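(* Let $f,\mu,u_0$ satisfy assumptions (A1)–(A4) listed in the context, and suppose there exists $\overline h\in\mathbb{R}$ such that $f(\overline h,\mu(\{u_0<\overline h\}))\le 0\le f(\overline h,\mu(\{u_0\le\overline h\}))$. Let $u_D,u_E:\mathbb{R}^n\times[0,\infty)\to\mathbb{R}$ be the functions defined in the context. Then $u_D=u_E$ on $\mathbb{R}^n\times[0,\infty)$, and $u:=u_D=u_E$ is the unique continuous viscosity solution of the Cauchy problem $$u_t(x,t)+|\nabla u(x,t)|\,f\big(u(x,t),\mu(\{u(\cdot,t)<u(x,t)\})\big)=0\ \text{ in }\mathbb{R}^n\times(0,\infty),\qquad u(\cdot,0)=u_0\ \text{ in }\mathbb{R}^n,$$ satisfying the growth condition: for any $T>0$ there exists $M_T>0$ such that $|u(x,t)|\le M_T(|x|+1)$ for all $(x,t)\in\mathbb{R}^n\times[0,T]$.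
   Context: Setting. $\mathcal{B}$ is the family of Lebesgue measurable subsets of $\mathbb{R}^n$; $f:\mathbb{R}\times[0,\infty)\to\mathbb{R}$, $\mu:\mathcal{B}\to[0,\infty)$, $u_0:\mathbb{R}^n\to\mathbb{R}$. (A1) $f$ is bounded and continuous, and there is a modulus of continuity $\omega_f$ with $|f(r,q_1)-f(r,q_2)|\le\omega_f(|q_1-q_2|)$ for all $r\in\mathbb{R}$, $q_1,q_2\ge0$. (A2) $f(r_1,q)\le f(r_2,q)$ for $r_1<r_2$, $q\ge0$; and $f(r,q_1)<f(r,q_2)$ for $r\in\mathbb{R}$, $0\le q_1<q_2$. (A3) $\mu(A)=\int_A\Theta(x)\,dx$ for $A\in\mathcal{B}$, where $\Theta\in L^1(\mathbb{R}^n)$, $\Theta>0$ in $\mathbb{R}^n$. (A4) $u_0$ is uniformly continuous and $\lim_{R\to\infty}\inf\{u_0(y):|y|\ge R\}>u_0(x)$ for every $x\in\mathbb{R}^n$. Viscosity solutions. A locally bounded upper semicontinuous $u:\mathbb{R}^n\times(0,\infty)\to\mathbb{R}$ is a viscosity subsolution of the equation if whenever $\varphi\in C^1(\mathbb{R}^n\times(0,\infty))$ and $u-\varphi$ has a local maximum at $(x_0,t_0)$, then $\varphi_t(x_0,t_0)+|\nabla\varphi(x_0,t_0)|f(u(x_0,t_0),\mu(\{u(\cdot,t_0)<u(x_0,t_0)\}))\le0$. A locally bounded lower semicontinuous $u$ is a viscosity supersolution if whenever $\varphi\in C^1$ and $u-\varphi$ has a local minimum at $(x_0,t_0)$, then $\varphi_t(x_0,t_0)+|\nabla\varphi(x_0,t_0)|f(u(x_0,t_0),\mu(\{u(\cdot,t_0)\le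 u(x_0,t_0)\}))\ge0$. A continuous function that is both is a viscosity solution. A continuous solution of the Cauchy problem is $u\in C(\mathbb{R}^n\times[0,\infty))$ that is a viscosity solution in $\mathbb{R}^n\times(0,\infty)$ with $u(\cdot,0)=u_0$. Parallel sets. For $h\in\mathbb{R}$: $D_h(0)=\{u_0<h\}$, $E_h(0)=\{u_0\le h\}$, and for $s\in\mathbb{R}$, $D_h(s)=\{x:\mathrm{sd}(x,D_h(0))<s\}$, $E_h(s)=\{x:\mathrm{sd}(x,E_h(0))\le s\}$, with $\mathrm{sd}(x,A)=\mathrm{dist}(x,A)-\mathrm{dist}(x,\mathbb{R}^n\setminus A)$ and $\mathrm{dist}(x,\emptyset)=+\infty$. Functions $\delta_D,\delta_E$. For $W\in\{D,E\}$ and $h\in\mathbb{R}$ consider Lipschitz $\delta:[0,\infty)\to\mathbb{R}$ with $\delta(0)=0$ and $f(h,\mu(\mathrm{int}\,W_h(\delta(t))))\le\delta'(t)\le f(h,\mu(\mathrm{cl}\,W_h(\delta(t))))$ for a.e. $t\ge0$. $\delta_D(\cdot,h)$ denotes the (pointwise) minimal such function for $W=D$, and $\delta_E(\cdot,h)$ the maximal such function for $W=E$ (these exist). Value functions. With $U_0(x,h)=u_0(x)-h$, $U_D(x,t,h)=\min\{U_0(y,h):|y-x|\le\delta_D(t,h)\}$ if $h>\overline h$, and $U_D(x,t,h)=\max\{U_0(y,h):|y-x|\le-\delta_D(t,h)\}$ if $h\le\overline h$; $U_E(x,t,h)=\min\{U_0(y,h):|y-x|\le\delta_E(t,h)\}$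 if $h\ge\overline h$, and $U_E(x,t,h)=\max\{U_0(y,h):|y-x|\le-\delta_E(t,h)\}$ if $h<\overline h$. Finally $u_D(x,t)=\sup\{h\in\mathbb{R}:U_D(x,t,h)\ge0\}$ and $u_E(x,t)=\inf\{h\in\mathbb{R}:U_E(x,t,h)\le0\}$. *)

theory Defs
  imports "HOL-Analysis.Analysis"
begin

definition modulus_of_continuity :: "(real \<Rightarrow> real) \<Rightarrow> bool" where
  "modulus_of_continuity \<omega> \<longleftrightarrow>
     \<omega> 0 = 0 \<and> mono_on {0..} \<omega> \<and> (\<omega> \<longlongrightarrow> 0) (at_right 0)"

definition usc_on :: "'a::topological_space set \<Rightarrow> ('a \<Rightarrow> real) \<Rightarrow> bool" where
  "usc_on S u \<longleftrightarrow> (\<forall>z\<in>S. \<forall>a. u z < a \<longrightarrow> (\<forall>\<^sub>F w in at z within S. u w < a))"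

definition lsc_on :: "'a::topological_space set \<Rightarrow> ('a \<Rightarrow> real) \<Rightarrow> bool" where
  "lsc_on S u \<longleftrightarrow> (\<forall>z\<in>S. \<forall>a. a < u z \<longrightarrow> (\<forall>\<^sub>F w in at z within S. a < u w))"

definition locally_bounded_on :: "'a::metric_space set \<Rightarrow> ('a \<Rightarrow> real) \<Rightarrow> bool" where
  "locally_bounded_on S u \<longleftrightarrow> (\<forall>z\<in>S. \<exists>e>0. bounded (u ` (ball z e \<inter> S)))"

definition local_max_on :: "'a::topological_space set \<Rightarrow> ('a \<Rightarrow> real) \<Rightarrow> 'a \<Rightarrow> bool" where
  "local_max_on S g z \<longleftrightarrow> z \<in> S \<and> (\<forall>\<^sub>F w in at z within S. g w \<le> g z)"

definition local_min_on :: "'a::topological_space set \<Rightarrow> ('a \<Rightarrow> real) \<Rightarrow> 'a \<Rightarrow> bool" where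
  "local_min_on S g z \<longleftrightarrow> z \<in> S \<and> (\<forall>\<^sub>F w in at z within S. g z \<le> g w)"


section \<open>Viscosity solutions\<close>

text \<open>Functions of space and time are functions of a pair \<open>(x, t)\<close>; their values
  at negative times are irrelevant.\<close>

abbreviation pos_time :: "((real^'n) \<times> real) set" where
  "pos_time \<equiv> UNIV \<times> {0<..}"

abbreviation nonneg_time :: "((real^'n) \<times> real) set" where
  "nonneg_time \<equiv> UNIV \<times> {0..}"

text \<open>The space-time gradient \<open>G z\<close> of \<open>\<phi>\<close> at \<open>z\<close> is the pair of the spatial gradient
  \<open>fst (G z)\<close> and the time derivative \<open>snd (G z)\<close>.\<close>

definition C1_with_gradient ::
    "((real^'n) \<times> real \<Rightarrow> real) \<Rightarrow> ((real^'n) \<times> real \<Rightarrow> (real^'n) \<times> real) \<Rightarrow> bool" where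
  "C1_with_gradient \<phi> G \<longleftrightarrow>
     (\<forall>z\<in>pos_time. GDERIV \<phi> z :> G z) \<and> continuous_on pos_time G"

definition viscosity_subsolution ::
    "(real \<Rightarrow> real \<Rightarrow> real) \<Rightarrow> ((real^'n) set \<Rightarrow> real) \<Rightarrow> ((real^'n) \<times> real \<Rightarrow> real) \<Rightarrow> bool" where
  "viscosity_subsolution f \<mu> u \<longleftrightarrow>
     locally_bounded_on pos_time u \<and> usc_on pos_time u \<and>
     (\<forall>\<phi> G x\<^sub>0 t\<^sub>0. C1_with_gradient \<phi> G \<longrightarrow>
        local_max_on pos_time (\<lambda>z. u z - \<phi> z) (x\<^sub>0, t\<^sub>0) \<longrightarrow>
        snd (G (x\<^sub>0, t\<^sub>0)) + norm (fst (G (x\<^sub>0, t\<^sub>0))) *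
          f (u (x\<^sub>0, t\<^sub>0)) (\<mu> {y. u (y, t\<^sub>0) < u (x\<^sub>0, t\<^sub>0)}) \<le> 0)"

definition viscosity_supersolution ::
    "(real \<Rightarrow> real \<Rightarrow> real) \<Rightarrow> ((real^'n) set \<Rightarrow> real) \<Rightarrow> ((real^'n) \<times> real \<Rightarrow> real) \<Rightarrow> bool" where
  "viscosity_supersolution f \<mu> u \<longleftrightarrow>
     locally_bounded_on pos_time u \<and> lsc_on pos_time u \<and>
     (\<forall>\<phi> G x\<^sub>0 t\<^sub>0. C1_with_gradient \<phi> G \<longrightarrow>
        local_min_on pos_time (\<lambda>z. u z - \<phi> z) (x\<^sub>0, t\<^sub>0) \<longrightarrow>
        snd (G (x\<^sub>0, t\<^sub>0)) + norm (fst (G (x\<^sub>0, t\<^sub>0))) *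
          f (u (x\<^sub>0, t\<^sub>0)) (\<mu> {y. u (y, t\<^sub>0) \<le> u (x\<^sub>0, t\<^sub>0)}) \<ge> 0)"

definition viscosity_solution ::
    "(real \<Rightarrow> real \<Rightarrow> real) \<Rightarrow> ((real^'n) set \<Rightarrow> real) \<Rightarrow> ((real^'n) \<times> real \<Rightarrow> real) \<Rightarrow> bool" where
  "viscosity_solution f \<mu> u \<longleftrightarrow>
     continuous_on pos_time u \<and> viscosity_subsolution f \<mu> u \<and> viscosity_supersolution f \<mu> u"

definition continuous_Cauchy_solution ::
    "(real \<Rightarrow> real \<Rightarrow> real) \<Rightarrow> ((real^'n) set \<Rightarrow> real) \<Rightarrow> (real^'n \<Rightarrow> real) \<Rightarrow>
     ((real^'n) \<times> real \<Rightarrow> real) \<Rightarrow> bool" where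
  "continuous_Cauchy_solution f \<mu> u\<^sub>0 u \<longleftrightarrow>
     continuous_on nonneg_time u \<and> viscosity_solution f \<mu> u \<and> (\<forall>x. u (x, 0) = u\<^sub>0 x)"

definition linear_growth :: "((real^'n) \<times> real \<Rightarrow> real) \<Rightarrow> bool" where
  "linear_growth u \<longleftrightarrow>
     (\<forall>T>0. \<exists>M>0. \<forall>x. \<forall>t\<in>{0..T}. \<bar>u (x, t)\<bar> \<le> M * (norm x + 1))"


section \<open>Parallel sets\<close>

text \<open>Unlike the library's \<^const>\<open>infdist\<close>, the distance to the empty set is \<open>\<infinity>\<close>. The
  difference in \<open>signed_dist\<close> is never \<open>\<infinity> - \<infinity>\<close>, as \<open>A\<close> and \<open>- A\<close> are not both empty.\<close>

definition set_dist :: "'a::metric_space \<Rightarrow> 'a set \<Rightarrow> ereal" where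
  "set_dist x A = (INF y\<in>A. ereal (dist x y))"

definition signed_dist :: "'a::metric_space \<Rightarrow> 'a set \<Rightarrow> ereal" where
  "signed_dist x A = set_dist x A - set_dist x (- A)"

definition D_set :: "(real^'n \<Rightarrow> real) \<Rightarrow> real \<Rightarrow> real \<Rightarrow> (real^'n) set" where
  "D_set u\<^sub>0 h s = {x. signed_dist x {y. u\<^sub>0 y < h} < ereal s}"

definition E_set :: "(real^'n \<Rightarrow> real) \<Rightarrow> real \<Rightarrow> real \<Rightarrow> (real^'n) set" where
  "E_set u\<^sub>0 h s = {x. signed_dist x {y. u\<^sub>0 y \<le> h} \<le> ereal s}"


section \<open>The functions \<open>\<delta>\<^sub>D\<close> and \<open>\<delta>\<^sub>E\<close>\<close>

definition front_displacement ::
    "(real \<Rightarrow> real \<Rightarrow> real) \<Rightarrow> ((real^'n) set \<Rightarrow> real) \<Rightarrow> (real \<Rightarrow> (real^'n) set) \<Rightarrow> real \<Rightarrow>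
     (real \<Rightarrow> real) \<Rightarrow> bool" where
  "front_displacement f \<mu> W h \<delta> \<longleftrightarrow>
     (\<exists>C. C-lipschitz_on {0..} \<delta>) \<and> \<delta> 0 = 0 \<and>
     (AE t in lebesgue. 0 \<le> t \<longrightarrow>
        (\<exists>d. (\<delta> has_real_derivative d) (at t within {0..}) \<and>
             f h (\<mu> (interior (W (\<delta> t)))) \<le> d \<and> d \<le> f h (\<mu> (closure (W (\<delta> t))))))"

text \<open>Pointwise minimality (maximality) determines the chosen function on \<open>[0,\<infinity>)\<close>; its
  values at negative times are arbitrary and never used.\<close>

definition delta_D ::
    "(real \<Rightarrow> real \<Rightarrow> real) \<Rightarrow> ((real^'n) set \<Rightarrow> real) \<Rightarrow> (real^'n \<Rightarrow> real) \<Rightarrow> real \<Rightarrow> real \<Rightarrow> real" where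
  "delta_D f \<mu> u\<^sub>0 t h =
     (SOME \<delta>. front_displacement f \<mu> (D_set u\<^sub>0 h) h \<delta> \<and>
        (\<forall>\<eta>. front_displacement f \<mu> (D_set u\<^sub>0 h) h \<eta> \<longrightarrow> (\<forall>s\<ge>0. \<delta> s \<le> \<eta> s))) t"

definition delta_E ::
    "(real \<Rightarrow> real \<Rightarrow> real) \<Rightarrow> ((real^'n) set \<Rightarrow> real) \<Rightarrow> (real^'n \<Rightarrow> real) \<Rightarrow> real \<Rightarrow> real \<Rightarrow> real" where
  "delta_E f \<mu> u\<^sub>0 t h =
     (SOME \<delta>. front_displacement f \<mu> (E_set u\<^sub>0 h) h \<delta> \<and>
        (\<forall>\<eta>. front_displacement f \<mu> (E_set u\<^sub>0 h) h \<eta> \<longrightarrow> (\<forall>s\<ge>0. \<eta> s \<le> \<delta> s))) t"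


section \<open>Value functions\<close>

text \<open>Extrema of the continuous function \<open>U_0 u\<^sub>0 _ h\<close> over compact balls are written as
  \<open>INF\<close> and \<open>SUP\<close>.\<close>

definition U_0 :: "(real^'n \<Rightarrow> real) \<Rightarrow> real^'n \<Rightarrow> real \<Rightarrow> real" where
  "U_0 u\<^sub>0 x h = u\<^sub>0 x - h"

definition U_D ::
    "(real \<Rightarrow> real \<Rightarrow> real) \<Rightarrow> ((real^'n) set \<Rightarrow> real) \<Rightarrow> (real^'n \<Rightarrow> real) \<Rightarrow> real \<Rightarrow>
     real^'n \<Rightarrow> real \<Rightarrow> real \<Rightarrow> real" where
  "U_D f \<mu> u\<^sub>0 hbar x t h =
     (if h > hbar then (INF y\<in>cball x (delta_D f \<mu> u\<^sub>0 t h). U_0 u\<^sub>0 y h)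
      else (SUP y\<in>cball x (- delta_D f \<mu> u\<^sub>0 t h). U_0 u\<^sub>0 y h))"

definition U_E ::
    "(real \<Rightarrow> real \<Rightarrow> real) \<Rightarrow> ((real^'n) set \<Rightarrow> real) \<Rightarrow> (real^'n \<Rightarrow> real) \<Rightarrow> real \<Rightarrow>
     real^'n \<Rightarrow> real \<Rightarrow> real \<Rightarrow> real" where
  "U_E f \<mu> u\<^sub>0 hbar x t h =
     (if h \<ge> hbar then (INF y\<in>cball x (delta_E f \<mu> u\<^sub>0 t h). U_0 u\<^sub>0 y h)
      else (SUP y\<in>cball x (- delta_E f \<mu> u\<^sub>0 t h). U_0 u\<^sub>0 y h))"

definition u_D ::
    "(real \<Rightarrow> real \<Rightarrow> real) \<Rightarrow> ((real^'n) set \<Rightarrow> real) \<Rightarrow> (real^'n \<Rightarrow> real) \<Rightarrow> real \<Rightarrow>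
     (real^'n) \<times> real \<Rightarrow> real" where
  "u_D f \<mu> u\<^sub>0 hbar = (\<lambda>(x, t). Sup {h. U_D f \<mu> u\<^sub>0 hbar x t h \<ge> 0})"

definition u_E ::
    "(real \<Rightarrow> real \<Rightarrow> real) \<Rightarrow> ((real^'n) set \<Rightarrow> real) \<Rightarrow> (real^'n \<Rightarrow> real) \<Rightarrow> real \<Rightarrow>
     (real^'n) \<times> real \<Rightarrow> real" where
  "u_E f \<mu> u\<^sub>0 hbar = (\<lambda>(x, t). Inf {h. U_E f \<mu> u\<^sub>0 hbar x t h \<le> 0})"

end

theory Submission
  imports Defs
begin

text \<open>Each level \<open>h\<close> moves on its own: the sublevel set \<open>{u\<^sub>0 < h}\<close> is replaced by a parallel
  set at signed distance \<open>\<delta>\<close>, where \<open>\<delta>' = f h (\<mu> (D\<^sub>h \<delta>))\<close>. By monotonicity this autonomous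
  equation expands fronts above \<open>hbar\<close> and shrinks them below, and fronts of different levels keep
  their initial distance. Hence \<open>\<delta>\<close> is monotone and left continuous in \<open>h\<close>, so that
  \<open>{u\<^sub>D(\<cdot>, t) < h}\<close> is exactly the parallel set \<open>D\<^sub>h (\<delta>\<^sub>D(t, h))\<close> and \<open>u\<^sub>D\<close> inherits the
  modulus of continuity of \<open>u\<^sub>0\<close>. The subsolution property follows by comparing a front with its
  position at a slightly earlier time.

  For uniqueness, let \<open>v\<close> be a subsolution and \<open>h' < h\<close>. As long as the explicit front of level
  \<open>h'\<close> is contained in \<open>{v \<le> h}\<close>, the set \<open>{v > h}\<close> retreats at least as fast as that front advances;
  the initial gap between them gives room to iterate this over short time steps, so \<open>v \<le> u\<^sub>D\<close>.

  The reflection \<open>u \<mapsto> - u\<close>, \<open>f r q \<mapsto> - f (- r) (\<mu> UNIV - q)\<close> exchanges \<open>D\<close> with \<open>E\<close> and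
  subsolutions with supersolutions, which yields the other half of every statement.\<close>

section \<open>Differential inequalities and monotone autonomous flows\<close>

text \<open>The speed of a level is only monotone in the displacement, so the autonomous equation
  has a jumping right-hand side and a level may admit several displacements. The choice of
  \<open>hbar\<close> fixes the sign of the speed on either side of it, which permits solving by
  separation of variables; the minimal displacement is then reached as an increasing limit of
  displacements of lower levels. Comparison always relates two different levels
  \<open>h1 < h2\<close>: their parallel sets are separated by a distance \<open>d\<close> that
  uniform continuity of \<open>u\<^sub>0\<close> provides for all displacements at once. Losing a
  little in the level is harmless, because levels form a continuum. This is also how
  \<open>u_D\<close> and \<open>u_E\<close> are shown to agree without comparing their displacements
  at one and the same level. In the comparison with a subsolution, the distance covered by the
  explicit front and the speed guaranteed for the subsolution refer to different times of a step.
  The front speed is monotone in time, so these errors telescope to a multiple of the step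
  length.\<close>

lemma lipschitz_nonneg_deriv_imp_le:
  fixes w :: "real \<Rightarrow> real"
  assumes lip: "L-lipschitz_on {a..b} w" and ab: "a \<le> b" and neg: "negligible N"
    and der: "\<And>t. t \<in> {a<..<b} - N \<Longrightarrow> \<exists>d\<ge>0. (w has_real_derivative d) (at t)"
  shows "w a \<le> w b"
proof (rule ccontr)
  assume "\<not> w a \<le> w b"
  then have wb: "w b < w a" and ab': "a < b"
    using ab by (auto simp: le_less)
  \<comment> \<open>The tilt by \<open>e\<close> uses up only half of the drop of \<open>w\<close>
    and turns the nonnegative derivatives off \<open>N\<close> into positive ones.\<close>
  define e where "e = (w a - w b) / (2 * (b - a))"
  have e: "e > 0" using wb ab' by (simp add: e_def)
  define G where "G t = w t + e * (t - a)" for t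
  have "e * (b - a) = (w a - w b) / 2"
    using ab' unfolding e_def by (simp add: divide_simps)
  then have Gb: "G b < G a"
    using wb by (simp add: G_def)
  have lipG: "(L + e)-lipschitz_on {a..b} G"
  proof (rule lipschitz_onI)
    show "0 \<le> L + e" using lipschitz_on_nonneg[OF lip] e by simp
    fix x y assume xy: "x \<in> {a..b}" "y \<in> {a..b}"
    have "\<bar>w x - w y\<bar> \<le> L * \<bar>x - y\<bar>"
      using lipschitz_onD[OF lip xy] by (simp add: dist_real_def)
    moreover have "\<bar>e * (x - a) - e * (y - a)\<bar> = e * \<bar>x - y\<bar>"
    proof -
      have "e * (x - a) - e * (y - a) = e * (x - y)" by (simp add: algebra_simps)
      then show ?thesis using e by (simp add: abs_mult)
    qed
    ultimately show "dist (G x) (G y) \<le> (L + e) * dist x y"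
      by (simp add: G_def dist_real_def distrib_right)
  qed
  have contG: "continuous_on {a..b} G"
    using lipschitz_on_continuous_on[OF lipG] .
  \<comment> \<open>A Lipschitz map sends null sets to null sets, so some level \<open>y\<close>
    strictly between \<open>G b\<close> and \<open>G a\<close> is missed by the exceptional set. At
    the last time with \<open>y \<le> G t\<close> the derivative then exists and is positive, which
    is absurd.\<close>
  have "negligible (G ` (N \<inter> {a..b}))"
  proof (rule negligible_locally_Lipschitz_image)
    show "DIM(real) \<le> DIM(real)" by simp
    show "negligible (N \<inter> {a..b})" using neg by (simp add: negligible_Int)
    fix x assume x: "x \<in> N \<inter> {a..b}"
    show "\<exists>T B. open T \<and> x \<in> T \<and> (\<forall>y\<in>N \<inter> {a..b} \<inter> T. norm (G y - G x) \<le> B * norm (y - x))"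
      using x lipschitz_onD[OF lipG] by (intro exI[of _ UNIV] exI[of _ "L + e"]) (auto simp: dist_norm)
  qed
  moreover have "\<not> negligible {G b<..<G a}"
    using Gb open_not_negligible[of "{G b<..<G a}"] by auto
  ultimately obtain y where y: "G b < y" "y < G a" "y \<notin> G ` (N \<inter> {a..b})"
    by (meson greaterThanLessThan_iff negligible_subset subsetI)
  define S where "S = {a..b} \<inter> G -` {y..}"
  have "closed S"
    unfolding S_def using contG by (intro continuous_closed_preimage) auto
  moreover have bdd: "bdd_above S" unfolding S_def by auto
  moreover have aS: "a \<in> S" unfolding S_def using y ab' by auto
  ultimately have tS: "Sup S \<in> S" by (intro closed_contains_Sup) auto
  define t where "t = Sup S"
  have t: "a \<le> t" "t < b" "y \<le> G t"
    using tS y by (auto simp: S_def t_def less_le)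
  have above: "G s < y" if "t < s" "s \<le> b" for s
  proof (rule ccontr)
    assume "\<not> G s < y"
    then have "s \<in> S" using that t by (auto simp: S_def)
    then have "s \<le> t" unfolding t_def using bdd by (rule cSup_upper)
    then show False using that by simp
  qed
  have "G t = y"
  proof (rule ccontr)
    assume "G t \<noteq> y"
    then have "y < G t" using t by simp
    moreover have "continuous_on {t..b} G"
      using contG by (rule continuous_on_subset) (use t in auto)
    ultimately obtain s where "t \<le> s" "s \<le> b" "G s = y"
      using IVT2'[of G b y t] y t by auto
    then show False using above[of s] \<open>y < G t\<close> by (cases "s = t") auto
  qed
  then have "t \<notin> N" "t \<noteq> a" using y t by auto
  then obtain d where d: "d \<ge> 0" "(w has_real_derivative d) (at t)"
    using der[of t] t by auto
  have "(G has_real_derivative d + e) (at t)"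
    unfolding G_def by (rule derivative_eq_intros refl d)+ simp
  then obtain r where r: "r > 0" "\<And>k. k > 0 \<Longrightarrow> k < r \<Longrightarrow> G t < G (t + k)"
    using DERIV_pos_inc_right[of G "d + e" t] d e by auto
  define k where "k = min (r / 2) (b - t)"
  have "k > 0" "k < r" "t + k \<le> b" using r t by (auto simp: k_def min_def)
  then show False using r(2)[of k] above[of "t + k"] \<open>G t = y\<close> by force
qed

text \<open>Separation of variables: the integral \<open>T b\<close> of \<open>1 / g\<close> is the
  time at which \<open>b\<close> is reached, and \<open>\<delta>\<close> inverts it. As
  \<open>g\<close> may jump, the differential equation is recorded by bounds on difference
  quotients, which come from bounding the monotone integrand by its end values.\<close>

lemma exists_autonomous_flow:
  fixes g :: "real \<Rightarrow> real"
  assumes g: "mono g" and g0: "g 0 > 0" and C: "\<And>a. g a \<le> C"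
  shows "\<exists>\<delta>. \<delta> 0 = 0 \<and> (\<forall>s t. 0 \<le> s \<longrightarrow> s \<le> t \<longrightarrow> \<delta> s \<le> \<delta> t \<and>
           (t - s) * g (\<delta> s) \<le> \<delta> t - \<delta> s \<and> \<delta> t - \<delta> s \<le> (t - s) * g (\<delta> t))"
proof -
  have gpos: "g a > 0" if "0 \<le> a" for a
    using monoD[OF g that] g0 by simp
  have "C > 0" using C[of 0] g0 by simp
  have int: "(\<lambda>a. 1 / g a) integrable_on {a..b}" if "0 \<le> a" for a b
  proof -
    have "mono_on {a..b} (\<lambda>a. - (1 / g a))"
    proof (rule mono_onI)
      fix x y assume "x \<in> {a..b}" "y \<in> {a..b}" "x \<le> y"
      then show "- (1 / g x) \<le> - (1 / g y)"
        using gpos[of x] gpos[of y] monoD[OF g, of x y] that by (simp add: frac_le)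
    qed
    then have "(\<lambda>a. - (1 / g a)) integrable_on {a..b}" by (rule integrable_on_mono_on)
    then show ?thesis using integrable_neg by fastforce
  qed
  define T where "T b = integral {0..b} (\<lambda>a. 1 / g a)" for b
  have Tdiff: "(b - a) / g b \<le> T b - T a \<and> T b - T a \<le> (b - a) / g a"
    if "0 \<le> a" "a \<le> b" for a b
  proof -
    have "T b - T a = integral {a..b} (\<lambda>a. 1 / g a)"
      using Henstock_Kurzweil_Integration.integral_combine[of 0 a b "\<lambda>a. 1 / g a"] that int
      by (auto simp: T_def)
    moreover have "integral {a..b} (\<lambda>x. 1 / g b) \<le> integral {a..b} (\<lambda>a. 1 / g a)"
      using that gpos g by (intro integral_le int) (auto simp: monoD frac_le)
    moreover have "integral {a..b} (\<lambda>a. 1 / g a) \<le> integral {a..b} (\<lambda>x. 1 / g a)"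
      using that gpos g by (intro integral_le int) (auto simp: monoD frac_le)
    ultimately show ?thesis using that by simp
  qed
  have T0: "T 0 = 0" by (simp add: T_def)
  have Tsmono: "T a < T b" if "0 \<le> a" "a < b" for a b
    using Tdiff[of a b] that gpos[of b] by (smt (verit) divide_pos_pos)
  have surj: "\<exists>b\<ge>0. T b = t" if "0 \<le> t" for t
  proof -
    \<comment> \<open>With speed at most \<open>C\<close> the position \<open>C * t\<close> is not
      reached before time \<open>t\<close>; this is the upper end for the intermediate value
      argument.\<close>
    have Ct: "0 \<le> C * t" using \<open>C > 0\<close> that by simp
    have "t \<le> C * t / g (C * t)"
      using mult_left_mono[OF C that, of "C * t"] gpos[OF Ct] by (simp add: pos_le_divide_eq mult.commute)
    then have "t \<le> T (C * t)" using Tdiff[of 0 "C * t"] Ct T0 by simp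
    moreover have "continuous_on {0..C * t} T"
      unfolding T_def by (rule indefinite_integral_continuous_1) (simp add: int)
    ultimately show ?thesis using IVT'[of T 0 t "C * t"] Ct T0 that by auto
  qed
  define \<delta> where "\<delta> t = (SOME b. b \<ge> 0 \<and> T b = t)" for t
  have \<delta>: "\<delta> t \<ge> 0" "T (\<delta> t) = t" if "0 \<le> t" for t
    using someI_ex[of "\<lambda>b. b \<ge> 0 \<and> T b = t"] surj[OF that] by (auto simp: \<delta>_def)
  have "\<delta> 0 = 0"
    using \<delta>[of 0] Tsmono[of 0 "\<delta> 0"] T0 by (cases "\<delta> 0 = 0") auto
  moreover have "\<delta> s \<le> \<delta> t \<and> (t - s) * g (\<delta> s) \<le> \<delta> t - \<delta> s \<and> \<delta> t - \<delta> s \<le> (t - s) * g (\<delta> t)"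
    if st: "0 \<le> s" "s \<le> t" for s t
  proof -
    have le: "\<delta> s \<le> \<delta> t"
      using \<delta>[of s] \<delta>[of t] st Tsmono[of "\<delta> t" "\<delta> s"] by force
    have "(\<delta> t - \<delta> s) / g (\<delta> t) \<le> t - s" "t - s \<le> (\<delta> t - \<delta> s) / g (\<delta> s)"
      using Tdiff[OF _ le] \<delta>[of s] \<delta>[of t] st by auto
    then show ?thesis
      using le gpos[of "\<delta> s"] gpos[of "\<delta> t"] \<delta>[of s] \<delta>[of t] st
      by (simp add: pos_divide_le_eq pos_le_divide_eq)
  qed
  ultimately show ?thesis by blast
qed

text \<open>\<open>m\<close> and \<open>p\<close> are lower and upper speeds that differ only at
  jumps. If they agree at \<open>\<delta> t0\<close>, the difference quotients are squeezed. If they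
  jump there, continuity in time forbids \<open>\<delta>\<close> to leave the value
  \<open>\<delta> t0\<close> nearby, and the derivative is 0; the last disjunct of the conclusion
  keeps this information.\<close>

lemma has_derivative_of_slope_bounds:
  fixes \<delta> m p :: "real \<Rightarrow> real"
  assumes t0: "0 \<le> t0"
    and m: "mono m" and p: "mono p" and mp: "\<And>a. m a \<le> p a" and pm: "\<And>a b. a < b \<Longrightarrow> p a \<le> m b"
    and slope: "\<And>s t. 0 \<le> s \<Longrightarrow> s \<le> t \<Longrightarrow>
        (t - s) * m (min (\<delta> s) (\<delta> t)) \<le> \<delta> t - \<delta> s \<and> \<delta> t - \<delta> s \<le> (t - s) * p (max (\<delta> s) (\<delta> t))"
    and contm: "continuous (at t0 within {0..}) (\<lambda>t. m (\<delta> t))"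
    and contp: "continuous (at t0 within {0..}) (\<lambda>t. p (\<delta> t))"
  shows "\<exists>d. (\<delta> has_real_derivative d) (at t0 within {0..}) \<and> m (\<delta> t0) \<le> d \<and> d \<le> p (\<delta> t0) \<and>
           (d = m (\<delta> t0) \<or> d = 0)"
proof -
  define F where "F = at t0 within {0::real..}"
  define Q where "Q t = (\<delta> t - \<delta> t0) / (t - t0)" for t
  have Fbot: "F \<noteq> bot"
  proof -
    have "t0 islimpt {t0..t0+1}" by (simp add: islimpt_Icc)
    then have "t0 islimpt {0..}" by (rule islimpt_subset) (use t0 in auto)
    then show ?thesis by (simp add: F_def trivial_limit_within)
  qed
  have cm: "((\<lambda>t. m (\<delta> t)) \<longlongrightarrow> m (\<delta> t0)) F" and cp: "((\<lambda>t. p (\<delta> t)) \<longlongrightarrow> p (\<delta> t0)) F"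
    using contm contp by (simp_all add: F_def continuous_within)
  have bounds: "min (m (\<delta> t)) (m (\<delta> t0)) \<le> Q t \<and> Q t \<le> max (p (\<delta> t)) (p (\<delta> t0))"
    if "0 \<le> t" "t \<noteq> t0" for t
  proof (cases "t < t0")
    case True
    then have "(t0 - t) * m (min (\<delta> t) (\<delta> t0)) \<le> \<delta> t0 - \<delta> t \<and>
        \<delta> t0 - \<delta> t \<le> (t0 - t) * p (max (\<delta> t) (\<delta> t0))"
      using slope[of t t0] that by simp
    moreover have "Q t = (\<delta> t0 - \<delta> t) / (t0 - t)"
      unfolding Q_def using True by (simp add: field_simps)
    ultimately show ?thesis
      using True by (simp add: pos_le_divide_eq pos_divide_le_eq min_of_mono[OF m] max_of_mono[OF p] mult.commute)
  next
    case False
    then have "(t - t0) * m (min (\<delta> t0) (\<delta> t)) \<le> \<delta> t - \<delta> t0 \<and>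
        \<delta> t - \<delta> t0 \<le> (t - t0) * p (max (\<delta> t0) (\<delta> t))"
      using slope[of t0 t] that t0 by simp
    then show ?thesis
      using False that unfolding Q_def
      by (simp add: pos_le_divide_eq pos_divide_le_eq min_of_mono[OF m] max_of_mono[OF p] mult.commute
          min.commute max.commute)
  qed
  have near: "eventually (\<lambda>t. 0 \<le> t \<and> t \<noteq> t0) F"
    unfolding F_def eventually_at_filter by simp
  have ev: "eventually (\<lambda>t. min (m (\<delta> t)) (m (\<delta> t0)) \<le> Q t) F"
       "eventually (\<lambda>t. Q t \<le> max (p (\<delta> t)) (p (\<delta> t0))) F"
    using near by (auto elim!: eventually_mono simp: bounds)
  have lims: "((\<lambda>t. min (m (\<delta> t)) (m (\<delta> t0))) \<longlongrightarrow> m (\<delta> t0)) F"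
       "((\<lambda>t. max (p (\<delta> t)) (p (\<delta> t0))) \<longlongrightarrow> p (\<delta> t0)) F"
    using tendsto_min[OF cm tendsto_const[of "m (\<delta> t0)"]] tendsto_max[OF cp tendsto_const[of "p (\<delta> t0)"]]
    by simp_all
  show ?thesis
  proof (cases "m (\<delta> t0) = p (\<delta> t0)")
    case True
    have "(Q \<longlongrightarrow> m (\<delta> t0)) F"
      by (rule tendsto_sandwich[OF ev]) (use lims True in simp_all)
    then have "(\<delta> has_real_derivative m (\<delta> t0)) (at t0 within {0..})"
      unfolding has_field_derivative_iff F_def Q_def .
    then show ?thesis using True by (intro exI[of _ "m (\<delta> t0)"]) simp
  next
    case False
    then have less: "m (\<delta> t0) < p (\<delta> t0)" using mp[of "\<delta> t0"] by simp
    have "eventually (\<lambda>t. m (\<delta> t) < p (\<delta> t0)) F" "eventually (\<lambda>t. m (\<delta> t0) < p (\<delta> t)) F"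
      using order_tendstoD[OF cm] order_tendstoD[OF cp] less by auto
    then have const: "eventually (\<lambda>t. \<delta> t = \<delta> t0) F"
      by eventually_elim (metis linorder_neq_iff not_less pm)
    then have Q0: "eventually (\<lambda>t. Q t = 0) F"
      by eventually_elim (simp add: Q_def)
    then have lim0: "(Q \<longlongrightarrow> 0) F" by (rule tendsto_eventually)
    then have "(\<delta> has_real_derivative 0) (at t0 within {0..})"
      unfolding has_field_derivative_iff F_def Q_def .
    moreover have "m (\<delta> t0) \<le> 0" by (rule tendsto_le[OF Fbot lim0 lims(1) ev(1)])
    moreover have "0 \<le> p (\<delta> t0)" by (rule tendsto_le[OF Fbot lims(2) lim0 ev(2)])
    ultimately show ?thesis by blast
  qed
qed

section \<open>Intermediate points on segments\<close>

lemma dist_split: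
  fixes x y :: "'a::real_normed_vector"
  assumes "dist x y \<le> r + s" "0 \<le> r" "0 \<le> s"
  obtains z where "dist x z \<le> r" "dist z y \<le> s"
proof (cases "dist x y \<le> r")
  case True
  then show ?thesis using that[of y] assms by simp
next
  case False
  define k where "k = r / dist x y"
  have "dist x y > 0" using False assms by linarith
  then have d: "dist x y > 0" "k * dist x y = r" "0 \<le> k" "k \<le> 1"
    using False assms by (simp_all add: k_def)
  define z where "z = x + k *\<^sub>R (y - x)"
  have "dist x z = r"
    using d by (simp add: z_def dist_norm norm_minus_commute)
  moreover have "z - y = (1 - k) *\<^sub>R (x - y)" by (simp add: z_def algebra_simps)
  then have "dist z y = (1 - k) * dist x y" using d by (simp add: dist_norm)
  then have "dist z y \<le> s" using d assms by (simp add: algebra_simps)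
  ultimately show ?thesis using that[of z] by simp
qed

lemma dist_split_less:
  fixes x y :: "'a::real_normed_vector"
  assumes "dist x y < r + s" "0 < r" "0 \<le> s"
  obtains z where "dist x z < r" "dist z y \<le> s"
proof -
  define r' where "r' = max 0 (dist x y - s)"
  have "dist x y \<le> r' + s" "0 \<le> r'" by (auto simp: r'_def)
  then obtain z where "dist x z \<le> r'" "dist z y \<le> s"
    using dist_split[of x y r' s] assms by blast
  moreover have "r' < r" using assms by (auto simp: r'_def)
  ultimately show ?thesis using that[of z] by simp
qed

section \<open>Parallel sets\<close>

lemma set_dist_nonneg: "0 \<le> set_dist x A"
  unfolding set_dist_def by (rule INF_greatest) simp

lemma set_dist_eq_0: "x \<in> A \<Longrightarrow> set_dist x A = 0"
  using INF_lower[of x A "\<lambda>y. ereal (dist x y)"] set_dist_nonneg[of x A]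
  by (intro antisym) (auto simp: set_dist_def zero_ereal_def)

lemma set_dist_less_iff: "set_dist x A < ereal s \<longleftrightarrow> (\<exists>y\<in>A. dist x y < s)"
  unfolding set_dist_def by (simp add: INF_less_iff)

lemma less_set_dist_iff:
  fixes A :: "'a::heine_borel set"
  assumes "closed A"
  shows "ereal s < set_dist x A \<longleftrightarrow> (\<forall>y\<in>A. s < dist x y)"
proof (cases "A = {}")
  case True
  then show ?thesis by (simp add: set_dist_def top_ereal_def)
next
  case False
  obtain z where z: "z \<in> A" "infdist x A = dist x z"
    using infdist_attains_inf[OF assms False] by blast
  then have "set_dist x A = ereal (dist x z)"
    unfolding set_dist_def using infdist_le[of _ A x]
    by (intro antisym INF_lower INF_greatest) auto
  then show ?thesis
    using z infdist_le[of _ A x] by (auto intro: less_le_trans)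
qed

lemma signed_dist_compl: "signed_dist x (- A) = - signed_dist x A"
  by (cases "x \<in> A") (simp_all add: signed_dist_def set_dist_eq_0)

lemma D_set_pos:
  assumes "0 < s"
  shows "D_set u h s = {x. \<exists>y. dist x y < s \<and> u y < h}"
proof -
  have "signed_dist x {y. u y < h} < ereal s \<longleftrightarrow> (\<exists>y. dist x y < s \<and> u y < h)" for x
  proof (cases "u x < h")
    case True
    then have "signed_dist x {y. u y < h} = - set_dist x (- {y. u y < h})"
      by (simp add: signed_dist_def set_dist_eq_0)
    also have "\<dots> \<le> 0" using set_dist_nonneg[of x "- {y. u y < h}"] by simp
    also have "0 < ereal s" using assms by simp
    finally show ?thesis using True assms by (metis dist_self)
  next
    case False
    then have "signed_dist x {y. u y < h} = set_dist x {y. u y < h}"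
      by (simp add: signed_dist_def set_dist_eq_0)
    then show ?thesis by (auto simp: set_dist_less_iff)
  qed
  then show ?thesis by (auto simp: D_set_def)
qed

text \<open>The complement of the sublevel set is closed, so its distance is attained and the strict
  inequality becomes a condition on a closed ball. For positive \<open>s\<close> the ball is open;
  this asymmetry causes the case distinctions on signs below.\<close>

lemma D_set_nonpos:
  assumes u: "continuous_on UNIV u" and "s \<le> 0"
  shows "D_set u h s = {x. \<forall>y. dist x y \<le> - s \<longrightarrow> u y < h}"
proof -
  have "closed (- {y. u y < h})"
    using u by (auto simp: closed_def intro!: open_Collect_less continuous_on_const)
  note closed = less_set_dist_iff[OF this]
  have "signed_dist x {y. u y < h} < ereal s \<longleftrightarrow> (\<forall>y. dist x y \<le> - s \<longrightarrow> u y < h)" for x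
  proof (cases "u x < h")
    case True
    then have "signed_dist x {y. u y < h} = - set_dist x (- {y. u y < h})"
      by (simp add: signed_dist_def set_dist_eq_0)
    then have "signed_dist x {y. u y < h} < ereal s \<longleftrightarrow> ereal (- s) < set_dist x (- {y. u y < h})"
      by (metis ereal_minus_less_minus ereal_uminus_uminus uminus_ereal.simps(1))
    then show ?thesis by (auto simp: closed not_less[symmetric])
  next
    case False
    then have "signed_dist x {y. u y < h} = set_dist x {y. u y < h}"
      by (simp add: signed_dist_def set_dist_eq_0)
    moreover have "ereal s \<le> 0" using assms by simp
    ultimately have "\<not> signed_dist x {y. u y < h} < ereal s"
      using set_dist_nonneg[of x "{y. u y < h}"] by (metis leD order_trans)
    moreover have "\<not> (\<forall>y. dist x y \<le> - s \<longrightarrow> u y < h)"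
      using False assms by (auto intro!: exI[of _ x])
    ultimately show ?thesis by simp
  qed
  then show ?thesis by (auto simp: D_set_def)
qed

text \<open>The signed distance changes sign under complementation. This identity is what lets
  reflection exchange the \<open>D\<close> and \<open>E\<close> families.\<close>

lemma E_set_eq_compl_D_set: "E_set u h s = - D_set (\<lambda>x. - u x) (- h) (- s)"
proof -
  have "{y. - u y < - h} = - {y. u y \<le> h}" by auto
  then show ?thesis
    by (auto simp: E_set_def D_set_def signed_dist_compl not_less
        ereal_uminus_le_reorder simp flip: uminus_ereal.simps(1))
qed

lemma D_set_mono:
  assumes u: "continuous_on UNIV u" and "h \<le> h'" "s \<le> s'"
  shows "D_set u h s \<subseteq> D_set u h' s'"
proof -
  have "D_set u h s \<subseteq> D_set u h s'"
    using assms unfolding D_set_def by (auto intro: less_le_trans)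
  moreover have "D_set u h s' \<subseteq> D_set u h' s'"
    using \<open>h \<le> h'\<close>
    by (cases "0 < s'") (auto simp: D_set_pos D_set_nonpos[OF u] intro: less_le_trans)
  ultimately show ?thesis by simp
qed

lemma D_set_0: "continuous_on UNIV u \<Longrightarrow> D_set u h 0 = {x. u x < h}"
  by (auto simp: D_set_nonpos)

text \<open>The signed distance is 1-Lipschitz; working with the sets avoids arithmetic with
  infinite distances. When the sign changes from \<open>b\<close> to \<open>b + r\<close>, an
  intermediate point on the segment does the work.\<close>

lemma D_set_dist_less:
  assumes u: "continuous_on UNIV u" and y: "y \<in> D_set u h b" and r: "dist x y < r"
  shows "x \<in> D_set u h (b + r)"
proof (cases "0 < b")
  case True
  then obtain z where "dist y z < b" "u z < h" using y by (auto simp: D_set_pos)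
  moreover have "0 < b + r" using True r zero_le_dist[of x y] by linarith
  ultimately show ?thesis
    using r dist_triangle[of x z y] by (auto simp: D_set_pos intro!: exI[of _ z])
next
  case False
  then have yb: "\<And>z. dist y z \<le> - b \<Longrightarrow> u z < h"
    using y by (auto simp: D_set_nonpos[OF u])
  show ?thesis
  proof (cases "0 < b + r")
    case True
    obtain z where "dist x z < b + r" "dist z y \<le> - b"
      using dist_split_less[of x y "b + r" "- b"] r True False by auto
    then show ?thesis using True yb by (auto simp: D_set_pos dist_commute)
  next
    case nonpos: False
    have "u z < h" if "dist x z \<le> - (b + r)" for z
      using yb[of z] that r dist_triangle[of y z x] by (simp add: dist_commute)
    then show ?thesis using nonpos by (auto simp: D_set_nonpos[OF u])
  qed
qed

lemma open_D_set:
  assumes u: "continuous_on UNIV u"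
  shows "open (D_set u h s)"
proof (subst open_dist, intro ballI)
  fix x assume x: "x \<in> D_set u h s"
  have "\<exists>b<s. x \<in> D_set u h b"
  proof -
    obtain b where "signed_dist x {y. u y < h} < ereal b" "b < s"
      using x ereal_dense2[of "signed_dist x {y. u y < h}" "ereal s"] by (auto simp: D_set_def)
    then show ?thesis by (auto simp: D_set_def)
  qed
  then obtain b where "b < s" "x \<in> D_set u h b" by blast
  then show "\<exists>e>0. \<forall>y. dist y x < e \<longrightarrow> y \<in> D_set u h s"
    using D_set_dist_less[OF u, of x h b _ "s - b"] by (intro exI[of _ "s - b"]) auto
qed

lemma closed_E_set: "continuous_on UNIV u \<Longrightarrow> closed (E_set u h s)"
  by (auto simp: E_set_eq_compl_D_set intro!: open_D_set continuous_intros)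

text \<open>A shift by \<open>d\<close> raises \<open>u\<close> by less than \<open>e\<close>, so
  passing to the level \<open>h + e\<close> pays for a retreat by \<open>d\<close>. It is essential
  that one \<open>d\<close> serves all \<open>h\<close> and \<open>a\<close>: a gap between two
  fronts then persists whatever their displacement.\<close>

lemma D_set_gap:
  fixes u :: "real^'n \<Rightarrow> real"
  assumes u: "uniformly_continuous_on UNIV u" and e: "0 < e"
  obtains d where "0 < d" "\<And>h a. D_set u h a \<subseteq> D_set u (h + e) (a - d)"
proof -
  obtain d0 where d0: "d0 > 0" "\<And>x y. dist x y < d0 \<Longrightarrow> dist (u x) (u y) < e"
    using uniformly_continuous_onE[OF u e] by (auto simp: dist_commute)
  have uc: "continuous_on UNIV u" using u by (rule uniformly_continuous_imp_continuous)
  define d where "d = d0 / 2"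
  have d: "0 < d" "d < d0" using d0 by (auto simp: d_def)
  have close: "u y < h + e" if "dist x y \<le> d" "u x < h" for x y h
    using d0(2)[of x y] that d by (simp add: dist_real_def)
  have "x \<in> D_set u (h + e) (a - d)" if x: "x \<in> D_set u h a" for x h a
  proof (cases "0 < a")
    case True
    then obtain y where y: "dist x y < a" "u y < h" using x by (auto simp: D_set_pos)
    show ?thesis
    proof (cases "0 < a - d")
      case True
      obtain z where "dist x z < a - d" "dist z y \<le> d"
        using dist_split_less[of x y "a - d" d] True y d by auto
      then show ?thesis using close[of y z h] y True by (auto simp: D_set_pos dist_commute)
    next
      case False
      have "u z < h + e" if "dist x z \<le> d - a" for z
        using close[of y z h] dist_triangle[of y z x] y that by (simp add: dist_commute)
      then show ?thesis using False by (auto simp: D_set_nonpos[OF uc])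
    qed
  next
    case False
    then have xa: "\<And>y. dist x y \<le> - a \<Longrightarrow> u y < h"
      using x by (auto simp: D_set_nonpos[OF uc])
    have "u z < h + e" if "dist x z \<le> d - a" for z
    proof -
      have "dist x z \<le> - a + d" using that by simp
      then obtain y where "dist x y \<le> - a" "dist y z \<le> d"
        by (rule dist_split) (use False d in auto)
      then show ?thesis using close xa by blast
    qed
    then show ?thesis using False d by (auto simp: D_set_nonpos[OF uc])
  qed
  then show ?thesis using that d by blast
qed

lemma D_set_subset_E_set:
  fixes u :: "real^'n \<Rightarrow> real"
  shows "D_set u h s \<subseteq> E_set u h s"
proof
  fix x assume x: "x \<in> D_set u h s"
  have anti: "set_dist x B \<le> set_dist x A" if "A \<subseteq> B" for A B :: "(real^'n) set"
    unfolding set_dist_def using that by (rule INF_superset_mono) simp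
  have "signed_dist x {y. u y \<le> h} \<le> signed_dist x {y. u y < h}"
    unfolding signed_dist_def by (rule ereal_minus_mono; rule anti) auto
  also have "\<dots> < ereal s" using x by (simp add: D_set_def)
  finally show "x \<in> E_set u h s" by (simp add: E_set_def)
qed

lemma E_set_subset_D_set:
  assumes u: "continuous_on UNIV u" and h: "h < h'" and s: "s < s'"
  shows "E_set u h s \<subseteq> D_set u h' s'"
proof
  fix x assume x: "x \<in> E_set u h s"
  have nu: "continuous_on UNIV (\<lambda>x. - u x)" using u by (intro continuous_intros)
  show "x \<in> D_set u h' s'"
  proof (cases "0 \<le> s")
    case True
    then obtain y where "dist x y \<le> s" "u y \<le> h"
      using x by (auto simp: E_set_eq_compl_D_set D_set_nonpos[OF nu] not_less)
    then show ?thesis using True h s by (auto simp: D_set_pos intro!: exI[of _ y])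
  next
    case False
    then have xs: "u y \<le> h" if "dist x y < - s" for y
      using x that by (force simp: E_set_eq_compl_D_set D_set_pos not_less)
    show ?thesis
    proof (cases "0 < s'")
      case True
      then show ?thesis using xs[of x] False h by (auto simp: D_set_pos intro!: exI[of _ x])
    next
      case False
      have "u y < h'" if "dist x y \<le> - s'" for y
        using xs[of y] that h s by simp
      then show ?thesis using False by (simp add: D_set_nonpos[OF u])
    qed
  qed
qed

text \<open>Left continuity of the parallel sets jointly in level and displacement. For
  \<open>0 < a\<close> one witness satisfies strict inequalities and survives. For
  \<open>a \<le> 0\<close> the maximum of \<open>u\<close> over a compact ball is below
  \<open>h\<close>, and stays so on a slightly larger ball.\<close>

lemma D_set_subset_UN:
  fixes u :: "real^'n \<Rightarrow> real"
  assumes u: "continuous_on UNIV u"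
    and h: "hs \<longlonglongrightarrow> h" "\<And>k. hs k \<le> h" and a: "as \<longlonglongrightarrow> a" "\<And>k. as k \<le> a"
  shows "D_set u h a \<subseteq> (\<Union>k. D_set u (hs k) (as k))"
proof
  fix x assume x: "x \<in> D_set u h a"
  have "\<exists>k. x \<in> D_set u (hs k) (as k)"
  proof (cases "0 < a")
    case True
    then obtain y where y: "dist x y < a" "u y < h" using x by (auto simp: D_set_pos)
    have "eventually (\<lambda>k. u y < hs k \<and> max 0 (dist x y) < as k) sequentially"
      using order_tendstoD(1)[OF h(1) y(2)] order_tendstoD(1)[OF a(1), of "max 0 (dist x y)"] y True
      by (intro eventually_conj) simp_all
    then obtain k where "u y < hs k" "max 0 (dist x y) < as k"
      using eventually_happens trivial_limit_sequentially by blast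
    then have "u y < hs k" "0 < as k" "dist x y < as k"
      using le_less_trans[OF zero_le_dist, of x y "as k"] by simp_all
    then show ?thesis using y by (auto simp: D_set_pos intro!: exI[of _ k])
  next
    case False
    obtain z where z: "dist x z \<le> - a" "\<And>y. dist x y \<le> - a \<Longrightarrow> u y \<le> u z"
    proof -
      have "\<exists>z\<in>cball x (- a). \<forall>y\<in>cball x (- a). u y \<le> u z"
        using False by (intro continuous_attains_sup[OF _ _ continuous_on_subset[OF u]]) auto
      then show ?thesis using that by auto
    qed
    have zh: "u z < h" using x False z by (auto simp: D_set_nonpos[OF u])
    \<comment> \<open>Half of the slack is for the enlargement of the ball, the other half for the
      approach of \<open>hs k\<close> to \<open>h\<close>.\<close>
    define e where "e = (h - u z) / 2"
    have e: "e > 0" using zh by (simp add: e_def)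
    have "uniformly_continuous_on (cball x (1 - a)) u"
      by (rule compact_uniformly_continuous[OF continuous_on_subset[OF u]]) auto
    then obtain d where d: "d > 0"
      "\<And>y y'. dist x y \<le> 1 - a \<Longrightarrow> dist x y' \<le> 1 - a \<Longrightarrow> dist y' y < d \<Longrightarrow> dist (u y') (u y) < e"
      using uniformly_continuous_onE[OF _ e] by (metis mem_cball)
    define r where "r = min 1 (d / 2)"
    have r: "0 < r" "r \<le> 1" "r < d" using d by (auto simp: r_def min_def)
    have "eventually (\<lambda>k. h - e < hs k \<and> a - r < as k) sequentially"
      using order_tendstoD(1)[OF h(1), of "h - e"] order_tendstoD(1)[OF a(1), of "a - r"] e r
      by (intro eventually_conj) simp_all
    then obtain k where k: "h - e < hs k" "a - r < as k"
      using eventually_happens trivial_limit_sequentially by blast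
    have "u y < hs k" if y: "dist x y \<le> - as k" for y
    proof -
      have xy: "dist x y \<le> r - a" using y k by simp
      then obtain y' where y': "dist x y' \<le> - a" "dist y' y \<le> r"
        using dist_split[of x y "- a" r] False r by auto
      have "dist (u y') (u y) < e"
        using d(2)[of y y'] y' xy r by simp
      then have "u y < u z + e" using z(2)[OF y'(1)] by (simp add: dist_real_def)
      also have "\<dots> = h - e" by (simp add: e_def field_simps)
      finally show ?thesis using k by simp
    qed
    moreover have "as k \<le> 0" using a(2)[of k] False by linarith
    ultimately have "x \<in> D_set u (hs k) (as k)" by (simp add: D_set_nonpos[OF u])
    then show ?thesis ..
  qed
  then show "x \<in> (\<Union>k. D_set u (hs k) (as k))" by blast
qed

text \<open>This is \<open>{x. signed_dist x {u < h} \<le> s}\<close>, which for \<open>s < 0\<close> can be larger than the closure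
  of \<open>D_set u h s\<close>.\<close>

definition Dc_set :: "(real^'n \<Rightarrow> real) \<Rightarrow> real \<Rightarrow> real \<Rightarrow> (real^'n) set" where
  "Dc_set u h s = (\<Inter>a\<in>{s<..}. D_set u h a)"

lemma Dc_setD: "x \<in> Dc_set u h s \<Longrightarrow> s < a \<Longrightarrow> x \<in> D_set u h a"
  by (auto simp: Dc_set_def)

lemma Dc_set_borel:
  assumes u: "continuous_on UNIV u"
  shows "Dc_set u h s \<in> sets borel"
proof -
  have "Dc_set u h s = (\<Inter>k::nat. D_set u h (s + 1 / Suc k))"
  proof (intro equalityI subsetI)
    fix x assume x: "x \<in> (\<Inter>k::nat. D_set u h (s + 1 / Suc k))"
    show "x \<in> Dc_set u h s"
      unfolding Dc_set_def
    proof (intro INT_I)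
      fix a assume "a \<in> {s<..}"
      then obtain k :: nat where "1 / Suc k < a - s"
        using nat_approx_posE[of "a - s"] by auto
      then have "D_set u h (s + 1 / Suc k) \<subseteq> D_set u h a"
        by (intro D_set_mono[OF u]) auto
      then show "x \<in> D_set u h a" using x by blast
    qed
  qed (auto simp: Dc_set_def)
  also have "\<dots> \<in> sets borel"
    by (intro sets.countable_INT'') (auto intro: borel_open open_D_set[OF u])
  finally show ?thesis .
qed

lemma Dc_set_mono:
  assumes u: "continuous_on UNIV u" and "h \<le> h'" "s \<le> s'"
  shows "Dc_set u h s \<subseteq> Dc_set u h' s'"
  unfolding Dc_set_def using \<open>s \<le> s'\<close> D_set_mono[OF u \<open>h \<le> h'\<close> order_refl]
  by (intro INT_greatest) (meson INT_lower greaterThan_iff le_less_trans order_trans)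

lemma D_set_subset_Dc_set: "continuous_on UNIV u \<Longrightarrow> D_set u h s \<subseteq> Dc_set u h s"
  unfolding Dc_set_def by (intro INT_greatest D_set_mono) auto

lemma Dc_set_subset_D_set: "s < s' \<Longrightarrow> Dc_set u h s \<subseteq> D_set u h s'"
  unfolding Dc_set_def by auto

lemma closure_D_set_subset:
  assumes u: "continuous_on UNIV u"
  shows "closure (D_set u h s) \<subseteq> Dc_set u h s"
proof
  fix x assume x: "x \<in> closure (D_set u h s)"
  show "x \<in> Dc_set u h s"
    unfolding Dc_set_def
  proof (intro INT_I)
    fix a assume "a \<in> {s<..}"
    then obtain y where "y \<in> D_set u h s" "dist y x < a - s"
      using x unfolding closure_approachable by (metis diff_gt_0_iff_gt greaterThan_iff)
    then show "x \<in> D_set u h a" using D_set_dist_less[OF u, of y h s x "a - s"] by (simp add: dist_commute)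
  qed
qed

text \<open>A small move towards the sublevel set brings a point of \<open>Dc_set u h s\<close> into
  \<open>D_set u h s\<close>. For \<open>s < 0\<close> this fails: if the sublevel set is an
  interval of length \<open>- 2 * s\<close>, then \<open>D_set u h s\<close> is empty while
  \<open>Dc_set u h s\<close> contains the midpoint.\<close>

lemma closure_D_set_nonneg:
  assumes u: "continuous_on UNIV u" and "0 \<le> s"
  shows "closure (D_set u h s) = Dc_set u h s"
proof (intro equalityI closure_D_set_subset[OF u] subsetI)
  fix x assume x: "x \<in> Dc_set u h s"
  show "x \<in> closure (D_set u h s)"
    unfolding closure_approachable
  proof (intro allI impI)
    fix e :: real assume e: "0 < e"
    have "x \<in> D_set u h (s + e / 2)" using Dc_setD[OF x] e by simp
    moreover have "0 < s + e / 2" using assms e by simp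
    ultimately obtain z where z: "dist x z < s + e / 2" "u z < h"
      by (auto simp: D_set_pos)
    show "\<exists>y\<in>D_set u h s. dist y x < e"
    proof (cases "s = 0")
      case True
      then show ?thesis using z e by (intro bexI[of _ z]) (auto simp: D_set_0[OF u] dist_commute)
    next
      case False
      then have s: "0 < s" using assms by simp
      have "dist z x < s + e / 2" using z by (simp add: dist_commute)
      then obtain y where y: "dist z y < s" "dist y x \<le> e / 2"
        by (rule dist_split_less) (use s e in auto)
      then have "\<exists>z. dist y z < s \<and> u z < h"
        using z by (intro exI[of _ z]) (simp add: dist_commute)
      then have "y \<in> D_set u h s" using s by (simp add: D_set_pos)
      then show ?thesis using y e by (intro bexI[of _ y]) auto
    qed
  qed
qed

lemma Dc_set_expand:
  assumes u: "continuous_on UNIV u" and "0 \<le> b" "b \<le> b'" and x: "x \<in> Dc_set u h b'" and "0 < e"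
  obtains y where "y \<in> Dc_set u h b" "dist x y < b' - b + e"
proof -
  have "x \<in> D_set u h (b' + e)" using Dc_setD[OF x] \<open>0 < e\<close> by simp
  then obtain z where z: "dist x z < b' - b + e + b" "u z < h"
    using assms by (auto simp: D_set_pos)
  obtain y where y: "dist x y < b' - b + e" "dist y z \<le> b"
    by (rule dist_split_less[OF z(1)]) (use assms in auto)
  have "y \<in> D_set u h a" if "b < a" for a
  proof -
    have "\<exists>z. dist y z < a \<and> u z < h" using y z that by (intro exI[of _ z]) simp
    then show ?thesis using assms that by (simp add: D_set_pos)
  qed
  then have "y \<in> Dc_set u h b" by (simp add: Dc_set_def)
  then show ?thesis using that y by blast
qed

lemma Dc_set_dist_le:
  assumes u: "continuous_on UNIV u" and x: "x \<in> Dc_set u h a" and r: "dist x y \<le> r"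
  shows "y \<in> Dc_set u h (a + r)"
proof -
  have "y \<in> D_set u h b" if "a + r < b" for b
  proof -
    define e where "e = (b - (a + r)) / 2"
    have e: "0 < e" using that by (simp add: e_def)
    have "x \<in> D_set u h (a + e)" using Dc_setD[OF x] e by simp
    then have "y \<in> D_set u h (a + e + (r + e))"
      by (rule D_set_dist_less[OF u]) (use r e in \<open>simp add: dist_commute\<close>)
    moreover have "a + e + (r + e) = b" by (simp add: e_def field_simps)
    ultimately show ?thesis by simp
  qed
  then show ?thesis by (simp add: Dc_set_def)
qed

section \<open>Displacement of a single level\<close>

text \<open>The hypotheses on \<open>f\<close> are restricted to \<open>q \<le> \<mu> UNIV\<close> to make them invariant under
  \<open>f r q \<mapsto> - f (- r) (\<mu> UNIV - q)\<close>.\<close>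

locale nonlocal_front =
  fixes f :: "real \<Rightarrow> real \<Rightarrow> real" and \<mu> :: "(real^'n) set \<Rightarrow> real"
    and u\<^sub>0 :: "real^'n \<Rightarrow> real" and hbar C :: real
  assumes f_bound: "\<And>r q. 0 \<le> q \<Longrightarrow> q \<le> \<mu> UNIV \<Longrightarrow> \<bar>f r q\<bar> \<le> C"
    and f_cont: "continuous_on (UNIV \<times> {0..\<mu> UNIV}) (\<lambda>(r, q). f r q)"
    and f_mono_r: "\<And>r r' q. r < r' \<Longrightarrow> 0 \<le> q \<Longrightarrow> q \<le> \<mu> UNIV \<Longrightarrow> f r q \<le> f r' q"
    and f_strict_q: "\<And>r q q'. 0 \<le> q \<Longrightarrow> q < q' \<Longrightarrow> q' \<le> \<mu> UNIV \<Longrightarrow> f r q < f r q'"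
    and mu_nonneg: "\<And>A. A \<in> sets borel \<Longrightarrow> 0 \<le> \<mu> A"
    and mu_compl: "\<And>A. A \<in> sets borel \<Longrightarrow> \<mu> (- A) = \<mu> UNIV - \<mu> A"
    and mu_mono: "\<And>A B. A \<in> sets borel \<Longrightarrow> B \<in> sets borel \<Longrightarrow> A \<subseteq> B \<Longrightarrow> \<mu> A \<le> \<mu> B"
    and mu_strict: "\<And>A B U. A \<in> sets borel \<Longrightarrow> B \<in> sets borel \<Longrightarrow> A \<subseteq> B \<Longrightarrow>
          open U \<Longrightarrow> U \<noteq> {} \<Longrightarrow> U \<subseteq> B - A \<Longrightarrow> \<mu> A < \<mu> B"
    and mu_incseq: "\<And>A. (\<And>k::nat. A k \<in> sets borel) \<Longrightarrow> incseq A \<Longrightarrow> (\<lambda>k. \<mu> (A k)) \<longlonglongrightarrow> \<mu> (\<Union>k. A k)"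
    and u0_unif: "uniformly_continuous_on UNIV u\<^sub>0"
    and hbar_D: "f hbar (\<mu> {x. u\<^sub>0 x < hbar}) \<le> 0"
    and hbar_E: "0 \<le> f hbar (\<mu> {x. u\<^sub>0 x \<le> hbar})"
begin

lemma u0_cont: "continuous_on UNIV u\<^sub>0"
  using u0_unif by (rule uniformly_continuous_imp_continuous)

lemma open_sublevel: "open {x. u\<^sub>0 x < h}" and closed_sublevel: "closed {x. u\<^sub>0 x \<le> h}"
  and open_between: "open {x. h < u\<^sub>0 x \<and> u\<^sub>0 x < h'}"
  using u0_cont by (auto intro!: open_Collect_less closed_Collect_le open_Collect_conj continuous_on_const)

lemma mu_range: "A \<in> sets borel \<Longrightarrow> 0 \<le> \<mu> A \<and> \<mu> A \<le> \<mu> UNIV"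
  by (simp add: mu_nonneg mu_mono)

lemma f_mu_mono:
  assumes "r \<le> r'" "A \<in> sets borel" "B \<in> sets borel" "A \<subseteq> B"
  shows "f r (\<mu> A) \<le> f r' (\<mu> B)"
proof -
  have "f r (\<mu> A) \<le> f r' (\<mu> A)"
    using f_mono_r[of r r' "\<mu> A"] mu_range[of A] assms by (cases "r = r'") auto
  also have "\<dots> \<le> f r' (\<mu> B)"
    using f_strict_q[of "\<mu> A" "\<mu> B" r'] mu_range[of A] mu_range[of B] mu_mono[of A B] assms
    by (cases "\<mu> A = \<mu> B") auto
  finally show ?thesis .
qed

lemma f_mu_strict:
  assumes "r \<le> r'" "A \<in> sets borel" "B \<in> sets borel" "A \<subseteq> B" "open U" "U \<noteq> {}" "U \<subseteq> B - A"
  shows "f r (\<mu> A) < f r' (\<mu> B)"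
proof -
  have "f r (\<mu> A) \<le> f r' (\<mu> A)" using assms by (intro f_mu_mono) auto
  also have "\<dots> < f r' (\<mu> B)"
    using mu_strict[OF assms(2-7)] mu_range assms by (intro f_strict_q) auto
  finally show ?thesis .
qed

lemma f_mu_bound: "A \<in> sets borel \<Longrightarrow> \<bar>f r (\<mu> A)\<bar> \<le> C"
  by (simp add: f_bound mu_range)

lemma C_nonneg: "0 \<le> C"
  using f_mu_bound[of UNIV 0] by simp

section \<open>Speeds of a front and comparison of displacements\<close>

abbreviation "D \<equiv> D_set u\<^sub>0"
abbreviation "Dc \<equiv> Dc_set u\<^sub>0"
text \<open>The two versions of the parallel set give lower and upper speeds with
  \<open>m h a \<le> p h a \<le> m h a'\<close> for \<open>a < a'\<close>, so they differ only at
  jumps.\<close>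

definition "m h a = f h (\<mu> (D h a))"
definition "p h a = f h (\<mu> (Dc h a))"

lemmas D_mono = D_set_mono[OF u0_cont]
lemmas Dc_mono = Dc_set_mono[OF u0_cont]
lemmas D_0 = D_set_0[OF u0_cont]

lemma D_open: "open (D h a)"
  by (rule open_D_set[OF u0_cont])

lemma D_borel [simp]: "D h a \<in> sets borel" and Dc_borel [simp]: "Dc h a \<in> sets borel"
  by (simp_all add: borel_open D_open Dc_set_borel[OF u0_cont])

lemma Dc_0_subset: "Dc h 0 \<subseteq> {x. u\<^sub>0 x \<le> h}"
proof -
  have "closure (D h 0) \<subseteq> {x. u\<^sub>0 x \<le> h}"
    by (rule closure_minimal) (auto simp: D_0 closed_sublevel)
  then show ?thesis by (simp add: closure_D_set_nonneg[OF u0_cont])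
qed

lemma m_mono: "h \<le> h' \<Longrightarrow> a \<le> a' \<Longrightarrow> m h a \<le> m h' a'"
  unfolding m_def by (intro f_mu_mono D_mono) auto

lemma p_mono: "h \<le> h' \<Longrightarrow> a \<le> a' \<Longrightarrow> p h a \<le> p h' a'"
  unfolding p_def by (intro f_mu_mono Dc_mono) auto

lemma m_le_p: "m h a \<le> p h a"
  unfolding p_def m_def by (intro f_mu_mono D_set_subset_Dc_set u0_cont) auto

lemma p_le_m: "a < a' \<Longrightarrow> p h a \<le> m h a'"
  unfolding p_def m_def by (intro f_mu_mono Dc_set_subset_D_set) auto

lemma m_bound: "\<bar>m h a\<bar> \<le> C" and p_bound: "\<bar>p h a\<bar> \<le> C"
  unfolding p_def m_def by (simp_all add: f_mu_bound)

text \<open>As long as the slower front stays behind, its speed is smaller, so the initial gap never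
  shrinks.\<close>

lemma front_displacement_le:
  assumes d1: "front_displacement f \<mu> W1 h1 \<delta>1" and d2: "front_displacement f \<mu> W2 h2 \<delta>2"
    and h: "h1 \<le> h2" and d: "0 < d" and gap: "\<And>a. closure (W1 a) \<subseteq> interior (W2 (a - d))"
    and W2: "\<And>a b. a \<le> b \<Longrightarrow> W2 a \<subseteq> W2 b" and t: "0 \<le> t"
  shows "\<delta>1 t \<le> \<delta>2 t"
proof (rule ccontr)
  assume neg: "\<not> \<delta>1 t \<le> \<delta>2 t"
  define w where "w s = \<delta>2 s - \<delta>1 s" for s
  obtain C1 C2 where L: "C1-lipschitz_on {0..} \<delta>1" "C2-lipschitz_on {0..} \<delta>2"
    and w0: "w 0 = 0"
    using d1 d2 by (auto simp: front_displacement_def w_def)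
  have Lw: "(C2 + C1)-lipschitz_on {0..} w"
    unfolding w_def by (rule lipschitz_on_diff[OF L(2) L(1)])
  then have cw: "continuous_on {0..} w" by (rule lipschitz_on_continuous_on)
  define S where "S = {0..t} \<inter> w -` {0..}"
  have "closed S"
    unfolding S_def
    by (rule continuous_closed_preimage[OF continuous_on_subset[OF cw]]) auto
  moreover have bdd: "bdd_above S" unfolding S_def by auto
  moreover have "0 \<in> S" unfolding S_def using w0 t by auto
  ultimately have "Sup S \<in> S" by (intro closed_contains_Sup) auto
  then obtain t0 where t0: "t0 = Sup S" "0 \<le> t0" "t0 \<le> t" "0 \<le> w t0"
    by (auto simp: S_def)
  have above: "w s < 0" if "t0 < s" "s \<le> t" for s
    using cSup_upper[OF _ bdd, of s] that t0 by (force simp: S_def)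
  have "t0 < t" using t0 neg by (auto simp: w_def less_le)
  \<comment> \<open>A slight lead of the first front is tolerated: while it is smaller than
    \<open>d\<close>, the closure of the first set stays inside the interior of the second one, and
    \<open>w\<close> cannot decrease.\<close>
  obtain e where e: "0 < e" "\<And>s. 0 \<le> s \<Longrightarrow> dist s t0 < e \<Longrightarrow> dist (w s) (w t0) < d"
    using cw t0 d unfolding continuous_on_iff by (metis atLeast_iff)
  define t1 where "t1 = min t (t0 + e / 2)"
  have t1: "t0 < t1" "t1 \<le> t" "t1 < t0 + e" using \<open>t0 < t\<close> e by (auto simp: t1_def min_def)
  have near: "\<delta>1 s - d < \<delta>2 s" if "t0 \<le> s" "s \<le> t1" for s
    using e(2)[of s] that t0 t1 by (auto simp: dist_real_def w_def)
  let ?P = "\<lambda>W h \<delta> t. 0 \<le> t \<longrightarrow> (\<exists>d. (\<delta> has_real_derivative d) (at t within {0..}) \<and>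
     f h (\<mu> (interior (W (\<delta> t)))) \<le> d \<and> d \<le> f h (\<mu> (closure (W (\<delta> t)))))"
  have "AE t in lebesgue. ?P W1 h1 \<delta>1 t \<and> ?P W2 h2 \<delta>2 t"
    using d1 d2 unfolding front_displacement_def by auto
  then obtain N where N: "N \<in> null_sets lebesgue" "{t. \<not> (?P W1 h1 \<delta>1 t \<and> ?P W2 h2 \<delta>2 t)} \<subseteq> N"
    unfolding eventually_ae_filter by auto
  have "w t0 \<le> w t1"
  proof (rule lipschitz_nonneg_deriv_imp_le[where w = w and a = t0 and b = t1 and L = "C2 + C1" and N = N])
    show "(C2 + C1)-lipschitz_on {t0..t1} w"
      using Lw by (rule lipschitz_on_subset) (use t0 in auto)
    show "t0 \<le> t1" using t1 by simp
    show "negligible N" using N by (simp add: negligible_iff_null_sets)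
    fix s assume s: "s \<in> {t0<..<t1} - N"
    then have "0 < s" using t0 by simp
    then have at: "at s within {0..} = at s" by (intro at_within_interior) simp
    have PP: "?P W1 h1 \<delta>1 s" "?P W2 h2 \<delta>2 s" using s N by blast+
    obtain a where a: "(\<delta>1 has_real_derivative a) (at s)" "a \<le> f h1 (\<mu> (closure (W1 (\<delta>1 s))))"
      using PP(1) \<open>0 < s\<close> at by auto
    obtain b where b: "(\<delta>2 has_real_derivative b) (at s)" "f h2 (\<mu> (interior (W2 (\<delta>2 s)))) \<le> b"
      using PP(2) \<open>0 < s\<close> at by auto
    have "closure (W1 (\<delta>1 s)) \<subseteq> interior (W2 (\<delta>2 s))"
      using gap[of "\<delta>1 s"] interior_mono[OF W2, of "\<delta>1 s - d" "\<delta>2 s"] near[of s] s by force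
    then have "f h1 (\<mu> (closure (W1 (\<delta>1 s)))) \<le> f h2 (\<mu> (interior (W2 (\<delta>2 s))))"
      using h by (intro f_mu_mono) auto
    then show "\<exists>c\<ge>0. (w has_real_derivative c) (at s)"
      using a b unfolding w_def by (intro exI[of _ "b - a"]) (auto intro: DERIV_diff)
  qed
  then show False using above[of t1] t0 t1 by simp
qed

lemma D_front_le:
  assumes "front_displacement f \<mu> (D h1) h1 \<delta>1" "front_displacement f \<mu> (D h2) h2 \<delta>2" "h1 < h2" "0 \<le> t"
  shows "\<delta>1 t \<le> \<delta>2 t"
proof -
  obtain d where d: "0 < d" "\<And>h a. D h a \<subseteq> D (h + (h2 - h1)) (a - d)"
    using D_set_gap[OF u0_unif, of "h2 - h1"] assms(3) by auto
  show ?thesis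
  proof (rule front_displacement_le[OF assms(1,2)])
    show "h1 \<le> h2" "0 < d / 2" "0 \<le> t" using assms d by auto
    show "D h2 a \<subseteq> D h2 b" if "a \<le> b" for a b using that by (intro D_mono) auto
    fix a
    \<comment> \<open>One half of the gap pays for the passage to the closure; the other half
      remains as the gap required.\<close>
    have "closure (D h1 a) \<subseteq> D h1 (a + d / 2)"
      using closure_D_set_subset[OF u0_cont] Dc_set_subset_D_set[of a "a + d / 2"] d by fastforce
    also have "\<dots> \<subseteq> D h2 (a - d / 2)" using d(2)[of h1 "a + d / 2"] by simp
    finally show "closure (D h1 a) \<subseteq> interior (D h2 (a - d / 2))"
      by (simp add: interior_open D_open)
  qed
qed

text \<open>Difference quotients in place of derivatives make the notion stable under limits in \<open>h\<close>.\<close>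

definition displ :: "real \<Rightarrow> (real \<Rightarrow> real) \<Rightarrow> bool" where
  "displ h \<delta> \<longleftrightarrow> \<delta> 0 = 0 \<and> (\<forall>s t. 0 \<le> s \<longrightarrow> s \<le> t \<longrightarrow>
     (if hbar < h then \<delta> s \<le> \<delta> t else \<delta> t \<le> \<delta> s) \<and>
     (t - s) * m h (min (\<delta> s) (\<delta> t)) \<le> \<delta> t - \<delta> s \<and>
     \<delta> t - \<delta> s \<le> (t - s) * p h (max (\<delta> s) (\<delta> t)))"

lemma displ_0: "displ h \<delta> \<Longrightarrow> \<delta> 0 = 0"
  by (simp add: displ_def)

lemma displ_mono: "displ h \<delta> \<Longrightarrow> hbar < h \<Longrightarrow> 0 \<le> s \<Longrightarrow> s \<le> t \<Longrightarrow> \<delta> s \<le> \<delta> t"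
  by (simp add: displ_def)

lemma displ_antimono: "displ h \<delta> \<Longrightarrow> h \<le> hbar \<Longrightarrow> 0 \<le> s \<Longrightarrow> s \<le> t \<Longrightarrow> \<delta> t \<le> \<delta> s"
  by (simp add: displ_def not_less[symmetric])

lemma displ_slope:
  assumes "displ h \<delta>" "0 \<le> s" "s \<le> t"
  shows "(t - s) * m h (min (\<delta> s) (\<delta> t)) \<le> \<delta> t - \<delta> s"
    and "\<delta> t - \<delta> s \<le> (t - s) * p h (max (\<delta> s) (\<delta> t))"
  using assms unfolding displ_def by blast+

lemma displ_lipschitz:
  assumes \<delta>: "displ h \<delta>" and st: "0 \<le> s" "0 \<le> t"
  shows "\<bar>\<delta> t - \<delta> s\<bar> \<le> C * \<bar>t - s\<bar>"
proof -
  have *: "\<bar>\<delta> t - \<delta> s\<bar> \<le> C * (t - s)" if "0 \<le> s" "s \<le> t" for s t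
  proof -
    have "(t - s) * (- C) \<le> (t - s) * m h (min (\<delta> s) (\<delta> t))"
      using that m_bound[of h "min (\<delta> s) (\<delta> t)"] by (intro mult_left_mono) auto
    moreover have "(t - s) * p h (max (\<delta> s) (\<delta> t)) \<le> (t - s) * C"
      using that p_bound[of h "max (\<delta> s) (\<delta> t)"] by (intro mult_left_mono) auto
    ultimately show ?thesis
      using displ_slope[OF \<delta> that] by (simp add: mult.commute abs_le_iff)
  qed
  show ?thesis using *[of s t] *[of t s] st by (cases "s \<le> t") (auto simp: abs_minus_commute)
qed

text \<open>Points of the sublevel set closer than \<open>- a\<close> to a boundary point
  \<open>z\<close> have been swept away at displacement \<open>a\<close>. The open piece
  \<open>U\<close> feeds the strict monotonicity of \<open>\<mu>\<close>.\<close>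

lemma sublevel_nontrivial:
  assumes "a < 0" "D h 0 \<noteq> {}" "D h 0 \<noteq> UNIV"
  obtains U where "open U" "U \<noteq> {}" "U \<subseteq> D h 0 - Dc h a"
proof -
  have "frontier (D h 0) \<noteq> {}" using assms by (simp add: frontier_eq_empty)
  then obtain z where z: "z \<in> closure (D h 0)" "z \<notin> D h 0"
    unfolding frontier_def interior_open[OF D_open] by blast
  define U where "U = D h 0 \<inter> ball z (- a)"
  have "\<exists>y\<in>D h 0. dist y z < - a"
    using z(1) assms(1) unfolding closure_approachable by simp
  then have "U \<noteq> {}" by (auto simp: U_def dist_commute)
  have "x \<notin> Dc h a" if x: "x \<in> U" for x
  proof
    assume "x \<in> Dc h a"
    moreover have "a < - dist x z" "- dist x z \<le> 0" using x by (auto simp: U_def dist_commute)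
    ultimately have "x \<in> D h (- dist x z)" by (blast dest: Dc_setD)
    then show False using z(2) \<open>- dist x z \<le> 0\<close> by (simp add: D_0 D_set_nonpos[OF u0_cont])
  qed
  then have "U \<subseteq> D h 0 - Dc h a" by (auto simp: U_def)
  moreover have "open U" by (auto simp: U_def D_open)
  ultimately show ?thesis using that \<open>U \<noteq> {}\<close> by blast
qed

text \<open>If the sublevel set or its complement is empty, the signed distance is infinite
  everywhere and does not see \<open>a\<close>.\<close>

lemma D_trivial:
  assumes "D h 0 = {} \<or> D h 0 = UNIV"
  shows "D h a = D h 0" and "Dc h a = D h 0"
proof -
  have *: "D h a = D h 0" for a
  proof (cases "0 < a")
    case True
    then have "\<exists>y. dist x y < a" for x by (metis dist_self)
    then show ?thesis using assms True by (auto simp: D_set_pos D_0)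
  next
    case False
    then have "\<exists>y. dist x y \<le> - a" for x by (metis dist_self neg_0_le_iff_le not_less)
    then show ?thesis using assms False by (auto simp: D_set_nonpos[OF u0_cont])
  qed
  show "D h a = D h 0" by (rule *)
  have "Dc h a = (\<Inter>b\<in>{a<..}. D h 0)"
    unfolding Dc_set_def by (intro INF_cong refl *)
  then show "Dc h a = D h 0" by simp
qed

lemma sublevel_hbar:
  assumes "h \<le> hbar"
  shows "m h 0 \<le> 0"
proof -
  have "m h 0 \<le> m hbar 0" using assms by (rule m_mono) simp
  then show ?thesis using hbar_D by (simp add: m_def D_0)
qed

text \<open>Monotone functions of \<open>\<delta> t\<close> are continuous in time up to countably
  many exceptions, and elsewhere the slope bounds produce the derivative. The delicate point is that
  \<open>p\<close> is built on \<open>Dc h\<close>, whereas the definition asks for the closure of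
  \<open>D h\<close>.\<close>

lemma displ_imp_front_displacement:
  assumes \<delta>: "displ h \<delta>"
  shows "front_displacement f \<mu> (D h) h \<delta>"
proof -
  have "C-lipschitz_on {0..} \<delta>"
    using displ_lipschitz[OF \<delta>] C_nonneg by (intro lipschitz_onI) (auto simp: dist_real_def)
  moreover have "AE t in lebesgue. 0 \<le> t \<longrightarrow> (\<exists>d. (\<delta> has_real_derivative d) (at t within {0..}) \<and>
      f h (\<mu> (interior (D h (\<delta> t)))) \<le> d \<and> d \<le> f h (\<mu> (closure (D h (\<delta> t)))))"
  proof -
    have count: "countable {t \<in> {0..}. \<not> continuous (at t within {0..}) (\<lambda>t. g (\<delta> t))}"
      if g: "\<And>a b. a \<le> b \<Longrightarrow> g a \<le> g b" for g :: "real \<Rightarrow> real"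
    proof (cases "hbar < h")
      case True
      show ?thesis
        by (rule mono_on_ctble_discont) (auto intro!: mono_onI g displ_mono[OF \<delta> True])
    next
      case False
      have "countable {t \<in> {0..}. \<not> continuous (at t within {0..}) (\<lambda>t. - g (\<delta> t))}"
        by (rule mono_on_ctble_discont) (use False in \<open>auto intro!: mono_onI g displ_antimono[OF \<delta>]\<close>)
      moreover have "continuous (at t within {0..}) (\<lambda>t. - g (\<delta> t)) \<longleftrightarrow>
          continuous (at t within {0..}) (\<lambda>t. g (\<delta> t))" for t
        using continuous_minus[of "at t within {0..}" "\<lambda>t. - g (\<delta> t)"]
          continuous_minus[of "at t within {0..}" "\<lambda>t. g (\<delta> t)"] by auto
      ultimately show ?thesis by simp
    qed
    define N where "N = {t \<in> {0..}. \<not> continuous (at t within {0..}) (\<lambda>t. m h (\<delta> t))} \<union>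
        {t \<in> {0..}. \<not> continuous (at t within {0..}) (\<lambda>t. p h (\<delta> t))}"
    have "countable N" unfolding N_def by (intro countable_Un count m_mono p_mono) auto
    then have "N \<in> null_sets lebesgue"
      by (intro null_sets_completionI countable_imp_null_set_lborel)
    then show ?thesis
    proof (rule AE_I'[OF _ subsetI])
      fix t
      assume "t \<in> {t \<in> space lebesgue. \<not> (0 \<le> t \<longrightarrow> (\<exists>d. (\<delta> has_real_derivative d) (at t within {0..}) \<and>
        f h (\<mu> (interior (D h (\<delta> t)))) \<le> d \<and> d \<le> f h (\<mu> (closure (D h (\<delta> t))))))}"
      then have t: "0 \<le> t" and bad: "\<not> (\<exists>d. (\<delta> has_real_derivative d) (at t within {0..}) \<and>
        f h (\<mu> (interior (D h (\<delta> t)))) \<le> d \<and> d \<le> f h (\<mu> (closure (D h (\<delta> t)))))" by auto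
      show "t \<in> N"
      proof (rule ccontr)
        assume "t \<notin> N"
        then have "continuous (at t within {0..}) (\<lambda>t. m h (\<delta> t))"
            "continuous (at t within {0..}) (\<lambda>t. p h (\<delta> t))"
          using t by (auto simp: N_def)
        then obtain d where d: "(\<delta> has_real_derivative d) (at t within {0..})"
          "m h (\<delta> t) \<le> d" "d \<le> p h (\<delta> t)" "d = m h (\<delta> t) \<or> d = 0"
          using has_derivative_of_slope_bounds[of t "m h" "p h" \<delta>] t
            m_mono[of h h] p_mono[of h h] m_le_p[of h] p_le_m[of _ _ h] displ_slope[OF \<delta>]
          by (auto simp: mono_def)
        have m_le: "m h a \<le> f h (\<mu> (closure (D h a)))" for a
          unfolding m_def by (intro f_mu_mono closure_subset) auto
        have "d \<le> f h (\<mu> (closure (D h (\<delta> t))))"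
        proof (cases "d = m h (\<delta> t)")
          case True
          then show ?thesis using m_le by simp
        next
          case d_neq: False
          then have d0: "d = 0" using d by simp
          show ?thesis
          proof (cases "0 \<le> \<delta> t")
            case True
            then show ?thesis using d by (simp add: closure_D_set_nonneg[OF u0_cont] p_def)
          next
            case False
            then have "\<not> hbar < h"
              using displ_mono[OF \<delta>, of 0 t] displ_0[OF \<delta>] t by auto
            then have "m h 0 \<le> 0" by (intro sublevel_hbar) simp
            \<comment> \<open>At a negative displacement the derivative 0 would force
              \<open>0 \<le> p h (\<delta> t)\<close>. But a nontrivial sublevel set has lost an
              open piece by then, so \<open>p h (\<delta> t) < m h 0 \<le> 0\<close>.\<close>
            have "D h 0 = {} \<or> D h 0 = UNIV"
            proof (rule ccontr)
              assume "\<not> (D h 0 = {} \<or> D h 0 = UNIV)"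
              then obtain U where U: "open U" "U \<noteq> {}" "U \<subseteq> D h 0 - Dc h (\<delta> t)"
                using sublevel_nontrivial[of "\<delta> t" h] False by auto
              have "p h (\<delta> t) < m h 0"
                unfolding p_def m_def using False U
                by (intro f_mu_strict[OF _ _ _ _ U] Dc_set_subset_D_set) auto
              then show False using d d0 \<open>m h 0 \<le> 0\<close> by simp
            qed
            then have "m h (\<delta> t) = p h (\<delta> t)"
              by (simp add: m_def p_def D_trivial(1)[of h "\<delta> t"] D_trivial(2)[of h "\<delta> t"])
            then show ?thesis using d d_neq by simp
          qed
        qed
        then show False
          using bad d by (auto simp: interior_open[OF D_open] m_def)
      qed
    qed
  qed
  ultimately show ?thesis
    using displ_0[OF \<delta>] unfolding front_displacement_def by blast
qed

section \<open>Existence of displacements at a single level\<close>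

lemma displ_trivial:
  assumes "D h 0 = {} \<or> D h 0 = UNIV" "f h (\<mu> (D h 0)) = 0"
  shows "displ h (\<lambda>_. 0)"
proof -
  have "m h 0 = 0" "p h 0 = 0"
    using D_trivial(2)[OF assms(1), of 0] assms(2) by (simp_all add: m_def p_def)
  then show ?thesis by (simp add: displ_def)
qed

lemma sublevel_above:
  assumes h: "hbar < h"
  shows "0 \<le> m h 0"
proof -
  have "f hbar (\<mu> {x. u\<^sub>0 x \<le> hbar}) \<le> f h (\<mu> (D h 0))"
    using h by (intro f_mu_mono) (auto simp: D_0 closed_sublevel borel_closed open_sublevel borel_open)
  then show ?thesis using hbar_E by (simp add: m_def)
qed

text \<open>If the speed vanishes at displacement 0, strict monotonicity in the measure excludes
  values of \<open>u\<^sub>0\<close> strictly between \<open>hbar\<close> and \<open>h\<close>. The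
  range of \<open>u\<^sub>0\<close> is an interval, so the sublevel set is empty or everything, and
  a stationary front works.\<close>

lemma exists_displ_above:
  assumes h: "hbar < h"
  shows "\<exists>\<delta>. displ h \<delta>"
proof (cases "0 < m h 0")
  case True
  then obtain \<delta> where \<delta>: "\<delta> 0 = 0" "\<And>s t. 0 \<le> s \<Longrightarrow> s \<le> t \<Longrightarrow> \<delta> s \<le> \<delta> t \<and>
      (t - s) * m h (\<delta> s) \<le> \<delta> t - \<delta> s \<and> \<delta> t - \<delta> s \<le> (t - s) * m h (\<delta> t)"
    using exists_autonomous_flow[of "m h" C] m_mono[of h h] m_bound[of h]
    by (auto simp: mono_def abs_le_iff)
  have "displ h \<delta>"
    unfolding displ_def
  proof (intro conjI allI impI)
    fix s t :: real assume st: "0 \<le> s" "s \<le> t"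
    note b = \<delta>(2)[OF st]
    have "(t - s) * m h (\<delta> t) \<le> (t - s) * p h (\<delta> t)"
      using st m_le_p by (intro mult_left_mono) auto
    then show "(if hbar < h then \<delta> s \<le> \<delta> t else \<delta> t \<le> \<delta> s)"
        "(t - s) * m h (min (\<delta> s) (\<delta> t)) \<le> \<delta> t - \<delta> s"
        "\<delta> t - \<delta> s \<le> (t - s) * p h (max (\<delta> s) (\<delta> t))"
      using b h by (auto simp: min_absorb1 max_absorb2)
  qed (rule \<delta>(1))
  then show ?thesis by blast
next
  case False
  have sub: "{x. u\<^sub>0 x \<le> hbar} \<subseteq> {x. u\<^sub>0 x < h}" using h by auto
  have m0: "m h 0 = 0" using False sublevel_above[OF h] by simp
  have none: "{x. hbar < u\<^sub>0 x \<and> u\<^sub>0 x < h} = {}"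
  proof (rule ccontr)
    assume "{x. hbar < u\<^sub>0 x \<and> u\<^sub>0 x < h} \<noteq> {}"
    then have "f hbar (\<mu> {x. u\<^sub>0 x \<le> hbar}) < f h (\<mu> {x. u\<^sub>0 x < h})"
      by (intro f_mu_strict[OF _ _ _ sub open_between])
        (use h closed_sublevel open_sublevel in \<open>auto simp: borel_open borel_closed\<close>)
    then show False using hbar_E m0 by (simp add: m_def D_0)
  qed
  have "D h 0 = {} \<or> D h 0 = UNIV"
  proof (rule ccontr)
    assume "\<not> (D h 0 = {} \<or> D h 0 = UNIV)"
    then obtain x y where "x \<in> D h 0" "y \<notin> D h 0" by blast
    then have xy: "u\<^sub>0 x < h" "h \<le> u\<^sub>0 y" by (auto simp: D_0)
    then have "u\<^sub>0 x \<le> hbar" using none by force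
    have "connected (range u\<^sub>0)" using u0_cont by (intro connected_continuous_image) auto
    moreover have "u\<^sub>0 x \<le> (hbar + h) / 2" "(hbar + h) / 2 \<le> u\<^sub>0 y"
      using \<open>u\<^sub>0 x \<le> hbar\<close> xy h by auto
    ultimately have "(hbar + h) / 2 \<in> range u\<^sub>0"
      by (meson connectedD_interval rangeI)
    then obtain z where "u\<^sub>0 z = (hbar + h) / 2" by auto
    then have "z \<in> {x. hbar < u\<^sub>0 x \<and> u\<^sub>0 x < h}" using h by simp
    then show False using none by blast
  qed
  then have "displ h (\<lambda>_. 0)"
    by (rule displ_trivial) (use m0 in \<open>simp add: m_def\<close>)
  then show ?thesis by blast
qed

text \<open>At an attained maximum of the initial datum below \<open>hbar\<close> the level may be degenerate;
  it is recovered later as a limit of lower levels.\<close>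

lemma exists_displ_below:
  assumes h: "h < hbar" and nomax: "\<not> (\<exists>x. u\<^sub>0 x = h \<and> (\<forall>y. u\<^sub>0 y \<le> h))"
  shows "\<exists>\<delta>. displ h \<delta>"
proof (cases "p h 0 < 0")
  case True
  \<comment> \<open>Reversing the sign of the displacement turns the retreating front into an
    advancing one with speed \<open>- p h (- a)\<close>.\<close>
  have "mono (\<lambda>a. - p h (- a))" by (intro monoI) (simp add: p_mono)
  moreover have "- p h a \<le> C" for a using p_bound[of h a] by (simp add: abs_le_iff)
  ultimately obtain \<eta> where \<eta>: "\<eta> 0 = 0" "\<And>s t. 0 \<le> s \<Longrightarrow> s \<le> t \<Longrightarrow> \<eta> s \<le> \<eta> t \<and>
      (t - s) * (- p h (- \<eta> s)) \<le> \<eta> t - \<eta> s \<and> \<eta> t - \<eta> s \<le> (t - s) * (- p h (- \<eta> t))"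
    using exists_autonomous_flow[of "\<lambda>a. - p h (- a)" C] True by auto
  have "displ h (\<lambda>t. - \<eta> t)"
    unfolding displ_def
  proof (intro conjI allI impI)
    fix s t :: real assume st: "0 \<le> s" "s \<le> t"
    note b = \<eta>(2)[OF st]
    have "(t - s) * m h (- \<eta> t) \<le> (t - s) * p h (- \<eta> t)"
      using st m_le_p by (intro mult_left_mono) auto
    then show "(if hbar < h then - \<eta> s \<le> - \<eta> t else - \<eta> t \<le> - \<eta> s)"
        "(t - s) * m h (min (- \<eta> s) (- \<eta> t)) \<le> - \<eta> t - - \<eta> s"
        "- \<eta> t - - \<eta> s \<le> (t - s) * p h (max (- \<eta> s) (- \<eta> t))"
      using b h by (auto simp: min_absorb2 max_absorb1)
  qed (simp add: \<eta>(1))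
  then show ?thesis by blast
next
  case False
  have sub: "{x. u\<^sub>0 x \<le> h} \<subseteq> {x. u\<^sub>0 x < hbar}" using h by auto
  have "p h 0 \<le> f h (\<mu> {x. u\<^sub>0 x \<le> h})"
    unfolding p_def by (intro f_mu_mono Dc_0_subset) (auto simp: closed_sublevel borel_closed)
  moreover have le: "f h (\<mu> {x. u\<^sub>0 x \<le> h}) \<le> f hbar (\<mu> {x. u\<^sub>0 x < hbar})"
    by (intro f_mu_mono sub)
      (use h closed_sublevel open_sublevel in \<open>auto simp: borel_open borel_closed\<close>)
  ultimately have p0: "p h 0 = 0" and fh: "f h (\<mu> {x. u\<^sub>0 x \<le> h}) = 0"
    and fb: "f hbar (\<mu> {x. u\<^sub>0 x < hbar}) = 0"
    using False hbar_D by auto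
  have none: "{x. h < u\<^sub>0 x \<and> u\<^sub>0 x < hbar} = {}"
  proof (rule ccontr)
    assume "{x. h < u\<^sub>0 x \<and> u\<^sub>0 x < hbar} \<noteq> {}"
    then have "f h (\<mu> {x. u\<^sub>0 x \<le> h}) < f hbar (\<mu> {x. u\<^sub>0 x < hbar})"
      by (intro f_mu_strict[OF _ _ _ sub open_between])
        (use h closed_sublevel open_sublevel in \<open>auto simp: borel_open borel_closed\<close>)
    then show False using fh fb by simp
  qed
  have triv: "D h 0 = {} \<or> D h 0 = UNIV"
  proof (rule ccontr)
    assume "\<not> (D h 0 = {} \<or> D h 0 = UNIV)"
    then obtain x y where "x \<in> D h 0" "y \<notin> D h 0" by blast
    then have xy: "u\<^sub>0 x < h" "h \<le> u\<^sub>0 y" by (auto simp: D_0)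
    have conn: "connected (range u\<^sub>0)" using u0_cont by (intro connected_continuous_image) auto
    have "h \<in> range u\<^sub>0"
      by (rule connectedD_interval[OF conn rangeI[of _ x] rangeI[of _ y]]) (use xy in auto)
    \<comment> \<open>As \<open>h\<close> is attained it cannot be the maximum, so a larger value
      exists. With no value strictly between \<open>h\<close> and \<open>hbar\<close>, the
      continuous \<open>u\<^sub>0\<close> would have to jump over the midpoint.\<close>
    then obtain z where "u\<^sub>0 z = h" by auto
    then obtain y' where y': "h < u\<^sub>0 y'" using nomax by (auto simp: not_le)
    then have "hbar \<le> u\<^sub>0 y'" using none by force
    have "(hbar + h) / 2 \<in> range u\<^sub>0"
      by (rule connectedD_interval[OF conn rangeI[of _ x] rangeI[of _ y']])
        (use xy h \<open>hbar \<le> u\<^sub>0 y'\<close> in auto)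
    then obtain z' where "u\<^sub>0 z' = (hbar + h) / 2" by auto
    then have "z' \<in> {x. h < u\<^sub>0 x \<and> u\<^sub>0 x < hbar}" using h by simp
    then show False using none by blast
  qed
  have "displ h (\<lambda>_. 0)"
    by (rule displ_trivial[OF triv]) (use p0 D_trivial(2)[OF triv, of 0] in \<open>simp add: p_def\<close>)
  then show ?thesis by blast
qed

text \<open>At most one level can be an attained maximum of \<open>u\<^sub>0\<close>, so of two
  candidates below \<open>hbar\<close> one is admissible.\<close>

lemma exists_displ_between:
  assumes "h' < h" "h \<le> hbar \<or> hbar \<le> h'"
  shows "\<exists>g \<delta>. h' < g \<and> g < h \<and> displ g \<delta>"
proof -
  define g where "g = (h' + h) / 2"
  define g' where "g' = (h' + g) / 2"
  have g: "h' < g'" "g' < g" "g < h" using assms(1) by (auto simp: g_def g'_def)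
  show ?thesis
  proof (cases "hbar \<le> h'")
    case True
    then have "hbar < g" using g by simp
    then show ?thesis using exists_displ_above[of g] g less_trans by blast
  next
    case False
    then have "g < hbar" "g' < hbar" using assms g by simp_all
    show ?thesis
    proof (cases "\<exists>x. u\<^sub>0 x = g \<and> (\<forall>y. u\<^sub>0 y \<le> g)")
      case True
      then obtain x where "u\<^sub>0 x = g" by blast
      then have "\<not> (\<exists>x. u\<^sub>0 x = g' \<and> (\<forall>y. u\<^sub>0 y \<le> g'))"
        using g by (metis not_less)
      then show ?thesis using exists_displ_below[OF \<open>g' < hbar\<close>] g less_trans by blast
    next
      case False
      then show ?thesis using exists_displ_below[OF \<open>g < hbar\<close>] g less_trans by blast
    qed
  qed
qed

text \<open>Comparison makes the displacements increase with \<open>k\<close>. The upper slope bound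
  passes to the limit by monotonicity of \<open>p\<close> alone. The lower one needs convergence of
  \<open>m\<close>, which holds from below because the parallel sets increase to the limiting
  one.\<close>

lemma displ_limit:
  fixes hs :: "nat \<Rightarrow> real" and \<delta>s :: "nat \<Rightarrow> real \<Rightarrow> real"
  assumes hs: "strict_mono hs" "hs \<longlonglongrightarrow> h" "\<And>k. hs k < h" and side: "hbar < h \<Longrightarrow> \<forall>k. hbar < hs k"
    and \<delta>s: "\<And>k. displ (hs k) (\<delta>s k)"
  obtains \<delta> :: "real \<Rightarrow> real" where "displ h \<delta>" "\<And>t. 0 \<le> t \<Longrightarrow> (\<lambda>k. \<delta>s k t) \<longlonglongrightarrow> \<delta> t"
    "\<And>k t. 0 \<le> t \<Longrightarrow> \<delta>s k t \<le> \<delta> t"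
proof -
  define \<delta> where "\<delta> t = (SUP k. \<delta>s k t)" for t
  have inc: "incseq (\<lambda>k. \<delta>s k t)" if "0 \<le> t" for t
  proof (rule incseq_SucI)
    fix k
    have "hs k < hs (Suc k)" using hs(1) by (simp add: strict_monoD)
    then show "\<delta>s k t \<le> \<delta>s (Suc k) t"
      by (rule D_front_le[OF displ_imp_front_displacement[OF \<delta>s]
            displ_imp_front_displacement[OF \<delta>s] _ that])
  qed
  have bdd: "bdd_above (range (\<lambda>k. \<delta>s k t))" if "0 \<le> t" for t
    using displ_lipschitz[OF \<delta>s, of 0 t] displ_0[OF \<delta>s] that
    by (intro bdd_aboveI2[where M = "C * t"]) (auto simp: abs_le_iff)
  have lim: "(\<lambda>k. \<delta>s k t) \<longlonglongrightarrow> \<delta> t" if "0 \<le> t" for t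
    unfolding \<delta>_def by (rule LIMSEQ_incseq_SUP[OF bdd[OF that] inc[OF that]])
  have le: "\<delta>s k t \<le> \<delta> t" if "0 \<le> t" for k t
    unfolding \<delta>_def by (rule cSUP_upper[OF UNIV_I bdd[OF that]])
  have "displ h \<delta>"
    unfolding displ_def
  proof (intro conjI allI impI)
    show "\<delta> 0 = 0" using displ_0[OF \<delta>s] by (simp add: \<delta>_def)
    fix s t :: real assume st: "0 \<le> s" "s \<le> t"
    then have t: "0 \<le> t" by simp
    note lims = lim[OF st(1)] lim[OF t]
    show "if hbar < h then \<delta> s \<le> \<delta> t else \<delta> t \<le> \<delta> s"
    proof (cases "hbar < h")
      case True
      then have "\<delta>s k s \<le> \<delta>s k t" for k
        using displ_mono[OF \<delta>s] side st by blast
      then show ?thesis using True LIMSEQ_le[OF lims] by auto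
    next
      case False
      then have "hs k \<le> hbar" for k using hs(3)[of k] by simp
      then have "\<delta>s k t \<le> \<delta>s k s" for k
        using displ_antimono[OF \<delta>s] st by blast
      then show ?thesis using False LIMSEQ_le[OF lims(2,1)] by auto
    qed
    have lim_diff: "(\<lambda>k. \<delta>s k t - \<delta>s k s) \<longlonglongrightarrow> \<delta> t - \<delta> s"
      by (rule tendsto_diff[OF lims(2,1)])
    show "\<delta> t - \<delta> s \<le> (t - s) * p h (max (\<delta> s) (\<delta> t))"
    proof (rule LIMSEQ_le_const2[OF lim_diff], intro exI allI impI)
      fix k :: nat
      have "\<delta>s k t - \<delta>s k s \<le> (t - s) * p (hs k) (max (\<delta>s k s) (\<delta>s k t))"
        by (rule displ_slope[OF \<delta>s st])
      also have "\<dots> \<le> (t - s) * p h (max (\<delta> s) (\<delta> t))"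
        using st le[OF st(1), of k] le[OF t, of k] hs(3)[of k]
        by (intro mult_left_mono p_mono) (auto simp: le_max_iff_disj)
      finally show "\<delta>s k t - \<delta>s k s \<le> (t - s) * p h (max (\<delta> s) (\<delta> t))" .
    qed
    define a where "a k = min (\<delta>s k s) (\<delta>s k t)" for k
    have a: "a \<longlonglongrightarrow> min (\<delta> s) (\<delta> t)" "\<And>k. a k \<le> min (\<delta> s) (\<delta> t)"
      unfolding a_def using tendsto_min[OF lims] le[OF st(1)] le[OF t]
      by (auto simp: min_le_iff_disj)
    have "incseq (\<lambda>k. D (hs k) (a k))"
    proof (rule incseq_SucI)
      fix k
      have "a k \<le> a (Suc k)"
        using incseq_SucD[OF inc[OF st(1)], of k] incseq_SucD[OF inc[OF t], of k]
        by (auto simp: a_def min_le_iff_disj)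
      then show "D (hs k) (a k) \<subseteq> D (hs (Suc k)) (a (Suc k))"
        by (intro D_mono) (auto intro: less_imp_le strict_monoD[OF hs(1)])
    qed
    then have "(\<lambda>k. \<mu> (D (hs k) (a k))) \<longlonglongrightarrow> \<mu> (\<Union>k. D (hs k) (a k))"
      by (intro mu_incseq) auto
    moreover have "(\<Union>k. D (hs k) (a k)) = D h (min (\<delta> s) (\<delta> t))"
    proof (intro equalityI UN_least)
      show "D (hs k) (a k) \<subseteq> D h (min (\<delta> s) (\<delta> t))" for k
        using a(2)[of k] hs(3)[of k] by (intro D_mono) auto
      show "D h (min (\<delta> s) (\<delta> t)) \<subseteq> (\<Union>k. D (hs k) (a k))"
        by (rule D_set_subset_UN[OF u0_cont hs(2) _ a]) (simp add: hs(3) less_imp_le)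
    qed
    ultimately have "(\<lambda>k. (hs k, \<mu> (D (hs k) (a k)))) \<longlonglongrightarrow> (h, \<mu> (D h (min (\<delta> s) (\<delta> t))))"
      using hs(2) by (intro tendsto_Pair) auto
    then have "(\<lambda>k. m (hs k) (a k)) \<longlonglongrightarrow> m h (min (\<delta> s) (\<delta> t))"
      using continuous_on_tendsto_compose[OF f_cont, of "\<lambda>k. (hs k, \<mu> (D (hs k) (a k)))" _ sequentially]
        mu_range[OF D_borel] by (auto simp: m_def)
    then have "(\<lambda>k. (t - s) * m (hs k) (a k)) \<longlonglongrightarrow> (t - s) * m h (min (\<delta> s) (\<delta> t))"
      by (intro tendsto_mult tendsto_const)
    then show "(t - s) * m h (min (\<delta> s) (\<delta> t)) \<le> \<delta> t - \<delta> s"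
      by (rule LIMSEQ_le[OF _ lim_diff]) (use displ_slope(1)[OF \<delta>s st] in \<open>auto simp: a_def\<close>)
  qed
  then show ?thesis using that lim le by blast
qed

lemma exists_displ_approx:
  obtains hs :: "nat \<Rightarrow> real" and \<delta>s :: "nat \<Rightarrow> real \<Rightarrow> real" and \<delta> :: "real \<Rightarrow> real" where "strict_mono hs" "hs \<longlonglongrightarrow> h" "\<And>k. hs k < h"
    "\<And>k. displ (hs k) (\<delta>s k)" "displ h \<delta>" "\<And>t. 0 \<le> t \<Longrightarrow> (\<lambda>k. \<delta>s k t) \<longlonglongrightarrow> \<delta> t"
    "\<And>k t. 0 \<le> t \<Longrightarrow> \<delta>s k t \<le> \<delta> t"
proof -
  \<comment> \<open>For \<open>hbar < h\<close> this keeps all approximating levels above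
    \<open>hbar\<close>, as \<open>displ_limit\<close> requires.\<close>
  define e where "e = (if hbar < h then h - hbar else 1)"
  have e: "0 < e" by (simp add: e_def)
  \<comment> \<open>Picking one level from each of the adjacent windows makes the sequence strictly
    increasing.\<close>
  have "\<exists>g \<delta>. h - e / Suc k < g \<and> g < h - e / Suc (Suc k) \<and> displ g \<delta>" for k
  proof (rule exists_displ_between)
    have "e / Suc k \<le> e" using e by (simp add: divide_le_eq)
    moreover have "e / Suc (Suc k) > 0" using e by simp
    moreover have "h \<le> hbar \<or> e = h - hbar" by (simp add: e_def)
    ultimately show "h - e / Suc (Suc k) \<le> hbar \<or> hbar \<le> h - e / Suc k"
      by linarith
    show "h - e / Suc k < h - e / Suc (Suc k)"
      using e by (simp add: frac_less2)
  qed
  then obtain hs :: "nat \<Rightarrow> real" and \<delta>s :: "nat \<Rightarrow> real \<Rightarrow> real" where hs: "\<And>k. h - e / Suc k < hs k" "\<And>k. hs k < h - e / Suc (Suc k)"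
      "\<And>k. displ (hs k) (\<delta>s k)"
    by metis
  have smono: "strict_mono hs"
    by (rule strict_monoI_Suc) (use hs(1,2) less_trans in blast)
  have below: "hs k < h" for k
  proof -
    have "e / Suc (Suc k) > 0" using e by simp
    then show ?thesis using hs(2)[of k] by linarith
  qed
  have "(\<lambda>k. h - e * (1 / Suc k)) \<longlonglongrightarrow> h - e * 0"
    by (intro tendsto_diff tendsto_mult tendsto_const LIMSEQ_inverse_real_of_nat[unfolded inverse_eq_divide])
  then have low: "(\<lambda>k. h - e / Suc k) \<longlonglongrightarrow> h" by simp
  have lim: "hs \<longlonglongrightarrow> h"
  proof (rule tendsto_sandwich[OF _ _ low tendsto_const])
    show "\<forall>\<^sub>F k in sequentially. h - e / real (Suc k) \<le> hs k"
      using hs(1) by (intro always_eventually allI less_imp_le)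
    show "\<forall>\<^sub>F k in sequentially. hs k \<le> h"
      using below by (intro always_eventually allI less_imp_le)
  qed
  have side: "\<forall>k. hbar < hs k" if "hbar < h"
  proof
    fix k
    have "e / Suc k \<le> e" using e by (simp add: divide_le_eq)
    then show "hbar < hs k" using hs(1)[of k] that by (simp add: e_def)
  qed
  obtain \<delta> :: "real \<Rightarrow> real" where "displ h \<delta>" "\<And>t. 0 \<le> t \<Longrightarrow> (\<lambda>k. \<delta>s k t) \<longlonglongrightarrow> \<delta> t"
      "\<And>k t. 0 \<le> t \<Longrightarrow> \<delta>s k t \<le> \<delta> t"
    using displ_limit[OF smono lim below side hs(3)] by blast
  then show ?thesis using that[OF smono lim below hs(3)] by blast
qed

section \<open>The minimal displacement and its fronts\<close>

abbreviation "dD t h \<equiv> delta_D f \<mu> u\<^sub>0 t h"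

text \<open>Each \<open>\<delta>s k\<close> lies below every competitor \<open>\<eta>\<close> at
  level \<open>h\<close>, because \<open>hs k < h\<close> permits comparison; hence so does the
  limit. It is therefore minimal, and whatever \<open>SOME\<close> picks agrees with it at
  nonnegative times.\<close>

lemma delta_D_approx:
  obtains hs :: "nat \<Rightarrow> real" and \<delta>s :: "nat \<Rightarrow> real \<Rightarrow> real" where "strict_mono hs" "hs \<longlonglongrightarrow> h" "\<And>k. hs k < h"
    "\<And>k. displ (hs k) (\<delta>s k)" "displ h (\<lambda>t. dD t h)"
    "\<And>t. 0 \<le> t \<Longrightarrow> (\<lambda>k. \<delta>s k t) \<longlonglongrightarrow> dD t h" "\<And>k t. 0 \<le> t \<Longrightarrow> \<delta>s k t \<le> dD t h"
proof -
  obtain hs :: "nat \<Rightarrow> real" and \<delta>s :: "nat \<Rightarrow> real \<Rightarrow> real" and \<delta> :: "real \<Rightarrow> real" where *: "strict_mono hs" "hs \<longlonglongrightarrow> h" "\<And>k. hs k < h"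
    "\<And>k. displ (hs k) (\<delta>s k)" "displ h \<delta>" "\<And>t. 0 \<le> t \<Longrightarrow> (\<lambda>k. \<delta>s k t) \<longlonglongrightarrow> \<delta> t"
    "\<And>k t. 0 \<le> t \<Longrightarrow> \<delta>s k t \<le> \<delta> t"
    using exists_displ_approx by blast
  let ?P = "\<lambda>\<delta>. front_displacement f \<mu> (D h) h \<delta> \<and>
    (\<forall>\<eta>. front_displacement f \<mu> (D h) h \<eta> \<longrightarrow> (\<forall>s\<ge>0. \<delta> s \<le> \<eta> s))"
  have "?P \<delta>"
  proof (intro conjI allI impI)
    show fd: "front_displacement f \<mu> (D h) h \<delta>"
      by (rule displ_imp_front_displacement) fact
    fix \<eta> and s :: real assume \<eta>: "front_displacement f \<mu> (D h) h \<eta>" "0 \<le> s"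
    have "\<delta>s k s \<le> \<eta> s" for k
      using D_front_le[OF displ_imp_front_displacement[OF *(4)] \<eta>(1) *(3) \<eta>(2)] .
    then show "\<delta> s \<le> \<eta> s" by (intro LIMSEQ_le_const2[OF *(6)[OF \<eta>(2)]]) auto
  qed
  moreover have "?P (SOME \<delta>. ?P \<delta>)" using \<open>?P \<delta>\<close> by (rule someI[of ?P])
  ultimately have eq: "dD t h = \<delta> t" if "0 \<le> t" for t
    using that unfolding delta_D_def by (meson antisym)
  have 5: "displ h (\<lambda>t. dD t h)"
    using *(5) unfolding displ_def by (auto simp: eq)
  have 6: "(\<lambda>k. \<delta>s k t) \<longlonglongrightarrow> dD t h" if "0 \<le> t" for t
    using *(6)[OF that] eq[OF that] by simp
  have 7: "\<delta>s k t \<le> dD t h" if "0 \<le> t" for k t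
    using *(7)[OF that] eq[OF that] by simp
  show ?thesis by (rule that[OF *(1-4) 5 6 7])
qed

lemma delta_D_displ: "displ h (\<lambda>t. dD t h)"
  using delta_D_approx by blast

lemma delta_D_mono:
  assumes "h < h'" "0 \<le> t"
  shows "dD t h \<le> dD t h'"
  by (rule D_front_le[OF displ_imp_front_displacement[OF delta_D_displ]
        displ_imp_front_displacement[OF delta_D_displ] assms])

lemma delta_D_minimal:
  assumes \<eta>: "front_displacement f \<mu> (D h) h \<eta>" and t: "0 \<le> t"
  shows "dD t h \<le> \<eta> t"
proof -
  obtain hs :: "nat \<Rightarrow> real" and \<delta>s :: "nat \<Rightarrow> real \<Rightarrow> real" where
    hs: "strict_mono hs" "hs \<longlonglongrightarrow> h" "\<And>k. hs k < h"
    and \<delta>s: "\<And>k. displ (hs k) (\<delta>s k)" and "displ h (\<lambda>t. dD t h)"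
    and lim: "\<And>t. 0 \<le> t \<Longrightarrow> (\<lambda>k. \<delta>s k t) \<longlonglongrightarrow> dD t h"
    and le: "\<And>k t. 0 \<le> t \<Longrightarrow> \<delta>s k t \<le> dD t h"
    by (rule delta_D_approx[of h]) (rule that)
  have "\<delta>s k t \<le> \<eta> t" for k
    by (rule D_front_le[OF displ_imp_front_displacement[OF \<delta>s] \<eta> hs(3) t])
  then show ?thesis by (intro LIMSEQ_le_const2[OF lim[OF t]]) auto
qed

text \<open>\<open>front t h\<close> will turn out to be the sublevel set \<open>{u\<^sub>D(\<cdot>, t) < h}\<close>.\<close>

definition "front t h = D h (dD t h)"

lemma front_0: "front 0 h = {x. u\<^sub>0 x < h}"
  using displ_0[OF delta_D_displ, of h] by (simp add: front_def D_0)

lemma front_mono: "h \<le> h' \<Longrightarrow> 0 \<le> t \<Longrightarrow> front t h \<subseteq> front t h'"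
  unfolding front_def using delta_D_mono[of h h' t] D_mono[of h h' "dD t h" "dD t h'"]
  by (cases "h = h'") simp_all

text \<open>Fronts of lower levels exhaust the front of level \<open>h\<close>: displacements
  converge from below and parallel sets are left continuous in both parameters.\<close>

lemma front_left:
  assumes x: "x \<in> front t h" and t: "0 \<le> t"
  obtains h' where "h' < h" "x \<in> front t h'"
proof -
  obtain hs :: "nat \<Rightarrow> real" and \<delta>s :: "nat \<Rightarrow> real \<Rightarrow> real" where
    hs: "strict_mono hs" "hs \<longlonglongrightarrow> h" "\<And>k. hs k < h"
    and \<delta>s: "\<And>k. displ (hs k) (\<delta>s k)" and "displ h (\<lambda>t. dD t h)"
    and lim: "\<And>t. 0 \<le> t \<Longrightarrow> (\<lambda>k. \<delta>s k t) \<longlonglongrightarrow> dD t h"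
    and le: "\<And>k t. 0 \<le> t \<Longrightarrow> \<delta>s k t \<le> dD t h"
    by (rule delta_D_approx[of h]) (rule that)
  have "D h (dD t h) \<subseteq> (\<Union>k. D (hs k) (\<delta>s k t))"
    by (rule D_set_subset_UN[OF u0_cont hs(2) less_imp_le[OF hs(3)] lim[OF t] le[OF t]])
  then obtain k where k: "x \<in> D (hs k) (\<delta>s k t)" using x by (auto simp: front_def)
  \<comment> \<open>Comparison needs strictly ordered levels, hence the passage from
    \<open>hs k\<close> to \<open>hs (Suc k)\<close>.\<close>
  have less: "hs k < hs (Suc k)" using hs(1) by (simp add: strict_monoD)
  have "\<delta>s k t \<le> dD t (hs (Suc k))"
    by (rule D_front_le[OF displ_imp_front_displacement[OF \<delta>s]
          displ_imp_front_displacement[OF delta_D_displ] less t])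
  then have "x \<in> D (hs (Suc k)) (dD t (hs (Suc k)))"
    using k less D_mono[of "hs k" "hs (Suc k)" "\<delta>s k t" "dD t (hs (Suc k))"] by auto
  then show ?thesis by (intro that[OF hs(3)[of "Suc k"]]) (simp add: front_def)
qed

text \<open>The gap between the levels \<open>h\<close> and \<open>h + e\<close> is shared: one half
  absorbs the shift in space, the other the motion of the front between the two times. As
  \<open>d\<close> does not depend on \<open>h\<close>, this is a modulus of continuity for
  \<open>u\<close>.\<close>

lemma front_gap:
  assumes "0 < e"
  obtains d where "0 < d" "\<And>h t s x y. 0 \<le> t \<Longrightarrow> 0 \<le> s \<Longrightarrow> dist x y < d \<Longrightarrow> C * \<bar>t - s\<bar> \<le> d \<Longrightarrow>
     x \<in> front t h \<Longrightarrow> y \<in> front s (h + e)"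
proof -
  obtain d where d: "0 < d" "\<And>h a. D h a \<subseteq> D (h + e) (a - d)"
    using D_set_gap[OF u0_unif assms] by blast
  have "y \<in> front s (h + e)"
    if st: "0 \<le> t" "0 \<le> s" and xy: "dist x y < d / 2" and ts: "C * \<bar>t - s\<bar> \<le> d / 2"
      and x: "x \<in> front t h" for h t s x y
  proof -
    have "dD t h \<le> dD t (h + e)" using delta_D_mono assms st by simp
    moreover have "dD t (h + e) \<le> dD s (h + e) + d / 2"
      using displ_lipschitz[OF delta_D_displ st(2,1), of "h + e"] ts by linarith
    moreover have "x \<in> D (h + e) (dD t h - d)" using x d(2) by (auto simp: front_def)
    ultimately have "x \<in> D (h + e) (dD s (h + e) - d / 2)"
      using D_mono[of "h + e" "h + e" "dD t h - d" "dD s (h + e) - d / 2"] by auto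
    then show ?thesis
      using D_set_dist_less[OF u0_cont, of x "h + e" _ y "d / 2"] xy
      by (force simp: front_def dist_commute)
  qed
  then show ?thesis using that[of "d / 2"] d by auto
qed

text \<open>For a positive displacement the value function minimises over a closed ball, while the
  front is described by open balls; openness of the sublevel set reconciles the two. For a
  nonpositive displacement both use closed balls.\<close>

lemma U_D_nonneg_iff:
  assumes t: "0 \<le> t"
  shows "0 \<le> U_D f \<mu> u\<^sub>0 hbar x t h \<longleftrightarrow> x \<notin> front t h"
proof (cases "hbar < h")
  case True
  have "0 \<le> dD t h"
    using displ_mono[OF delta_D_displ True, of 0 t] displ_0[OF delta_D_displ, of h] t by simp
  then obtain z where z: "z \<in> cball x (dD t h)" "\<And>y. y \<in> cball x (dD t h) \<Longrightarrow> u\<^sub>0 z \<le> u\<^sub>0 y"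
    using continuous_attains_inf[OF _ _ continuous_on_subset[OF u0_cont], of "cball x (dD t h)"] by auto
  have "(INF y\<in>cball x (dD t h). U_0 u\<^sub>0 y h) = u\<^sub>0 z - h"
    using z unfolding U_0_def by (intro cInf_eq_minimum) auto
  then have "0 \<le> U_D f \<mu> u\<^sub>0 hbar x t h \<longleftrightarrow> (\<forall>y. dist x y \<le> dD t h \<longrightarrow> h \<le> u\<^sub>0 y)"
    using True z by (simp add: U_D_def) (meson order_trans)
  also have "\<dots> \<longleftrightarrow> x \<notin> front t h"
  proof (cases "0 < dD t h")
    case pos: True
    show ?thesis
    proof
      assume "\<forall>y. dist x y \<le> dD t h \<longrightarrow> h \<le> u\<^sub>0 y"
      then have "\<not> (\<exists>y. dist x y < dD t h \<and> u\<^sub>0 y < h)"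
        by (meson less_imp_le not_less)
      then show "x \<notin> front t h" using pos by (simp add: front_def D_set_pos)
    next
      assume x: "x \<notin> front t h"
      show "\<forall>y. dist x y \<le> dD t h \<longrightarrow> h \<le> u\<^sub>0 y"
      proof (rule ccontr)
        assume "\<not> (\<forall>y. dist x y \<le> dD t h \<longrightarrow> h \<le> u\<^sub>0 y)"
        then obtain y where y: "dist x y \<le> dD t h" "y \<in> D h 0" by (auto simp: D_0 not_le)
        then obtain e where e: "0 < e" "\<And>y'. dist y' y < e \<Longrightarrow> y' \<in> D h 0"
          using D_open[of h 0] unfolding open_dist by blast
        have "dist x y < dD t h + e / 2" using y e by simp
        then obtain y' where "dist x y' < dD t h" "dist y' y \<le> e / 2"
          by (rule dist_split_less) (use pos e in auto)
        then have "\<exists>y'. dist x y' < dD t h \<and> u\<^sub>0 y' < h"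
          using e(1) e(2)[of y'] by (auto simp: D_0)
        then show False using x pos by (simp add: front_def D_set_pos)
      qed
    qed
  next
    case False
    then have "dD t h = 0" using \<open>0 \<le> dD t h\<close> by simp
    then show ?thesis by (auto simp: front_def D_0 not_less)
  qed
  finally show ?thesis .
next
  case False
  have "dD t h \<le> 0"
    using displ_antimono[OF delta_D_displ, of h 0 t] displ_0[OF delta_D_displ, of h] t False by simp
  then obtain z where z: "z \<in> cball x (- dD t h)" "\<And>y. y \<in> cball x (- dD t h) \<Longrightarrow> u\<^sub>0 y \<le> u\<^sub>0 z"
    using continuous_attains_sup[OF _ _ continuous_on_subset[OF u0_cont], of "cball x (- dD t h)"] by auto
  have "(SUP y\<in>cball x (- dD t h). U_0 u\<^sub>0 y h) = u\<^sub>0 z - h"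
    using z unfolding U_0_def by (intro cSup_eq_maximum) auto
  then have "0 \<le> U_D f \<mu> u\<^sub>0 hbar x t h \<longleftrightarrow> (\<exists>y. dist x y \<le> - dD t h \<and> h \<le> u\<^sub>0 y)"
    using False z by (simp add: U_D_def) (meson order_trans)
  then show ?thesis
    using \<open>dD t h \<le> 0\<close> by (auto simp: front_def D_set_nonpos[OF u0_cont] not_less)
qed

section \<open>The function \<open>u\<close> and its sublevel sets\<close>

abbreviation "u \<equiv> u_D f \<mu> u\<^sub>0 hbar"

text \<open>Finite speed of propagation. It makes the supremum that defines \<open>u\<close>
  meaningful and later gives the growth bound.\<close>

lemma front_bounds:
  assumes t: "0 \<le> t"
  shows "(\<And>y. dist x y \<le> C * t \<Longrightarrow> u\<^sub>0 y < h) \<Longrightarrow> x \<in> front t h"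
    and "x \<in> front t h \<Longrightarrow> \<exists>y. dist x y \<le> C * t \<and> u\<^sub>0 y < h"
proof -
  have b: "\<bar>dD t h\<bar> \<le> C * t"
    using displ_lipschitz[OF delta_D_displ, of 0 t h] displ_0[OF delta_D_displ, of h] t by simp
  have Ct: "0 \<le> C * t" using C_nonneg t by simp
  show "x \<in> front t h" if "\<And>y. dist x y \<le> C * t \<Longrightarrow> u\<^sub>0 y < h"
  proof -
    have "x \<in> D h (- (C * t))" using that Ct by (simp add: D_set_nonpos[OF u0_cont])
    moreover have "D h (- (C * t)) \<subseteq> front t h" unfolding front_def using b by (intro D_mono) auto
    ultimately show ?thesis by blast
  qed
  show "\<exists>y. dist x y \<le> C * t \<and> u\<^sub>0 y < h" if x: "x \<in> front t h"
  proof (cases "0 < dD t h")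
    case True
    then obtain y where "dist x y < dD t h" "u\<^sub>0 y < h" using x by (auto simp: front_def D_set_pos)
    then show ?thesis using b by (intro exI[of _ y]) auto
  next
    case False
    then have "u\<^sub>0 x < h" using x by (simp add: front_def D_set_nonpos[OF u0_cont])
    then show ?thesis using Ct by (intro exI[of _ x]) simp
  qed
qed

text \<open>The set \<open>H\<close> of levels whose front misses \<open>x\<close> is closed
  downwards. Finite speed makes it nonempty and bounded above, and \<open>front_left\<close> makes
  it contain its supremum, which is what the strict inequality needs.\<close>

lemma u_less_iff:
  assumes t: "0 \<le> t"
  shows "u (x, t) < h \<longleftrightarrow> x \<in> front t h"
proof -
  define H where "H = {h. x \<notin> front t h}"
  have u: "u (x, t) = Sup H" by (simp add: u_D_def U_D_nonneg_iff[OF t] H_def)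
  have Ct: "0 \<le> C * t" using C_nonneg t by simp
  have "\<exists>z\<in>cball x (C * t). \<forall>y\<in>cball x (C * t). u\<^sub>0 y \<le> u\<^sub>0 z"
    by (rule continuous_attains_sup[OF _ _ continuous_on_subset[OF u0_cont]]) (use Ct in auto)
  then obtain b where "\<forall>y\<in>cball x (C * t). u\<^sub>0 y \<le> b" by blast
  then have b: "u\<^sub>0 y \<le> b" if "dist x y \<le> C * t" for y using that by simp
  have "\<exists>z\<in>cball x (C * t). \<forall>y\<in>cball x (C * t). u\<^sub>0 z \<le> u\<^sub>0 y"
    by (rule continuous_attains_inf[OF _ _ continuous_on_subset[OF u0_cont]]) (use Ct in auto)
  then obtain a where "\<forall>y\<in>cball x (C * t). a \<le> u\<^sub>0 y" by blast
  then have a: "a \<le> u\<^sub>0 y" if "dist x y \<le> C * t" for y using that by simp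
  have "a \<in> H" unfolding H_def using front_bounds(2)[OF t, of x a] a not_less by blast
  have up: "x \<in> front t h'" if "x \<in> front t h" "h \<le> h'" for h h'
    using that front_mono[OF _ t] by blast
  have "h' \<le> b + 1" if "h' \<in> H" for h'
  proof (rule ccontr)
    assume "\<not> h' \<le> b + 1"
    then have "x \<in> front t h'" using b by (intro front_bounds(1)[OF t]) fastforce
    then show False using that by (simp add: H_def)
  qed
  then have bdd: "bdd_above H" by (rule bdd_aboveI)
  show ?thesis
  proof
    assume "u (x, t) < h"
    then have "h \<notin> H" using cSup_upper[OF _ bdd, of h] u by auto
    then show "x \<in> front t h" by (simp add: H_def)
  next
    assume "x \<in> front t h"
    then obtain h' where h': "h' < h" "x \<in> front t h'" using front_left t by blast
    have "g \<le> h'" if "g \<in> H" for g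
      using up[OF h'(2), of g] that by (force simp: H_def)
    then have "Sup H \<le> h'" using \<open>a \<in> H\<close> by (intro cSup_least) auto
    then show "u (x, t) < h" using u h' by simp
  qed
qed

lemma u_0: "u (x, 0) = u\<^sub>0 x"
proof -
  have "u (x, 0) < h \<longleftrightarrow> u\<^sub>0 x < h" for h
    by (simp add: u_less_iff front_0)
  then show ?thesis by (metis linorder_neq_iff order_less_irrefl)
qed

lemma u_uniform:
  assumes e: "0 < e"
  obtains d where "0 < d" "\<And>t s x y. 0 \<le> t \<Longrightarrow> 0 \<le> s \<Longrightarrow> dist x y < d \<Longrightarrow> C * \<bar>t - s\<bar> \<le> d \<Longrightarrow>
    \<bar>u (x, t) - u (y, s)\<bar> \<le> e"
proof -
  obtain d where d: "0 < d" "\<And>h t s x y. 0 \<le> t \<Longrightarrow> 0 \<le> s \<Longrightarrow> dist x y < d \<Longrightarrow> C * \<bar>t - s\<bar> \<le> d \<Longrightarrow>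
     x \<in> front t h \<Longrightarrow> y \<in> front s (h + e)"
    using front_gap[OF e] by blast
  have *: "u (y, s) \<le> u (x, t) + e"
    if "0 \<le> t" "0 \<le> s" "dist x y < d" "C * \<bar>t - s\<bar> \<le> d" for t s x y
  proof (rule field_le_epsilon)
    fix k :: real assume "0 < k"
    then have "x \<in> front t (u (x, t) + k)" using that by (simp flip: u_less_iff)
    then have "y \<in> front s (u (x, t) + k + e)" using d(2) that by blast
    then show "u (y, s) \<le> u (x, t) + e + k" using that by (simp flip: u_less_iff)
  qed
  have "\<bar>u (x, t) - u (y, s)\<bar> \<le> e"
    if "0 \<le> t" "0 \<le> s" "dist x y < d" "C * \<bar>t - s\<bar> \<le> d" for t s x y
    using *[OF that] *[of s t y x] that by (simp add: dist_commute abs_minus_commute abs_le_iff)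
  then show ?thesis using that d(1) by blast
qed

lemma u_continuous: "continuous_on (UNIV \<times> {0..}) u"
  unfolding continuous_on_iff
proof (intro ballI allI impI)
  fix z :: "(real^'n) \<times> real" and e :: real
  assume z: "z \<in> UNIV \<times> {0..}" and e: "0 < e"
  obtain d where d: "0 < d" "\<And>t s x y. 0 \<le> t \<Longrightarrow> 0 \<le> s \<Longrightarrow> dist x y < d \<Longrightarrow> C * \<bar>t - s\<bar> \<le> d \<Longrightarrow>
    \<bar>u (x, t) - u (y, s)\<bar> \<le> e / 2"
    using u_uniform[of "e / 2"] e by auto
  show "\<exists>d>0. \<forall>w\<in>UNIV \<times> {0..}. dist w z < d \<longrightarrow> dist (u w) (u z) < e"
  proof (intro exI conjI ballI impI)
    show "0 < d / (C + 1)" using d C_nonneg by simp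
    fix w assume w: "w \<in> UNIV \<times> {0..}" "dist w z < d / (C + 1)"
    have "d / (C + 1) \<le> d" using d C_nonneg by (simp add: divide_le_eq)
    then have 1: "dist (fst w) (fst z) < d"
      using dist_fst_le[of w z] w(2) by linarith
    have "C * dist (snd w) (snd z) \<le> (C + 1) * dist w z"
      using dist_snd_le[of w z] C_nonneg by (intro mult_mono) auto
    also have "\<dots> < d"
      using w(2) C_nonneg by (simp add: pos_less_divide_eq mult.commute)
    finally have 2: "C * \<bar>snd w - snd z\<bar> \<le> d"
      by (simp add: dist_real_def)
    have "\<bar>u (fst w, snd w) - u (fst z, snd z)\<bar> \<le> e / 2"
      using d(2) 1 2 w z by auto
    then show "dist (u w) (u z) < e" using e by (simp add: dist_real_def)
  qed
qed

end

section \<open>The subsolution property\<close>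

lemma continuous_imp_locally_bounded_on:
  fixes u :: "'a::metric_space \<Rightarrow> real"
  assumes "continuous_on S u"
  shows "locally_bounded_on S u"
  unfolding locally_bounded_on_def
proof
  fix z assume "z \<in> S"
  then obtain e where e: "0 < e" "\<And>w. w \<in> S \<Longrightarrow> dist w z < e \<Longrightarrow> dist (u w) (u z) < 1"
    using assms unfolding continuous_on_iff by (metis zero_less_one)
  have "u ` (ball z e \<inter> S) \<subseteq> ball (u z) 1"
    using e(2) by (auto simp: dist_commute)
  then have "bounded (u ` (ball z e \<inter> S))" by (rule bounded_subset[OF bounded_ball])
  then show "\<exists>e>0. bounded (u ` (ball z e \<inter> S))" using e(1) by blast
qed

lemma continuous_imp_usc_on: "continuous_on S u \<Longrightarrow> usc_on S u"
  unfolding usc_on_def continuous_on_def by (blast intro: order_tendstoD(2))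

lemma local_max_onE:
  fixes z :: "'a::metric_space"
  assumes "local_max_on S g z"
  obtains e where "0 < e" "\<And>w. w \<in> S \<Longrightarrow> dist w z < e \<Longrightarrow> g w \<le> g z"
  using assms unfolding local_max_on_def eventually_at by (metis order_refl)

text \<open>Linearisation of \<open>\<phi>\<close> along the displacement
  \<open>(z - x, - \<tau>)\<close>, whose length is of order \<open>\<tau>\<close>. The point
  \<open>z\<close> may depend on \<open>\<tau>\<close> in any way; only its distance and its
  component along \<open>p\<close> are controlled.\<close>

lemma gradient_backward_le:
  fixes \<phi> :: "'a::real_inner \<times> real \<Rightarrow> real"
  assumes G: "GDERIV \<phi> (x, t) :> (p, q)" and K: "0 \<le> K" and \<tau>0: "0 < \<tau>0"
    and step: "\<And>\<tau>. 0 < \<tau> \<Longrightarrow> \<tau> < \<tau>0 \<Longrightarrow>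
      \<exists>z. norm (z - x) \<le> K * \<tau> \<and> p \<bullet> (z - x) \<le> - (\<tau> * k) \<and> \<phi> (x, t) \<le> \<phi> (z, t - \<tau>)"
  shows "q + k \<le> 0"
proof (rule ccontr)
  assume "\<not> q + k \<le> 0"
  define c where "c = q + k"
  have c: "0 < c" using \<open>\<not> q + k \<le> 0\<close> by (simp add: c_def)
  \<comment> \<open>Chosen such that the linearisation error is at most half of
    \<open>c * \<tau>\<close>.\<close>
  define e where "e = c / (2 * (K + 1))"
  have e: "0 < e" "e * (K + 1) = c / 2" using c K by (auto simp: e_def divide_simps)
  obtain d where d: "0 < d" "\<And>y. norm (y - (x, t)) < d \<Longrightarrow>
      norm (\<phi> y - \<phi> (x, t) - (y - (x, t)) \<bullet> (p, q)) \<le> e * norm (y - (x, t))"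
    using G e(1) unfolding gderiv_def has_derivative_at_alt by (metis (no_types))
  define \<tau> where "\<tau> = min (\<tau>0 / 2) (d / (2 * (K + 1)))"
  have \<tau>: "0 < \<tau>" "\<tau> < \<tau>0" using \<tau>0 d K by (auto simp: \<tau>_def min_less_iff_disj)
  have "\<tau> \<le> d / (2 * (K + 1))" by (simp add: \<tau>_def)
  then have \<tau>d: "(K + 1) * \<tau> < d" using K d by (simp add: field_simps)
  obtain z where z: "norm (z - x) \<le> K * \<tau>" "p \<bullet> (z - x) \<le> - (\<tau> * k)" "\<phi> (x, t) \<le> \<phi> (z, t - \<tau>)"
    using step[OF \<tau>] by blast
  have diff: "(z, t - \<tau>) - (x, t) = (z - x, - \<tau>)" by simp
  have "norm (z - x, - \<tau>) \<le> norm (z - x) + norm (- \<tau>)" by (rule norm_Pair_le)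
  also have "\<dots> \<le> (K + 1) * \<tau>" using z(1) \<tau> by (simp add: algebra_simps)
  finally have n: "norm (z - x, - \<tau>) \<le> (K + 1) * \<tau>" .
  then have "norm (\<phi> (z, t - \<tau>) - \<phi> (x, t) - (z - x, - \<tau>) \<bullet> (p, q)) \<le> e * norm (z - x, - \<tau>)"
    using d(2)[of "(z, t - \<tau>)"] \<tau>d unfolding diff by simp
  also have "\<dots> \<le> e * ((K + 1) * \<tau>)" using n e by (intro mult_left_mono) auto
  also have "\<dots> = (e * (K + 1)) * \<tau>" by (simp only: mult.assoc)
  also have "\<dots> = c * \<tau> / 2" by (simp only: e(2) times_divide_eq_left)
  finally have "\<bar>\<phi> (z, t - \<tau>) - \<phi> (x, t) - (z - x, - \<tau>) \<bullet> (p, q)\<bar> \<le> c * \<tau> / 2"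
    unfolding real_norm_def .
  then have "\<phi> (z, t - \<tau>) - \<phi> (x, t) \<le> (z - x, - \<tau>) \<bullet> (p, q) + c * \<tau> / 2"
    by linarith
  also have "(z - x, - \<tau>) \<bullet> (p, q) = (z - x) \<bullet> p - \<tau> * q" by simp
  also have "(z - x) \<bullet> p - \<tau> * q + c * \<tau> / 2 \<le> - (\<tau> * k) - \<tau> * q + c * \<tau> / 2"
    using z(2) by (simp add: inner_commute)
  also have "\<dots> = - (c * \<tau> / 2)" by (simp add: c_def field_simps)
  finally show False using z(3) mult_pos_pos[OF c \<tau>(1)] by linarith
qed

text \<open>Chaining: each step of length at most \<open>d\<close> changes \<open>w\<close> by less
  than 1, and about \<open>norm x / d\<close> steps lead from the origin to
  \<open>x\<close>.\<close>

lemma uniformly_continuous_linear_growth: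
  fixes w :: "'a::real_normed_vector \<Rightarrow> real"
  assumes "uniformly_continuous_on UNIV w"
  obtains M where "0 < M" "\<And>x. \<bar>w x\<bar> \<le> M * (norm x + 1)"
proof -
  obtain d0 where d0: "0 < d0" "\<And>x y. dist x y < d0 \<Longrightarrow> dist (w x) (w y) < 1"
    using uniformly_continuous_onE[OF assms zero_less_one] by (auto simp: dist_commute)
  define d where "d = d0 / 2"
  have d: "0 < d" "d < d0" using d0 by (auto simp: d_def)
  have *: "\<bar>w x - w 0\<bar> \<le> real n" if "norm x \<le> real n * d" for n x
    using that
  proof (induction n arbitrary: x)
    case 0
    then show ?case by simp
  next
    case (Suc n)
    have "dist 0 x \<le> real n * d + d" using Suc.prems by (simp add: algebra_simps)
    then obtain z where z: "dist 0 z \<le> real n * d" "dist z x \<le> d"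
      by (rule dist_split) (use d in auto)
    have "\<bar>w z - w 0\<bar> \<le> real n" using z by (intro Suc.IH) simp
    moreover have "\<bar>w z - w x\<bar> < 1" using d0(2)[of z x] z d by (simp add: dist_real_def)
    ultimately show ?case by simp
  qed
  define M where "M = \<bar>w 0\<bar> + 1 + 1 / d"
  have "\<bar>w x\<bar> \<le> M * (norm x + 1)" for x
  proof -
    define n where "n = nat \<lceil>norm x / d\<rceil>"
    have n0: "0 \<le> norm x / d" using d by simp
    then have "norm x / d \<le> real n" "real n \<le> norm x / d + 1" by (auto simp: n_def)
    then have n: "norm x \<le> real n * d" "real n \<le> norm x / d + 1"
      using d by (simp_all add: pos_divide_le_eq)
    have "\<bar>w x\<bar> \<le> \<bar>w 0\<bar> + (norm x / d + 1)" using *[OF n(1)] n(2) by linarith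
    also have "\<dots> \<le> M * (norm x + 1)"
      using d by (simp add: M_def algebra_simps)
    finally show ?thesis .
  qed
  moreover have "0 < M" using d by (simp add: M_def add_nonneg_pos)
  ultimately show ?thesis using that by blast
qed

context nonlocal_front
begin

lemma u_linear_growth: "linear_growth u"
  unfolding linear_growth_def
proof (intro allI impI)
  fix T :: real assume T: "0 < T"
  obtain M where M: "0 < M" "\<And>x. \<bar>u\<^sub>0 x\<bar> \<le> M * (norm x + 1)"
    using uniformly_continuous_linear_growth[OF u0_unif] by blast
  have CT: "0 \<le> C * T" using C_nonneg T by simp
  show "\<exists>M>0. \<forall>x. \<forall>t\<in>{0..T}. \<bar>u (x, t)\<bar> \<le> M * (norm x + 1)"
  proof (intro exI conjI allI ballI)
    show "0 < M * (C * T + 2)" using M CT by simp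
    fix x :: "real^'n" and t assume t: "t \<in> {0..T}"
    define B where "B = M * (norm x + C * T + 2)"
    have u0: "\<bar>u\<^sub>0 y\<bar> < B" if "dist x y \<le> C * t" for y
    proof -
      have "C * t \<le> C * T" using t C_nonneg by (simp add: mult_left_mono)
      moreover have "norm y \<le> norm x + dist x y"
        by (metis dist_commute dist_norm norm_triangle_sub)
      ultimately have "norm y + 1 < norm x + C * T + 2" using that by linarith
      then have "M * (norm y + 1) < B" unfolding B_def using M(1) by simp
      then show ?thesis using M(2)[of y] by simp
    qed
    have "u (x, t) < B"
      using u0 t by (subst u_less_iff) (auto intro!: front_bounds(1) simp: abs_less_iff)
    moreover have "\<not> u (x, t) < - B"
      using u0 t front_bounds(2)[of t x "- B"] by (force simp: u_less_iff)
    ultimately have "\<bar>u (x, t)\<bar> \<le> B" by simp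
    also have "B \<le> M * (C * T + 2) * (norm x + 1)"
    proof -
      have "norm x + C * T + 2 \<le> (C * T + 2) * (norm x + 1)"
        using CT mult_nonneg_nonneg[OF CT norm_ge_zero[of x]] by (simp add: algebra_simps)
      then show ?thesis unfolding B_def using M(1) by (simp add: mult.assoc)
    qed
    finally show "\<bar>u (x, t)\<bar> \<le> M * (C * T + 2) * (norm x + 1)" .
  qed
qed

text \<open>\<open>m h\<close> is left continuous, by continuity of \<open>\<mu>\<close> along
  increasing sets and of \<open>f\<close>; monotonicity extends the bound to all larger
  displacements.\<close>

lemma m_left_limit:
  assumes "c < m h a"
  obtains b where "b < a" "\<And>b'. b \<le> b' \<Longrightarrow> c < m h b'"
proof -
  define as where "as k = a - 1 / Suc k" for k :: nat
  have as: "as \<longlonglongrightarrow> a"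
    unfolding as_def
    using tendsto_diff[OF tendsto_const[of a] LIMSEQ_inverse_real_of_nat[unfolded inverse_eq_divide]]
    by simp
  have asa: "as k < a" for k by (simp add: as_def)
  have "as k \<le> as (Suc k)" for k
    unfolding as_def by (intro diff_left_mono divide_left_mono) auto
  then have "incseq (\<lambda>k. D h (as k))" by (intro incseq_SucI D_mono) auto
  then have "(\<lambda>k. \<mu> (D h (as k))) \<longlonglongrightarrow> \<mu> (\<Union>k. D h (as k))"
    by (intro mu_incseq) auto
  moreover have "(\<Union>k. D h (as k)) = D h a"
  proof (intro equalityI UN_least)
    show "D h (as k) \<subseteq> D h a" for k using asa[of k] by (intro D_mono) auto
    show "D h a \<subseteq> (\<Union>k. D h (as k))"
      by (rule D_set_subset_UN[OF u0_cont tendsto_const order_refl as less_imp_le[OF asa]])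
  qed
  ultimately have "(\<lambda>k. (h, \<mu> (D h (as k)))) \<longlonglongrightarrow> (h, \<mu> (D h a))"
    by (intro tendsto_Pair) auto
  then have "(\<lambda>k. m h (as k)) \<longlonglongrightarrow> m h a"
    using continuous_on_tendsto_compose[OF f_cont, of "\<lambda>k. (h, \<mu> (D h (as k)))" _ sequentially]
      mu_range[OF D_borel] by (auto simp: m_def)
  then have "\<forall>\<^sub>F k in sequentially. c < m h (as k)" using assms by (rule order_tendstoD)
  then obtain k where "c < m h (as k)"
    using eventually_happens trivial_limit_sequentially by blast
  then show ?thesis using that[of "as k"] asa m_mono[OF order_refl] by (meson less_le_trans)
qed

text \<open>For small \<open>\<tau>\<close> a suitable point \<open>z\<close> outside the front at
  time \<open>t0 - \<tau>\<close> is fed into \<open>gradient_backward_le\<close>. Above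
  \<open>hbar\<close> it lies in the direction opposite to the gradient, otherwise on the way to a
  point \<open>y\<close> with \<open>h \<le> u\<^sub>0 y\<close>.\<close>

lemma u_subsolution: "viscosity_subsolution f \<mu> u"
  unfolding viscosity_subsolution_def
proof (intro conjI allI impI)
  have cont: "continuous_on pos_time u"
    by (rule continuous_on_subset[OF u_continuous]) auto
  show "locally_bounded_on pos_time u" "usc_on pos_time u"
    using cont by (auto intro: continuous_imp_locally_bounded_on continuous_imp_usc_on)
  fix \<phi> :: "(real^'n) \<times> real \<Rightarrow> real" and G x0 t0
  assume C1: "C1_with_gradient \<phi> G" and max: "local_max_on pos_time (\<lambda>z. u z - \<phi> z) (x0, t0)"
  obtain e where e: "0 < e"
    "\<And>w. w \<in> pos_time \<Longrightarrow> dist w (x0, t0) < e \<Longrightarrow> u w - \<phi> w \<le> u (x0, t0) - \<phi> (x0, t0)"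
    using local_max_onE[OF max] by blast
  have t0: "0 < t0" using max by (simp add: local_max_on_def)
  obtain p q where pq: "G (x0, t0) = (p, q)" by fastforce
  have grad: "GDERIV \<phi> (x0, t0) :> (p, q)"
    using C1 t0 unfolding C1_with_gradient_def by (metis UNIV_I greaterThan_iff mem_Times_iff pq fst_conv snd_conv)
  define h where "h = u (x0, t0)"
  define a where "a t = dD t h" for t
  have front: "front t h = D h (a t)" for t by (simp add: front_def a_def)
  have x0: "x0 \<notin> D h (a t0)"
    using u_less_iff[of t0 x0 h] t0 front[of t0] by (simp add: h_def)
  have "{y. u (y, t0) < h} = D h (a t0)"
    using t0 by (auto simp: u_less_iff front)
  then have c: "f h (\<mu> {y. u (y, t0) < h}) = m h (a t0)" by (simp add: m_def)
  have lip: "\<bar>a t - a s\<bar> \<le> C * \<bar>t - s\<bar>" if "0 \<le> s" "0 \<le> t" for s t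
    unfolding a_def by (rule displ_lipschitz[OF delta_D_displ that])
  \<comment> \<open>Outside the earlier front \<open>u\<close> is at least
    \<open>h = u (x0, t0)\<close>, so the local maximum orders the values of \<open>\<phi>\<close>.
    The bound by \<open>K * \<tau>\<close> keeps the point inside the neighbourhood of the
    maximum.\<close>
  have touch: "\<phi> (x0, t0) \<le> \<phi> (z, t0 - \<tau>)"
    if z: "z \<notin> D h (a (t0 - \<tau>))" "norm (z - x0) \<le> K * \<tau>"
      and \<tau>: "0 < \<tau>" "\<tau> < min t0 (e / (K + 1))" and K: "0 \<le> K" for z \<tau> K
  proof -
    have "(z, t0 - \<tau>) - (x0, t0) = (z - x0, - \<tau>)" by simp
    then have "dist (z, t0 - \<tau>) (x0, t0) \<le> norm (z - x0) + norm (- \<tau>)"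
      unfolding dist_norm by (metis norm_Pair_le)
    also have "\<dots> \<le> (K + 1) * \<tau>" using z \<tau> by (simp add: algebra_simps)
    also have "\<dots> < e" using \<tau> K by (simp add: pos_less_divide_eq mult.commute)
    finally have "u (z, t0 - \<tau>) - \<phi> (z, t0 - \<tau>) \<le> h - \<phi> (x0, t0)"
      using e(2)[of "(z, t0 - \<tau>)"] \<tau> by (simp add: h_def)
    moreover have "h \<le> u (z, t0 - \<tau>)"
      using u_less_iff[of "t0 - \<tau>" z h] z \<tau> by (simp add: front)
    ultimately show ?thesis by simp
  qed
  have "q + norm p * m h (a t0) \<le> 0"
  proof (cases "hbar < h")
    case True
    have mono: "a s \<le> a t" if "0 \<le> s" "s \<le> t" for s t
      unfolding a_def by (rule displ_mono[OF delta_D_displ True that])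
    have "a 0 = 0" unfolding a_def by (rule displ_0[OF delta_D_displ])
    then have "0 \<le> m h (a t0)"
      using sublevel_above[OF True] m_mono[of h h 0 "a t0"] mono[of 0 t0] t0 by simp
    then consider "m h (a t0) = 0" | "0 < m h (a t0)" by fastforce
    then show ?thesis
    proof cases
      case 1
      have "q + 0 \<le> 0"
      proof (rule gradient_backward_le[OF grad order_refl])
        show "0 < min t0 (e / (0 + 1))" using t0 e by simp
        fix \<tau> assume \<tau>: "0 < \<tau>" "\<tau> < min t0 (e / (0 + 1))"
        have "D h (a (t0 - \<tau>)) \<subseteq> D h (a t0)" using \<tau> by (intro D_mono mono) auto
        then have "\<phi> (x0, t0) \<le> \<phi> (x0, t0 - \<tau>)"
          using x0 touch[of x0 \<tau> 0] \<tau> by auto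
        then show "\<exists>z. norm (z - x0) \<le> 0 * \<tau> \<and> p \<bullet> (z - x0) \<le> - (\<tau> * 0) \<and> \<phi> (x0, t0) \<le> \<phi> (z, t0 - \<tau>)"
          by (intro exI[of _ x0]) simp
      qed
      then show ?thesis using 1 by simp
    next
      case 2
      \<comment> \<open>The slope bound involves the speed at the earlier displacement, which is at
        most \<open>m h (a t0)\<close>. Left continuity lifts it above any
        \<open>c < m h (a t0)\<close>; the supremum over \<open>c\<close> is taken at the
        end.\<close>
      have *: "q + norm p * c \<le> 0" if c: "0 < c" "c < m h (a t0)" for c
      proof -
        obtain b where b: "b < a t0" "\<And>b'. b \<le> b' \<Longrightarrow> c < m h b'"
          using m_left_limit[OF c(2)] by blast
        define \<tau>0 where "\<tau>0 = min (min t0 (e / (c + 1))) ((a t0 - b) / (C + 1))"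
        show ?thesis
        proof (rule gradient_backward_le[OF grad less_imp_le[OF c(1)]])
          show "0 < \<tau>0" using t0 e b c C_nonneg by (simp add: \<tau>0_def)
          fix \<tau> assume \<tau>: "0 < \<tau>" "\<tau> < \<tau>0"
          \<comment> \<open>A step of length \<open>\<tau> * c\<close> against the gradient; for
            \<open>p = 0\<close> division by zero makes it \<open>x0\<close>, which also
            serves.\<close>
          define z where "z = x0 - (\<tau> * c / norm p) *\<^sub>R p"
          have zn: "norm (z - x0) \<le> c * \<tau>" using \<tau> c by (simp add: z_def)
          have "p \<bullet> (z - x0) = - (\<tau> * c / norm p) * (norm p)\<^sup>2"
            by (simp add: z_def power2_norm_eq_inner)
          then have pz: "p \<bullet> (z - x0) \<le> - (\<tau> * (norm p * c))"
            by (simp add: power2_eq_square)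
          have "\<tau> * (C + 1) < a t0 - b"
            using \<tau> C_nonneg by (simp add: \<tau>0_def pos_less_divide_eq)
          then have "\<tau> * C < a t0 - b" using \<tau> by (simp add: algebra_simps)
          moreover have "a t0 - a (t0 - \<tau>) \<le> C * \<tau>"
            using lip[of "t0 - \<tau>" t0] \<tau> t0 by (simp add: \<tau>0_def)
          ultimately have "b \<le> a (t0 - \<tau>)" by (simp add: mult.commute)
          then have mc: "c < m h (a (t0 - \<tau>))" by (rule b(2))
          have "z \<notin> D h (a (t0 - \<tau>))"
          proof
            assume z: "z \<in> D h (a (t0 - \<tau>))"
            have "dist x0 z \<le> \<tau> * c" using zn by (simp add: dist_norm norm_minus_commute mult.commute)
            also have "\<dots> < \<tau> * m h (a (t0 - \<tau>))" using mc \<tau> by simp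
            also have "\<dots> \<le> a t0 - a (t0 - \<tau>)"
              using displ_slope(1)[OF delta_D_displ, of "t0 - \<tau>" t0 h] mono[of "t0 - \<tau>" t0] \<tau>
              by (simp add: a_def \<tau>0_def min_absorb1)
            finally have "x0 \<in> D h (a (t0 - \<tau>) + (a t0 - a (t0 - \<tau>)))"
              by (rule D_set_dist_less[OF u0_cont z])
            then show False using x0 by simp
          qed
          then have "\<phi> (x0, t0) \<le> \<phi> (z, t0 - \<tau>)"
            using touch zn \<tau> c by (simp add: \<tau>0_def)
          then show "\<exists>z. norm (z - x0) \<le> c * \<tau> \<and> p \<bullet> (z - x0) \<le> - (\<tau> * (norm p * c)) \<and> \<phi> (x0, t0) \<le> \<phi> (z, t0 - \<tau>)"
            using zn pz by blast
        qed
      qed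
      show ?thesis
      proof (cases "norm p = 0")
        case True
        then show ?thesis using *[of "m h (a t0) / 2"] 2 by simp
      next
        case False
        then have np: "0 < norm p" by simp
        have "m h (a t0) \<le> - q / norm p"
        proof (rule dense_le_bounded[OF 2])
          fix c assume "0 < c" "c < m h (a t0)"
          from *[OF this] have "c * norm p \<le> - q" by (simp add: mult.commute)
          then show "c \<le> - q / norm p" using np by (simp only: pos_le_divide_eq)
        qed
        then have "m h (a t0) * norm p \<le> - q" using np by (simp only: pos_le_divide_eq)
        then show ?thesis by (simp add: mult.commute)
      qed
    qed
  next
    case False
    then have hh: "h \<le> hbar" by simp
    have anti: "a t \<le> a s" if "0 \<le> s" "s \<le> t" for s t
      unfolding a_def by (rule displ_antimono[OF delta_D_displ hh that])
    have a0: "a 0 = 0" unfolding a_def by (rule displ_0[OF delta_D_displ])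
    define c where "c = m h (a t0)"
    have "q + norm p * c \<le> 0"
    proof (rule gradient_backward_le[OF grad abs_ge_zero[of c]])
      show "0 < min t0 (e / (\<bar>c\<bar> + 1))" using t0 e by simp
      fix \<tau> assume \<tau>: "0 < \<tau>" "\<tau> < min t0 (e / (\<bar>c\<bar> + 1))"
      have neg: "a t0 \<le> a (t0 - \<tau>)" "a (t0 - \<tau>) \<le> 0"
        using anti[of "t0 - \<tau>" t0] anti[of 0 "t0 - \<tau>"] a0 \<tau> by auto
      \<comment> \<open>\<open>y\<close> shows that the closed ball around \<open>x0\<close> leaves
        the sublevel set. A point \<open>z\<close> on the way to it is outside the earlier front and
        no farther from \<open>x0\<close> than the front has retreated; its direction is then
        handled by the Cauchy-Schwarz inequality.\<close>
      obtain y where y: "dist x0 y \<le> - a t0" "h \<le> u\<^sub>0 y"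
        using x0 neg by (auto simp: D_set_nonpos[OF u0_cont] not_less)
      have "dist x0 y \<le> (a (t0 - \<tau>) - a t0) + (- a (t0 - \<tau>))" using y by simp
      then obtain z where z: "dist x0 z \<le> a (t0 - \<tau>) - a t0" "dist z y \<le> - a (t0 - \<tau>)"
        by (rule dist_split) (use neg in auto)
      have zD: "z \<notin> D h (a (t0 - \<tau>))"
        using z(2) y neg by (auto simp: D_set_nonpos[OF u0_cont] not_less intro!: exI[of _ y])
      have "a (t0 - \<tau>) - a t0 \<le> - (\<tau> * c)"
        using displ_slope(1)[OF delta_D_displ, of "t0 - \<tau>" t0 h] neg \<tau>
        by (simp add: a_def c_def min_absorb2)
      then have zn: "norm (z - x0) \<le> - (\<tau> * c)"
        using z(1) by (simp add: dist_norm norm_minus_commute)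
      also have "\<dots> = (- c) * \<tau>" by simp
      also have "\<dots> \<le> \<bar>c\<bar> * \<tau>" using \<tau> by (intro mult_right_mono) auto
      finally have zn': "norm (z - x0) \<le> \<bar>c\<bar> * \<tau>" .
      have "p \<bullet> (z - x0) \<le> norm p * norm (z - x0)" by (rule norm_cauchy_schwarz)
      also have "\<dots> \<le> norm p * (- (\<tau> * c))" using zn by (intro mult_left_mono) auto
      finally have pz: "p \<bullet> (z - x0) \<le> - (\<tau> * (norm p * c))" by (simp add: algebra_simps)
      have "\<phi> (x0, t0) \<le> \<phi> (z, t0 - \<tau>)"
        by (rule touch[OF zD zn' \<tau>]) simp
      then show "\<exists>z. norm (z - x0) \<le> \<bar>c\<bar> * \<tau> \<and> p \<bullet> (z - x0) \<le> - (\<tau> * (norm p * c)) \<and> \<phi> (x0, t0) \<le> \<phi> (z, t0 - \<tau>)"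
        using zn' pz by blast
    qed
    then show ?thesis by (simp add: c_def)
  qed
  then show "snd (G (x0, t0)) + norm (fst (G (x0, t0))) * f (u (x0, t0)) (\<mu> {y. u (y, t0) < u (x0, t0)}) \<le> 0"
    using c by (simp add: pq h_def)
qed

end

section \<open>Maximality among subsolutions\<close>

text \<open>Squaring keeps the one-sided penalty continuously differentiable, as a test function has
  to be.\<close>

lemma DERIV_pos_part_square: "((\<lambda>r::real. (max 0 r)\<^sup>2) has_real_derivative 2 * max 0 r) (at r)"
proof -
  consider "r < 0" | "r = 0" | "0 < r" by linarith
  then show ?thesis
  proof cases
    case 1
    have "((\<lambda>r::real. 0) has_real_derivative 0) (at r)" by simp
    then have "((\<lambda>r::real. (max 0 r)\<^sup>2) has_real_derivative 0) (at r)"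
      by (rule has_field_derivative_transform_within_open[where S = "{..<0}"]) (use 1 in auto)
    then show ?thesis using 1 by simp
  next
    case 2
    have "((\<lambda>r::real. (max 0 r)\<^sup>2 / r) \<longlongrightarrow> 0) (at 0)"
    proof (rule Lim_null_comparison)
      show "\<forall>\<^sub>F r::real in at 0. norm ((max 0 r)\<^sup>2 / r) \<le> \<bar>r\<bar>"
        by (intro always_eventually allI) (auto simp: max_def power2_eq_square)
      show "((\<lambda>r::real. \<bar>r\<bar>) \<longlongrightarrow> 0) (at 0)"
        by (intro tendsto_rabs_zero tendsto_ident_at)
    qed
    then show ?thesis using 2 by (simp add: has_field_derivative_iff)
  next
    case 3
    have "((\<lambda>r::real. r\<^sup>2) has_real_derivative 2 * r) (at r)"
      by (auto intro!: derivative_eq_intros)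
    then have "((\<lambda>r::real. (max 0 r)\<^sup>2) has_real_derivative 2 * r) (at r)"
      by (rule has_field_derivative_transform_within_open[where S = "{0<..}"]) (use 3 in auto)
    then show ?thesis using 3 by simp
  qed
qed

text \<open>The test function is steep in the positive part of \<open>\<psi>\<close> and of \<open>t - t1\<close>, so the
  penalised subsolution attains its maximum inside the cylinder if it exceeds \<open>h\<close> where \<open>\<psi> \<le> 0\<close>.\<close>

lemma subsolution_barrier:
  fixes v :: "(real^'n) \<times> real \<Rightarrow> real"
  assumes sub: "viscosity_subsolution f \<mu> v" and cont: "continuous_on (UNIV \<times> {0..}) v"
    and \<psi>: "C1_with_gradient \<psi> H" and \<psi>cont: "continuous_on UNIV \<psi>"
    and st: "0 \<le> s" "s \<le> t1" "t1 < t2" and \<eta>: "0 < \<eta>"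
    and bdd: "bounded {z \<in> UNIV \<times> {s..t2}. \<psi> z \<le> \<eta>}"
    and init: "\<And>x. \<psi> (x, s) \<le> \<eta> \<Longrightarrow> v (x, s) \<le> h"
    and speed: "\<And>x t. s < t \<Longrightarrow> t < t2 \<Longrightarrow> h < v (x, t) \<Longrightarrow> c \<le> f (v (x, t)) (\<mu> {y. v (y, t) < v (x, t)})"
    and H: "\<And>x t. s < t \<Longrightarrow> t < t2 \<Longrightarrow> 0 < \<psi> (x, t) \<Longrightarrow> 0 \<le> snd (H (x, t)) + c * norm (fst (H (x, t)))"
    and x1: "\<psi> (x1, t1) \<le> 0"
  shows "v (x1, t1) \<le> h"
proof (rule ccontr)
  assume "\<not> v (x1, t1) \<le> h"
  then have vx1: "h < v (x1, t1)" by simp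
  \<comment> \<open>The tilt in time uses up less than the excess of \<open>v\<close> over
    \<open>h\<close> at \<open>(x1, t1)\<close> and makes the final inequality strict. The summand 1
    covers \<open>t1 = s\<close>.\<close>
  define \<epsilon> where "\<epsilon> = (v (x1, t1) - h) / (2 * (t1 - s + 1))"
  have \<epsilon>: "0 < \<epsilon>" using vx1 st by (simp add: \<epsilon>_def)
  have "\<epsilon> * (t1 - s + 1) = (v (x1, t1) - h) / 2" using st by (simp add: \<epsilon>_def field_simps)
  then have \<epsilon>1: "h < v (x1, t1) - \<epsilon> * (t1 - s)" using vx1 \<epsilon> by (simp add: algebra_simps)
  define K where "K = {z \<in> UNIV \<times> {s..t2}. \<psi> z \<le> \<eta>}"
  have "K = (UNIV \<times> {s..t2}) \<inter> \<psi> -` {..\<eta>}" by (auto simp: K_def)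
  also have "closed \<dots>"
    by (intro continuous_closed_preimage continuous_on_subset[OF \<psi>cont] closed_Times) auto
  finally have Kc: "compact K" using bdd by (simp add: compact_eq_bounded_closed K_def)
  have x1K: "(x1, t1) \<in> K" using x1 st \<eta> by (simp add: K_def)
  have vK: "continuous_on K v" using st by (intro continuous_on_subset[OF cont]) (auto simp: K_def)
  obtain zB where zB: "\<And>z. z \<in> K \<Longrightarrow> v z \<le> v zB"
    using continuous_attains_sup[OF Kc _ vK] x1K by blast
  define B where "B = v zB - h"
  have B: "0 < B" using zB[OF x1K] vx1 by (simp add: B_def)
  define \<kappa> where "\<kappa> = min (\<eta>\<^sup>2) ((t2 - t1)\<^sup>2)"
  have \<kappa>: "0 < \<kappa>" "\<kappa> \<le> \<eta>\<^sup>2" "\<kappa> \<le> (t2 - t1)\<^sup>2" using \<eta> st by (auto simp: \<kappa>_def)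
  \<comment> \<open>\<open>B\<close> is the largest excess of \<open>v\<close> over \<open>h\<close>
    on \<open>K\<close>. With this steepness the penalty is at least \<open>B\<close> wherever
    \<open>\<psi> = \<eta>\<close> or \<open>t = t2\<close>, so a maximum with value above
    \<open>h\<close> avoids these parts of the boundary.\<close>
  define \<Lambda> where "\<Lambda> = B / \<kappa>"
  have \<Lambda>: "0 < \<Lambda>" "\<Lambda> * \<kappa> = B" using B \<kappa> by (auto simp: \<Lambda>_def)
  define \<phi> where "\<phi> z = \<Lambda> * ((max 0 (\<psi> z))\<^sup>2 + (max 0 (snd z - t1))\<^sup>2) + \<epsilon> * (snd z - s)" for z
  define G where "G z = (2 * \<Lambda> * max 0 (\<psi> z)) *\<^sub>R H z + (0, 2 * \<Lambda> * max 0 (snd z - t1) + \<epsilon>)" for z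
  have \<phi>C1: "C1_with_gradient \<phi> G"
    unfolding C1_with_gradient_def
  proof (intro conjI ballI)
    fix z :: "(real^'n) \<times> real" assume z: "z \<in> UNIV \<times> {0<..}"
    have g\<psi>: "GDERIV \<psi> z :> H z" using \<psi> z unfolding C1_with_gradient_def by blast
    have gs: "GDERIV (\<lambda>z :: (real^'n) \<times> real. snd z - b) z :> (0, 1)" for b
      unfolding gderiv_def by (auto intro!: derivative_eq_intros simp: inner_prod_def fun_eq_iff)
    have g1: "((\<lambda>z. (max 0 (\<psi> z))\<^sup>2) has_derivative (\<lambda>k. k \<bullet> ((2 * max 0 (\<psi> z)) *\<^sub>R H z))) (at z)"
      using GDERIV_DERIV_compose[OF g\<psi> DERIV_pos_part_square] unfolding gderiv_def .
    have g2: "((\<lambda>z :: (real^'n) \<times> real. (max 0 (snd z - t1))\<^sup>2) has_derivative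
        (\<lambda>k. k \<bullet> ((2 * max 0 (snd z - t1)) *\<^sub>R (0, 1)))) (at z)"
      using GDERIV_DERIV_compose[OF gs DERIV_pos_part_square] unfolding gderiv_def .
    have "(\<phi> has_derivative (\<lambda>k. \<Lambda> * (k \<bullet> ((2 * max 0 (\<psi> z)) *\<^sub>R H z) +
        k \<bullet> ((2 * max 0 (snd z - t1)) *\<^sub>R (0, 1))) + \<epsilon> * (k \<bullet> (0, 1)))) (at z)"
      unfolding \<phi>_def
      by (intro has_derivative_add has_derivative_mult_right g1 g2 gs[unfolded gderiv_def])
    then show "GDERIV \<phi> z :> G z"
      unfolding gderiv_def G_def
      by (rule has_derivative_eq_rhs) (simp add: fun_eq_iff inner_add_right inner_prod_def algebra_simps)
  next
    have "continuous_on (UNIV \<times> {0<..}) H" using \<psi> unfolding C1_with_gradient_def by blast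
    then show "continuous_on (UNIV \<times> {0<..}) G"
      unfolding G_def
      by (intro continuous_intros continuous_on_subset[OF \<psi>cont]) auto
  qed
  have "continuous_on K \<phi>"
    unfolding \<phi>_def by (intro continuous_intros continuous_on_subset[OF \<psi>cont]) auto
  then obtain z where z: "z \<in> K" "\<And>w. w \<in> K \<Longrightarrow> v w - \<phi> w \<le> v z - \<phi> z"
    using continuous_attains_sup[OF Kc _ continuous_on_diff[OF vK]] x1K by blast
  obtain x t where zxt: "z = (x, t)" by fastforce
  have t: "s \<le> t" "t \<le> t2" "\<psi> z \<le> \<eta>" using z(1) by (auto simp: K_def zxt)
  have "\<phi> (x1, t1) = \<epsilon> * (t1 - s)" using x1 by (simp add: \<phi>_def)
  then have big: "h < v z - \<phi> z" using z(2)[OF x1K] \<epsilon>1 by simp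
  have terms: "0 \<le> \<Lambda> * (max 0 (\<psi> z))\<^sup>2" "0 \<le> \<Lambda> * (max 0 (t - t1))\<^sup>2" "0 \<le> \<epsilon> * (t - s)"
    using \<Lambda> \<epsilon> t by auto
  have \<phi>z: "\<phi> z = \<Lambda> * (max 0 (\<psi> z))\<^sup>2 + \<Lambda> * (max 0 (t - t1))\<^sup>2 + \<epsilon> * (t - s)"
    by (simp add: \<phi>_def zxt distrib_left)
  have vz: "h < v z" using big terms \<phi>z by linarith
  have \<phi>B: "\<phi> z < B" using big zB[OF z(1)] by (simp add: B_def)
  have "s \<noteq> t" using init[of x] vz t by (auto simp: zxt)
  then have st': "s < t" using t by simp
  have \<psi>lt: "\<psi> z < \<eta>"
  proof (rule ccontr)
    assume "\<not> \<psi> z < \<eta>"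
    then have "\<psi> z = \<eta>" using t by simp
    then have "\<Lambda> * \<kappa> \<le> \<Lambda> * (max 0 (\<psi> z))\<^sup>2" using \<Lambda> \<kappa> \<eta> by (intro mult_left_mono) auto
    then show False using \<phi>B \<phi>z terms \<Lambda> by linarith
  qed
  have tlt: "t < t2"
  proof (rule ccontr)
    assume "\<not> t < t2"
    then have "t = t2" using t by simp
    then have "\<Lambda> * \<kappa> \<le> \<Lambda> * (max 0 (t - t1))\<^sup>2" using \<Lambda> \<kappa> st by (intro mult_left_mono) auto
    then show False using \<phi>B \<phi>z terms \<Lambda> by linarith
  qed
  have "local_max_on pos_time (\<lambda>w. v w - \<phi> w) (x, t)"
    unfolding local_max_on_def
  proof
    show "(x, t) \<in> pos_time" using st' st by simp
    have op: "open (\<psi> -` {..<\<eta>} \<inter> UNIV \<times> {s<..<t2})"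
      by (intro open_Int open_Times open_vimage \<psi>cont) auto
    have "\<forall>\<^sub>F w in at (x, t) within pos_time. w \<in> \<psi> -` {..<\<eta>} \<inter> UNIV \<times> {s<..<t2}"
      by (rule eventually_at_in_open'[OF op, THEN filter_leD[OF at_le[OF subset_UNIV]]])
        (use \<psi>lt st' tlt in \<open>auto simp: zxt\<close>)
    then show "\<forall>\<^sub>F w in at (x, t) within pos_time. v w - \<phi> w \<le> v (x, t) - \<phi> (x, t)"
    proof eventually_elim
      case (elim w)
      then have "w \<in> K" by (auto simp: K_def)
      then show ?case using z(2) zxt by simp
    qed
  qed
  then have le: "snd (G (x, t)) + norm (fst (G (x, t))) * f (v (x, t)) (\<mu> {y. v (y, t) < v (x, t)}) \<le> 0"
    using sub \<phi>C1 unfolding viscosity_subsolution_def by blast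
  define k where "k = 2 * \<Lambda> * max 0 (\<psi> z)"
  have k: "0 \<le> k" using \<Lambda> by (simp add: k_def)
  have G: "fst (G (x, t)) = k *\<^sub>R fst (H (x, t))"
    "snd (G (x, t)) = k * snd (H (x, t)) + (2 * \<Lambda> * max 0 (t - t1) + \<epsilon>)"
    by (simp_all add: G_def k_def zxt)
  have "norm (fst (G (x, t))) * c \<le> norm (fst (G (x, t))) * f (v (x, t)) (\<mu> {y. v (y, t) < v (x, t)})"
    using speed[OF st' tlt, of x] vz zxt by (intro mult_left_mono) auto
  moreover have "snd (G (x, t)) + norm (fst (G (x, t))) * c =
      k * (snd (H (x, t)) + c * norm (fst (H (x, t)))) + 2 * \<Lambda> * max 0 (t - t1) + \<epsilon>"
    using k by (simp add: G algebra_simps)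
  moreover have "0 \<le> k * (snd (H (x, t)) + c * norm (fst (H (x, t))))"
  proof (cases "0 < \<psi> z")
    case True
    then show ?thesis using H[OF st' tlt, of x] k zxt by (intro mult_nonneg_nonneg) auto
  next
    case False
    then show ?thesis by (simp add: k_def)
  qed
  moreover have "0 \<le> 2 * \<Lambda> * max 0 (t - t1)" using \<Lambda> by simp
  ultimately show False using le \<epsilon> by linarith
qed

section \<open>Propagation of balls inside sublevel sets\<close>

lemma GDERIV_norm_square:
  fixes y :: "'a::real_inner"
  shows "GDERIV (\<lambda>z :: 'a \<times> real. (fst z - y) \<bullet> (fst z - y)) z :> (2 *\<^sub>R (fst z - y), 0)"
  unfolding gderiv_def
  by (auto intro!: derivative_eq_intros simp: inner_prod_def fun_eq_iff inner_commute inner_diff_right)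

text \<open>A ball inside \<open>{v \<le> h}\<close> spreads with speed \<open>c\<close>, or shrinks
  for negative \<open>c\<close>. For \<open>0 \<le> c\<close> the squared distance minus the squared
  radius is a smooth barrier. For \<open>c < 0\<close> its residual has the wrong sign outside the
  ball; there a regularised distance is used, whose gradient has norm at most 1.\<close>

lemma ball_propagation:
  fixes v :: "(real^'n) \<times> real \<Rightarrow> real"
  assumes sub: "viscosity_subsolution f \<mu> v" and cont: "continuous_on (UNIV \<times> {0..}) v"
    and ss': "0 \<le> s" "s \<le> s'" and \<rho>: "0 < \<rho>"
    and init: "\<And>x. dist y x < \<rho> \<Longrightarrow> v (x, s) \<le> h"
    and speed: "\<And>x t. s < t \<Longrightarrow> t < s' \<Longrightarrow> h < v (x, t) \<Longrightarrow> c \<le> f (v (x, t)) (\<mu> {y. v (y, t) < v (x, t)})"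
    and x: "dist y x < \<rho> + c * (s' - s)"
  shows "v (x, s') \<le> h"
proof (cases "s = s'")
  case True
  then show ?thesis using x init by simp
next
  case False
  then have less: "s < s'" using ss' by simp
  \<comment> \<open>The barrier needs an interval of times that extends beyond \<open>t1\<close>, so
    times before \<open>s'\<close> come first; \<open>s'\<close> itself follows by
    continuity.\<close>
  have inner: "v (x, t1) \<le> h" if t1: "s < t1" "t1 < s'" and xt1: "dist y x < \<rho> + c * (t1 - s)" for t1
  proof -
    define t2 where "t2 = (t1 + s') / 2"
    have t2: "t1 < t2" "t2 < s'" using t1 by (auto simp: t2_def)
    define X where "X = c * (t1 - s)"
    \<comment> \<open>A smaller radius that still reaches \<open>x\<close> at time
      \<open>t1\<close>; the difference to \<open>\<rho>\<close> leaves room for the margin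
      \<open>\<eta>\<close>.\<close>
    define \<rho>' where "\<rho>' = max (\<rho> / 2) ((\<rho> + dist y x - X) / 2)"
    have d: "dist y x < \<rho> + X" using xt1 by (simp add: X_def)
    have "dist y x - X < (\<rho> + dist y x - X) / 2" using d by (simp add: field_simps)
    also have "\<dots> \<le> \<rho>'" by (simp add: \<rho>'_def)
    finally have "dist y x < \<rho>' + X" by simp
    moreover have "0 < \<rho>'" using \<rho> by (simp add: \<rho>'_def less_max_iff_disj)
    moreover have "\<rho>' < \<rho>" using \<rho> d by (simp add: \<rho>'_def)
    ultimately have "0 < \<rho>'" "\<rho>' < \<rho>" "dist y x < \<rho>' + X" by simp_all
    then have \<rho>': "0 < \<rho>'" "\<rho>' < \<rho>" "dist y x < \<rho>' + c * (t1 - s)"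
      by (simp_all add: X_def)
    define r where "r t = \<rho>' + c * (t - s)" for t
    have speed2: "c \<le> f (v (x, t)) (\<mu> {y. v (y, t) < v (x, t)})"
      if "s < t" "t < t2" "h < v (x, t)" for x t
      using speed that t2 by simp
    have sq: "(w - y) \<bullet> (w - y) = (dist y w)\<^sup>2" for w
      by (simp add: dist_norm norm_minus_commute power2_norm_eq_inner)
    have ball_bdd: "bounded {z \<in> UNIV \<times> {s..t2}. P z}"
      if "\<And>w t. s \<le> t \<Longrightarrow> t \<le> t2 \<Longrightarrow> P (w, t) \<Longrightarrow> dist y w \<le> B" for P and B :: real
    proof (rule bounded_subset)
      show "bounded (cball y B \<times> {s..t2})" by (intro bounded_Times) auto
      show "{z \<in> UNIV \<times> {s..t2}. P z} \<subseteq> cball y B \<times> {s..t2}" using that by auto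
    qed
    show ?thesis
    proof (cases "0 \<le> c")
      case c: True
      define \<psi> where "\<psi> z = (fst z - y) \<bullet> (fst z - y) - (r (snd z))\<^sup>2" for z
      define H where "H z = (2 *\<^sub>R (fst z - y), - (2 * c * r (snd z)))" for z :: "(real^'n) \<times> real"
      define \<eta> where "\<eta> = (\<rho>\<^sup>2 - \<rho>'\<^sup>2) / 2"
      have "\<rho>'\<^sup>2 < \<rho>\<^sup>2" using \<rho>' by (intro power_strict_mono) auto
      then have \<eta>: "0 < \<eta>" "\<rho>'\<^sup>2 + \<eta> < \<rho>\<^sup>2" by (auto simp: \<eta>_def field_simps)
      have r0: "0 \<le> r t" if "s \<le> t" for t using that c \<rho>' by (simp add: r_def)
      show ?thesis
      proof (rule subsolution_barrier[OF sub cont, where \<psi> = \<psi> and H = H and s = s and \<eta> = \<eta> and c = c])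
        show "continuous_on UNIV \<psi>" unfolding \<psi>_def r_def by (intro continuous_intros)
        show "C1_with_gradient \<psi> H"
          unfolding C1_with_gradient_def
        proof (intro conjI ballI)
          show "continuous_on pos_time H" unfolding H_def r_def by (intro continuous_intros)
          fix z :: "(real^'n) \<times> real"
          have "((\<lambda>z. (r (snd z))\<^sup>2) has_derivative (\<lambda>k. 2 * r (snd z) * (c * snd k))) (at z)"
            unfolding r_def by (auto intro!: derivative_eq_intros)
          then have "(\<psi> has_derivative (\<lambda>k. k \<bullet> (2 *\<^sub>R (fst z - y), 0) - 2 * r (snd z) * (c * snd k))) (at z)"
            unfolding \<psi>_def by (intro has_derivative_diff GDERIV_norm_square[unfolded gderiv_def])
          then show "GDERIV \<psi> z :> H z"
            unfolding gderiv_def H_def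
            by (rule has_derivative_eq_rhs) (simp add: fun_eq_iff inner_prod_def)
        qed
        show "bounded {z \<in> UNIV \<times> {s..t2}. \<psi> z \<le> \<eta>}"
        proof (rule ball_bdd)
          fix w t assume t: "s \<le> t" "t \<le> t2" and "\<psi> (w, t) \<le> \<eta>"
          then have "(dist y w)\<^sup>2 \<le> \<eta> + (r t)\<^sup>2" by (simp add: \<psi>_def sq)
          also have "\<dots> \<le> \<eta> + (r t2)\<^sup>2"
            using t c r0[OF t(1)] by (intro add_left_mono power_mono) (auto simp: r_def mult_left_mono)
          finally show "dist y w \<le> sqrt (\<eta> + (r t2)\<^sup>2)" by (rule real_le_rsqrt)
        qed
        show "v (w, s) \<le> h" if "\<psi> (w, s) \<le> \<eta>" for w
        proof -
          have "(dist y w)\<^sup>2 < \<rho>\<^sup>2" using that \<eta> by (simp add: \<psi>_def sq r_def)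
          then have "dist y w < \<rho>" using \<rho> by (simp add: power2_less_imp_less)
          then show ?thesis by (rule init)
        qed
        show "0 \<le> snd (H (w, t)) + c * norm (fst (H (w, t)))" if "s < t" "t < t2" "0 < \<psi> (w, t)" for w t
        proof -
          have "(r t)\<^sup>2 < (dist y w)\<^sup>2" using that by (simp add: \<psi>_def sq)
          then have "r t < dist y w" by (rule power2_less_imp_less) simp
          then have "c * r t \<le> c * dist y w" using c by (intro mult_left_mono) auto
          moreover have "norm (fst (H (w, t))) = 2 * dist y w"
            by (simp add: H_def dist_norm norm_minus_commute)
          ultimately show ?thesis by (simp add: H_def)
        qed
        have "(dist y x)\<^sup>2 \<le> (r t1)\<^sup>2" using \<rho>' by (intro power_mono) (auto simp: r_def)
        then show "\<psi> (x, t1) \<le> 0" by (simp add: \<psi>_def sq)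
      qed (use ss' t1 t2 \<eta> speed2 in auto)
    next
      case c: False
      \<comment> \<open>\<open>\<sigma>\<close> smooths the distance at the centre and is chosen
        such that \<open>N (x, t1) = r t1\<close>, so the barrier vanishes at the target
        point.\<close>
      define \<sigma> where "\<sigma> = (r t1)\<^sup>2 - (dist y x)\<^sup>2"
      have \<sigma>: "0 < \<sigma>" using power_strict_mono[of "dist y x" "r t1" 2] \<rho>' by (simp add: \<sigma>_def r_def)
      define N where "N z = sqrt (\<sigma> + (fst z - y) \<bullet> (fst z - y))" for z :: "(real^'n) \<times> real"
      have N0: "0 < \<sigma> + (fst z - y) \<bullet> (fst z - y)" for z :: "(real^'n) \<times> real"
        using \<sigma> by (intro add_pos_nonneg) auto
      have N1: "0 < N z" for z using N0 by (simp add: N_def)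
      have N: "dist y (fst z) \<le> N z" for z
        unfolding N_def using \<sigma> by (intro real_le_rsqrt) (simp add: sq)
      define \<psi> where "\<psi> z = N z - r (snd z)" for z
      define H where "H z = ((1 / N z) *\<^sub>R (fst z - y), - c)" for z
      define \<eta> where "\<eta> = (\<rho> - \<rho>') / 2"
      have \<eta>: "0 < \<eta>" "\<rho>' + \<eta> < \<rho>" using \<rho>' by (auto simp: \<eta>_def field_simps)
      have contN: "continuous_on A N" for A unfolding N_def by (intro continuous_intros)
      show ?thesis
      proof (rule subsolution_barrier[OF sub cont, where \<psi> = \<psi> and H = H and s = s and \<eta> = \<eta> and c = c])
        show "continuous_on UNIV \<psi>" unfolding \<psi>_def r_def by (intro continuous_intros contN)
        show "C1_with_gradient \<psi> H"
          unfolding C1_with_gradient_def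
        proof (intro conjI ballI)
          show "continuous_on pos_time H"
            unfolding H_def using N1 by (intro continuous_intros contN) (metis less_irrefl)
          fix z :: "(real^'n) \<times> real"
          have "GDERIV (\<lambda>z :: (real^'n) \<times> real. \<sigma> + (fst z - y) \<bullet> (fst z - y)) z :> (2 *\<^sub>R (fst z - y), 0)"
            using has_derivative_add[OF has_derivative_const GDERIV_norm_square[of y z, unfolded gderiv_def]]
            unfolding gderiv_def by simp
          from GDERIV_DERIV_compose[OF this DERIV_real_sqrt[OF N0]]
          have gN: "(N has_derivative (\<lambda>k. k \<bullet> ((inverse (N z) / 2) *\<^sub>R (2 *\<^sub>R (fst z - y), 0)))) (at z)"
            unfolding gderiv_def N_def .
          have "((\<lambda>z. r (snd z)) has_derivative (\<lambda>k. c * snd k)) (at z)"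
            unfolding r_def by (auto intro!: derivative_eq_intros)
          then have "(\<psi> has_derivative
              (\<lambda>k. k \<bullet> ((inverse (N z) / 2) *\<^sub>R (2 *\<^sub>R (fst z - y), 0)) - c * snd k)) (at z)"
            unfolding \<psi>_def by (intro has_derivative_diff gN)
          then show "GDERIV \<psi> z :> H z"
            unfolding gderiv_def H_def
            by (rule has_derivative_eq_rhs) (simp add: fun_eq_iff inner_prod_def inverse_eq_divide)
        qed
        show "bounded {z \<in> UNIV \<times> {s..t2}. \<psi> z \<le> \<eta>}"
        proof (rule ball_bdd)
          fix w t assume t: "s \<le> t" "t \<le> t2" and "\<psi> (w, t) \<le> \<eta>"
          then have "dist y w \<le> \<eta> + r t" using N[of "(w, t)"] by (simp add: \<psi>_def)
          also have "\<dots> \<le> \<eta> + \<rho>'" using c t by (simp add: r_def mult_nonpos_nonneg)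
          finally show "dist y w \<le> \<eta> + \<rho>'" .
        qed
        show "v (w, s) \<le> h" if "\<psi> (w, s) \<le> \<eta>" for w
        proof -
          have "dist y w < \<rho>" using that \<eta> N[of "(w, s)"] by (simp add: \<psi>_def r_def)
          then show ?thesis by (rule init)
        qed
        show "0 \<le> snd (H (w, t)) + c * norm (fst (H (w, t)))" for w t
        proof -
          have "norm (fst (H (w, t))) = dist y w / N (w, t)"
            using N1[of "(w, t)"] by (simp add: H_def dist_norm norm_minus_commute)
          also have "\<dots> \<le> 1" using N[of "(w, t)"] N1[of "(w, t)"] by simp
          finally have "c * 1 \<le> c * norm (fst (H (w, t)))" using c by (intro mult_left_mono_neg) auto
          then show ?thesis by (simp add: H_def)
        qed
        show "\<psi> (x, t1) \<le> 0"
          using less_imp_le[OF le_less_trans[OF zero_le_dist \<rho>'(3)]]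
          by (simp add: \<psi>_def N_def sq \<sigma>_def r_def)
      qed (use ss' t1 t2 \<eta> speed2 in auto)
    qed
  qed
  show ?thesis
  proof (rule ccontr)
    assume "\<not> v (x, s') \<le> h"
    then have big: "h < v (x, s')" by simp
    have F: "at_left s' \<noteq> bot" by simp
    have "continuous_on {0..} (\<lambda>t. v (x, t))"
      by (rule continuous_on_compose2[OF cont]) (auto intro!: continuous_intros)
    then have "((\<lambda>t. v (x, t)) \<longlongrightarrow> v (x, s')) (at s' within {0..})"
      using ss' by (simp add: continuous_on_def)
    then have "((\<lambda>t. v (x, t)) \<longlongrightarrow> v (x, s')) (at s' within {s<..<s'})"
      by (rule tendsto_within_subset) (use ss' in auto)
    then have "\<forall>\<^sub>F t in at s' within {s<..<s'}. h < v (x, t)"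
      using big by (rule order_tendstoD)
    moreover have "((\<lambda>t. \<rho> + c * (t - s)) \<longlongrightarrow> \<rho> + c * (s' - s)) (at s' within {s<..<s'})"
      by (intro tendsto_intros)
    then have "\<forall>\<^sub>F t in at s' within {s<..<s'}. dist y x < \<rho> + c * (t - s)"
      using x by (rule order_tendstoD)
    moreover have "\<forall>\<^sub>F t in at s' within {s<..<s'}. s < t \<and> t < s'"
      by (simp add: eventually_at_filter)
    ultimately have "\<forall>\<^sub>F t in at s' within {s<..<s'}. False"
    proof eventually_elim
      case (elim t)
      then show ?case using inner[of t] by simp
    qed
    moreover have "at s' within {s<..<s'} = at_left s'"
      by (rule at_within_nhd[where S = "{s<..}"]) (use less in auto)
    ultimately show False using F by (simp add: eventually_False)
  qed
qed

section \<open>Comparison of a subsolution with the explicit fronts\<close>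

context nonlocal_front
begin

text \<open>Two passes over one time step. A crude one with speed \<open>- C\<close> keeps the front
  inside \<open>{v \<le> h}\<close> during the whole step. This bounds the speed of
  \<open>{v \<le> h}\<close> from below by that of the front, and a second pass with the better
  speed loses only the variation of the front speed.\<close>

lemma front_propagation_step:
  assumes sub: "viscosity_subsolution f \<mu> v" and cont: "continuous_on (UNIV \<times> {0..}) v"
    and h: "h1 < h" and s: "0 \<le> s" and \<tau>: "0 < \<tau>" and r: "2 * C * \<tau> < r"
    and I: "\<And>x z. x \<in> Dc h1 (dD s h1) \<Longrightarrow> dist x z < r \<Longrightarrow> v (z, s) \<le> h"
    and x: "x \<in> Dc h1 (dD (s + \<tau>) h1)"
    and z: "dist x z < r - \<tau> * \<bar>p h1 (dD (s + \<tau>) h1) - p h1 (dD s h1)\<bar>"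
  shows "v (z, s + \<tau>) \<le> h"
proof -
  define a where "a t = dD t h1" for t
  define P where "P t = p h1 (a t)" for t
  note \<delta> = delta_D_displ[of h1, folded a_def]
  have lip: "\<bar>a t - a t'\<bar> \<le> C * \<bar>t - t'\<bar>" if "0 \<le> t'" "0 \<le> t" for t t'
    by (rule displ_lipschitz[OF \<delta> that])
  have "0 \<le> 2 * C * \<tau>" using C_nonneg \<tau> by simp
  then have r0: "0 < r" using r by simp
  have cont_t: "continuous_on UNIV (\<lambda>y. v (y, t))" if "0 \<le> t" for t
    by (rule continuous_on_compose2[OF cont]) (use that in \<open>auto intro!: continuous_intros\<close>)
  have borel: "{y. v (y, t) < b} \<in> sets borel" "{y. v (y, t) \<le> b} \<in> sets borel" if "0 \<le> t" for t b
    by (intro borel_open borel_closed open_Collect_less closed_Collect_le continuous_on_const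
        cont_t[OF that])+
  \<comment> \<open>During the step the front moves by at most \<open>C * \<tau>\<close> and the
    guaranteed ball shrinks by at most \<open>C * \<tau>\<close>; hence the assumption
    \<open>2 * C * \<tau> < r\<close>.\<close>
  have crude: "v (w, t) \<le> h" if t: "s \<le> t" "t \<le> s + \<tau>" and w: "w \<in> Dc h1 (a t)" for t w
  proof -
    have Ct: "C * (t - s) \<le> C * \<tau>" using t C_nonneg by (intro mult_left_mono) auto
    have "\<exists>y\<in>Dc h1 (a s). dist y w < r + (- C) * (t - s)"
    proof (cases "hbar < h1")
      case True
      have 0: "0 \<le> a s" "a s \<le> a t"
        using displ_mono[OF \<delta> True, of 0 s] displ_mono[OF \<delta> True, of s t] displ_0[OF \<delta>] s t by auto
      obtain y where y: "y \<in> Dc h1 (a s)" "dist w y < a t - a s + (r - 2 * C * \<tau>) / 2"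
        by (rule Dc_set_expand[OF u0_cont 0 w, of "(r - 2 * C * \<tau>) / 2"]) (use r in auto)
      have "a t - a s \<le> C * \<tau>" using lip[of s t] s t Ct by simp
      then have "dist y w < r + (- C) * (t - s)"
        using y(2) Ct r by (simp add: dist_commute field_simps)
      then show ?thesis using y(1) by blast
    next
      case False
      then have "a t \<le> a s" using displ_antimono[OF \<delta>, of s t] s t by simp
      then have "w \<in> Dc h1 (a s)" using w Dc_mono[of h1 h1 "a t" "a s"] by auto
      moreover have "dist w w < r + (- C) * (t - s)" using Ct r \<open>0 \<le> 2 * C * \<tau>\<close> by simp
      ultimately show ?thesis by blast
    qed
    then obtain y where y: "y \<in> Dc h1 (a s)" "dist y w < r + (- C) * (t - s)" by blast
    show ?thesis
    proof (rule ball_propagation[OF sub cont s t(1) r0 _ _ y(2)])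
      show "v (z, s) \<le> h" if "dist y z < r" for z
        using I[OF y(1)[unfolded a_def] that] .
      show "- C \<le> f (v (z, t')) (\<mu> {y. v (y, t') < v (z, t')})" if "s < t'" for z t'
        using f_mu_bound[OF borel(1)[of t' "v (z, t')"], of "v (z, t')"] that s by (simp add: abs_le_iff)
    qed
  qed
  \<comment> \<open>Where \<open>v\<close> exceeds \<open>h\<close>, its strict sublevel set
    contains the whole front, and monotonicity of \<open>f\<close> in level and measure
    applies.\<close>
  have speed: "P t \<le> f (v (w, t)) (\<mu> {y. v (y, t) < v (w, t)})"
    if t: "s < t" "t < s + \<tau>" and w: "h < v (w, t)" for w t
    unfolding P_def p_def
  proof (rule f_mu_mono)
    show "Dc h1 (a t) \<subseteq> {y. v (y, t) < v (w, t)}"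
      using crude[of t] t w by force
  qed (use t w h s borel in auto)
  have z': "dist x z < r - \<tau> * \<bar>P (s + \<tau>) - P s\<bar>" using z by (simp add: P_def a_def)
  have x': "x \<in> Dc h1 (a (s + \<tau>))" using x by (simp add: a_def)
  show ?thesis
  proof (cases "hbar < h1")
    case True
    have mono: "a t \<le> a t'" if "0 \<le> t" "t \<le> t'" for t t' by (rule displ_mono[OF \<delta> True that])
    have P: "P t \<le> P t'" if "0 \<le> t" "t \<le> t'" for t t'
      unfolding P_def using mono[OF that] by (intro p_mono) auto
    have as: "0 \<le> a s" "a s \<le> a (s + \<tau>)" using mono[of 0 s] mono[of s "s + \<tau>"] displ_0[OF \<delta>] s \<tau> by auto
    define e where "e = r - \<tau> * \<bar>P (s + \<tau>) - P s\<bar> - dist x z"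
    have e: "0 < e" using z' by (simp add: e_def)
    obtain y where y: "y \<in> Dc h1 (a s)" "dist x y < a (s + \<tau>) - a s + e"
      by (rule Dc_set_expand[OF u0_cont as x' e])
    \<comment> \<open>The front advances by at most \<open>\<tau> * P (s + \<tau>)\<close>, while
      the ball around \<open>y\<close> is sure to grow only at the smallest speed
      \<open>P s\<close>. The discrepancy is exactly the loss allowed for \<open>z\<close>.\<close>
    have "a (s + \<tau>) - a s \<le> \<tau> * P (s + \<tau>)"
      using displ_slope(2)[OF \<delta>, of s "s + \<tau>"] as s \<tau> by (simp add: P_def max_absorb2)
    moreover have "\<bar>P (s + \<tau>) - P s\<bar> = P (s + \<tau>) - P s" using P[of s "s + \<tau>"] s \<tau> by simp
    ultimately have "dist y z < r + P s * (s + \<tau> - s)"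
      using y(2) dist_triangle[of y z x] by (simp add: e_def dist_commute algebra_simps)
    then show ?thesis
    proof (rule ball_propagation[OF sub cont s _ r0, rotated 3])
      show "s \<le> s + \<tau>" using \<tau> by simp
      show "v (w, s) \<le> h" if "dist y w < r" for w
        using I[OF y(1)[unfolded a_def] that] .
      show "P s \<le> f (v (w, t)) (\<mu> {y. v (y, t) < v (w, t)})"
        if "s < t" "t < s + \<tau>" "h < v (w, t)" for w t
        using speed[OF that] P[of s t] that s by linarith
    qed
  next
    case False
    then have hh: "h1 \<le> hbar" by simp
    have anti: "a t' \<le> a t" if "0 \<le> t" "t \<le> t'" for t t' by (rule displ_antimono[OF \<delta> hh that])
    have P: "P t' \<le> P t" if "0 \<le> t" "t \<le> t'" for t t'
      unfolding P_def using anti[OF that] by (intro p_mono) auto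
    \<comment> \<open>\<open>q\<close> is the retreat of the front: points within \<open>q\<close>
      of \<open>x\<close> belong to the front at time \<open>s\<close>, so \<open>I\<close> covers
      the ball of radius \<open>q + r\<close>. From there the smallest speed of the step is
      \<open>P (s + \<tau>)\<close>.\<close>
    define q where "q = a s - a (s + \<tau>)"
    have q: "0 \<le> q" using anti[of s "s + \<tau>"] s \<tau> by (simp add: q_def)
    have "a (s + \<tau>) - a s \<le> \<tau> * P s"
      using displ_slope(2)[OF \<delta>, of s "s + \<tau>"] q s \<tau> by (simp add: P_def q_def max_absorb1)
    moreover have "\<bar>P (s + \<tau>) - P s\<bar> = P s - P (s + \<tau>)" using P[of s "s + \<tau>"] s \<tau> by simp
    ultimately have "dist x z < (q + r) + P (s + \<tau>) * (s + \<tau> - s)"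
      using z' by (simp add: q_def algebra_simps)
    then show ?thesis
    proof (rule ball_propagation[OF sub cont s, rotated 4])
      show "s \<le> s + \<tau>" "0 < q + r" using \<tau> q r0 by auto
      show "v (w, s) \<le> h" if "dist x w < q + r" for w
      proof -
        have "dist w x < r + q" using that by (simp add: dist_commute)
        then obtain y where y: "dist w y < r" "dist y x \<le> q"
          by (rule dist_split_less) (use r0 q in auto)
        have "y \<in> Dc h1 (a (s + \<tau>) + q)"
          by (rule Dc_set_dist_le[OF u0_cont x']) (use y in \<open>simp add: dist_commute\<close>)
        then have "y \<in> Dc h1 (dD s h1)" by (simp add: q_def a_def)
        then show ?thesis by (rule I) (use y in \<open>simp add: dist_commute\<close>)
      qed
      show "P (s + \<tau>) \<le> f (v (w, t)) (\<mu> {y. v (y, t) < v (w, t)})"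
        if "s < t" "t < s + \<tau>" "h < v (w, t)" for w t
        using speed[OF that] P[of t "s + \<tau>"] that s by linarith
    qed
  qed
qed

text \<open>The initial gap \<open>d\<close> between the levels \<open>h1\<close> and
  \<open>h\<close> serves as a neighbourhood of the front. Its radius shrinks in each step by
  \<open>\<tau>\<close> times the change of the front speed, in total by at most
  \<open>2 * C * \<tau>\<close>, which fine time steps make smaller than \<open>d\<close>.\<close>

lemma subsolution_le_u:
  assumes sub: "viscosity_subsolution f \<mu> v" and cont: "continuous_on (UNIV \<times> {0..}) v"
    and v0: "\<And>x. v (x, 0) = u\<^sub>0 x" and T: "0 \<le> T"
  shows "v (x, T) \<le> u (x, T)"
proof (cases "T = 0")
  case True
  then show ?thesis by (simp add: v0 u_0)
next
  case False
  then have T0: "0 < T" using T by simp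
  have key: "v (x, T) \<le> h" if h: "h1 < h" and x: "x \<in> front T h1" for h1 h x
  proof -
    obtain d where d: "0 < d" "\<And>g a. D g a \<subseteq> D (g + (h - h1)) (a - d)"
      using D_set_gap[OF u0_unif, of "h - h1"] h by auto
    define P where "P t = p h1 (dD t h1)" for t
    have Pbd: "\<bar>P t\<bar> \<le> C" for t by (simp add: P_def p_bound)
    \<comment> \<open>The factor 4 provides \<open>2 * C * \<tau>\<close> for the accumulated loss
      and as much again for the radius that a single step requires.\<close>
    obtain n :: nat where n: "4 * C * T / d < real n" "0 < n"
      using reals_Archimedean2[of "max 0 (4 * C * T / d)"] by (auto simp: max_def split: if_splits)
    define \<tau> where "\<tau> = T / n"
    have \<tau>: "0 < \<tau>" "real n * \<tau> = T" using T0 n by (auto simp: \<tau>_def)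
    have "4 * C * T < d * real n" using n d by (simp add: divide_less_eq mult.commute)
    then have small: "4 * C * \<tau> < d" using n by (simp add: \<tau>_def divide_less_eq)
    have I: "v (z, real k * \<tau>) \<le> h"
      if "x \<in> Dc h1 (dD (real k * \<tau>) h1)" "dist x z < d - \<tau> * \<bar>P (real k * \<tau>) - P 0\<bar>" for k x z
      using that
    proof (induction k arbitrary: x z)
      case 0
      define e where "e = (d - dist x z) / 2"
      have e: "0 < e" "dist z x < d - e" using 0 by (auto simp: e_def dist_commute field_simps)
      have "x \<in> Dc h1 0" using 0 displ_0[OF delta_D_displ, of h1] by simp
      then have "x \<in> D h1 e" using e by (blast dest: Dc_setD)
      then have "x \<in> D h (e - d)" using d(2)[of h1 e] by auto
      then have "z \<in> D h (e - d + (d - e))" by (rule D_set_dist_less[OF u0_cont]) (rule e(2))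
      then show ?case by (simp add: D_0 v0)
    next
      case (Suc k)
      define s where "s = real k * \<tau>"
      have s: "0 \<le> s" "real (Suc k) * \<tau> = s + \<tau>" using \<tau> by (auto simp: s_def algebra_simps)
      define r where "r = d - \<tau> * \<bar>P s - P 0\<bar>"
      have "\<bar>P s - P 0\<bar> \<le> 2 * C" using Pbd[of s] Pbd[of 0] by linarith
      then have "\<tau> * \<bar>P s - P 0\<bar> \<le> \<tau> * (2 * C)" using \<tau> by (intro mult_left_mono) auto
      then have r: "2 * C * \<tau> < r" using small by (simp add: r_def algebra_simps)
      \<comment> \<open>The front speed is monotone in time, so its changes have one sign and the
        losses telescope.\<close>
      have abs: "\<bar>P (s + \<tau>) - P 0\<bar> = \<bar>P s - P 0\<bar> + \<bar>P (s + \<tau>) - P s\<bar>"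
      proof (cases "hbar < h1")
        case True
        have "P 0 \<le> P s" "P s \<le> P (s + \<tau>)"
          unfolding P_def using s \<tau> displ_mono[OF delta_D_displ True] by (auto intro!: p_mono)
        then show ?thesis by simp
      next
        case False
        then have "P s \<le> P 0" "P (s + \<tau>) \<le> P s"
          unfolding P_def using s \<tau> displ_antimono[OF delta_D_displ] by (auto intro!: p_mono)
        then show ?thesis by simp
      qed
      show ?case
        unfolding s(2)
      proof (rule front_propagation_step[OF sub cont h s(1) \<tau>(1) r])
        show "v (z, s) \<le> h" if "x \<in> Dc h1 (dD s h1)" "dist x z < r" for x z
          using Suc.IH[of x z] that by (simp add: s_def r_def)
        show "x \<in> Dc h1 (dD (s + \<tau>) h1)" using Suc.prems(1) by (simp only: s(2))
        have "dist x z < d - \<tau> * \<bar>P (s + \<tau>) - P 0\<bar>" using Suc.prems(2) by (simp only: s(2))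
        then show "dist x z < r - \<tau> * \<bar>p h1 (dD (s + \<tau>) h1) - p h1 (dD s h1)\<bar>"
          unfolding P_def[symmetric] abs r_def by (simp add: algebra_simps)
      qed
    qed
    have "\<bar>P T - P 0\<bar> \<le> 2 * C" using Pbd[of T] Pbd[of 0] by linarith
    then have "\<tau> * \<bar>P T - P 0\<bar> \<le> \<tau> * (2 * C)" using \<tau> by (intro mult_left_mono) auto
    moreover have "0 \<le> C * \<tau>" using C_nonneg \<tau> by simp
    ultimately have "dist x x < d - \<tau> * \<bar>P T - P 0\<bar>" using small by (simp add: algebra_simps)
    moreover have "x \<in> Dc h1 (dD T h1)"
      using x D_set_subset_Dc_set[OF u0_cont] by (auto simp: front_def)
    ultimately show ?thesis using I[of x n x] by (simp add: \<tau>(2))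
  qed
  show ?thesis
  proof (rule ccontr)
    assume "\<not> v (x, T) \<le> u (x, T)"
    then have "u (x, T) < v (x, T)" by simp
    then obtain h where h: "u (x, T) < h" "h < v (x, T)" using dense by blast
    then obtain h1 where h1: "u (x, T) < h1" "h1 < h" using dense by blast
    then have "x \<in> front T h1" using u_less_iff[OF T] by blast
    then show False using key[OF h1(2)] h by force
  qed
qed

end

section \<open>Reflection\<close>

lemma E_set_mono: "s \<le> s' \<Longrightarrow> E_set u h s \<subseteq> E_set u h s'"
  unfolding E_set_def by (auto elim: order_trans)

context nonlocal_front
begin

text \<open>The measure of the complement enters through \<open>\<mu> UNIV - q\<close>. Each
  argument is reversed once and so is the value, so monotonicity in \<open>r\<close> and strict
  monotonicity in \<open>q\<close> survive.\<close>

definition f_refl :: "real \<Rightarrow> real \<Rightarrow> real" where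
  "f_refl r q = - f (- r) (\<mu> UNIV - q)"

lemma f_refl_compl: "A \<in> sets borel \<Longrightarrow> f_refl r (\<mu> (- A)) = - f (- r) (\<mu> A)"
  by (simp add: f_refl_def mu_compl)

lemma nonlocal_front_reflected: "nonlocal_front f_refl \<mu> (\<lambda>x. - u\<^sub>0 x) (- hbar) C"
proof unfold_locales
  fix r r' q q' :: real and A B U :: "(real^'n) set"
  show "\<bar>f_refl r q\<bar> \<le> C" if "0 \<le> q" "q \<le> \<mu> UNIV"
    using that by (simp add: f_refl_def f_bound)
  show "f_refl r q \<le> f_refl r' q" if "r < r'" "0 \<le> q" "q \<le> \<mu> UNIV"
    using that by (simp add: f_refl_def f_mono_r)
  show "f_refl r q < f_refl r q'" if "0 \<le> q" "q < q'" "q' \<le> \<mu> UNIV"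
    using that by (simp add: f_refl_def f_strict_q)
  show "continuous_on (UNIV \<times> {0..\<mu> UNIV}) (\<lambda>(r, q). f_refl r q)"
  proof -
    have "continuous_on (UNIV \<times> {0..\<mu> UNIV}) (\<lambda>z. (\<lambda>(r, q). f r q) (- fst z, \<mu> UNIV - snd z))"
      by (rule continuous_on_compose2[OF f_cont]) (auto intro!: continuous_intros)
    from continuous_on_minus[OF this] show ?thesis
      by (simp add: f_refl_def split_beta)
  qed
  show "0 \<le> \<mu> A" if "A \<in> sets borel" using that by (rule mu_nonneg)
  show "\<mu> (- A) = \<mu> UNIV - \<mu> A" if "A \<in> sets borel" using that by (rule mu_compl)
  show "\<mu> A \<le> \<mu> B" if "A \<in> sets borel" "B \<in> sets borel" "A \<subseteq> B" using that by (rule mu_mono)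
  show "\<mu> A < \<mu> B" if "A \<in> sets borel" "B \<in> sets borel" "A \<subseteq> B" "open U" "U \<noteq> {}" "U \<subseteq> B - A"
    using that by (rule mu_strict)
  show "(\<lambda>k. \<mu> (S k)) \<longlonglongrightarrow> \<mu> (\<Union>k. S k)" if "\<And>k::nat. S k \<in> sets borel" "incseq S" for S
    using that by (rule mu_incseq)
  show "uniformly_continuous_on UNIV (\<lambda>x. - u\<^sub>0 x)"
    using u0_unif by (rule uniformly_continuous_on_minus)
  have "{x. - u\<^sub>0 x < - hbar} = - {x. u\<^sub>0 x \<le> hbar}" by auto
  then show "f_refl (- hbar) (\<mu> {x. - u\<^sub>0 x < - hbar}) \<le> 0"
    using hbar_E closed_sublevel by (simp add: f_refl_compl borel_closed)
  have "{x. - u\<^sub>0 x \<le> - hbar} = - {x. u\<^sub>0 x < hbar}" by auto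
  then show "0 \<le> f_refl (- hbar) (\<mu> {x. - u\<^sub>0 x \<le> - hbar})"
    using hbar_D open_sublevel by (simp add: f_refl_compl borel_open)
qed

text \<open>Complementation exchanges interior and closure, negation exchanges the lower and the
  upper bound for the derivative.\<close>

lemma front_displacement_reflect:
  assumes "front_displacement f \<mu> W h \<delta>"
  shows "front_displacement f_refl \<mu> (\<lambda>s. - W (- s)) (- h) (\<lambda>t. - \<delta> t)"
proof -
  obtain L where L: "L-lipschitz_on {0..} \<delta>" and \<delta>0: "\<delta> 0 = 0"
    and ae: "AE t in lebesgue. 0 \<le> t \<longrightarrow> (\<exists>d. (\<delta> has_real_derivative d) (at t within {0..}) \<and>
      f h (\<mu> (interior (W (\<delta> t)))) \<le> d \<and> d \<le> f h (\<mu> (closure (W (\<delta> t)))))"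
    using assms by (auto simp: front_displacement_def)
  have "L-lipschitz_on {0..} (\<lambda>t. - \<delta> t)"
    using L by (simp add: lipschitz_on_minus)
  moreover have "AE t in lebesgue. 0 \<le> t \<longrightarrow> (\<exists>d. ((\<lambda>t. - \<delta> t) has_real_derivative d) (at t within {0..}) \<and>
      f_refl (- h) (\<mu> (interior (- W (- (- \<delta> t))))) \<le> d \<and>
      d \<le> f_refl (- h) (\<mu> (closure (- W (- (- \<delta> t))))))"
    using ae
  proof eventually_elim
    case (elim t)
    show ?case
    proof
      assume "0 \<le> t"
      then obtain d where d: "(\<delta> has_real_derivative d) (at t within {0..})"
        "f h (\<mu> (interior (W (\<delta> t)))) \<le> d" "d \<le> f h (\<mu> (closure (W (\<delta> t))))"
        using elim by blast
      show "\<exists>d. ((\<lambda>t. - \<delta> t) has_real_derivative d) (at t within {0..}) \<and>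
        f_refl (- h) (\<mu> (interior (- W (- (- \<delta> t))))) \<le> d \<and>
        d \<le> f_refl (- h) (\<mu> (closure (- W (- (- \<delta> t)))))"
        using d DERIV_minus[OF d(1)]
        by (intro exI[of _ "- d"])
          (simp add: interior_complement closure_complement f_refl_compl borel_open borel_closed)
    qed
  qed
  ultimately show ?thesis using \<delta>0 unfolding front_displacement_def by auto
qed

lemma f_refl_refl: "nonlocal_front.f_refl f_refl \<mu> = f"
  by (simp add: nonlocal_front.f_refl_def[OF nonlocal_front_reflected] f_refl_def fun_eq_iff)

section \<open>The functions \<open>dE\<close> and \<open>u_E\<close> through reflection\<close>

abbreviation "dE t h \<equiv> delta_E f \<mu> u\<^sub>0 t h"
abbreviation "u_refl \<equiv> u_D f_refl \<mu> (\<lambda>x. - u\<^sub>0 x) (- hbar)"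

text \<open>Negation is a bijection between the competitors of the \<open>E\<close> problem and
  those of the reflected \<open>D\<close> problem. It reverses the order, so minimal becomes
  maximal.\<close>

lemma delta_E_reflect:
  shows "front_displacement f \<mu> (E_set u\<^sub>0 h) h (\<lambda>t. dE t h)"
    and "0 \<le> t \<Longrightarrow> dE t h = - delta_D f_refl \<mu> (\<lambda>x. - u\<^sub>0 x) t (- h)"
proof -
  interpret R: nonlocal_front f_refl \<mu> "\<lambda>x. - u\<^sub>0 x" "- hbar" C
    by (rule nonlocal_front_reflected)
  define \<delta> where "\<delta> t = - R.dD t (- h)" for t
  have ED: "E_set u\<^sub>0 h = (\<lambda>s. - R.D (- h) (- s))" and DE: "R.D (- h) = (\<lambda>s. - E_set u\<^sub>0 h (- s))"
    by (auto simp: E_set_eq_compl_D_set fun_eq_iff)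
  let ?P = "\<lambda>\<delta>. front_displacement f \<mu> (E_set u\<^sub>0 h) h \<delta> \<and>
    (\<forall>\<eta>. front_displacement f \<mu> (E_set u\<^sub>0 h) h \<eta> \<longrightarrow> (\<forall>s\<ge>0. \<eta> s \<le> \<delta> s))"
  have P: "?P \<delta>"
  proof (intro conjI allI impI)
    show "front_displacement f \<mu> (E_set u\<^sub>0 h) h \<delta>"
      using R.front_displacement_reflect[OF R.displ_imp_front_displacement[OF R.delta_D_displ[of "- h"]]]
      by (simp add: f_refl_refl ED \<delta>_def[abs_def])
    fix \<eta> and s :: real assume \<eta>: "front_displacement f \<mu> (E_set u\<^sub>0 h) h \<eta>" "0 \<le> s"
    have "front_displacement f_refl \<mu> (R.D (- h)) (- h) (\<lambda>t. - \<eta> t)"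
      unfolding DE by (rule front_displacement_reflect[OF \<eta>(1)])
    from R.delta_D_minimal[OF this \<eta>(2)] show "\<eta> s \<le> \<delta> s" by (simp add: \<delta>_def)
  qed
  have S: "?P (SOME \<delta>. ?P \<delta>)" using P by (rule someI[of ?P])
  then show "front_displacement f \<mu> (E_set u\<^sub>0 h) h (\<lambda>t. dE t h)"
    unfolding delta_E_def by simp
  show "dE t h = - R.dD t (- h)" if "0 \<le> t"
  proof (rule antisym)
    show "dE t h \<le> - R.dD t (- h)"
      using P S that unfolding delta_E_def \<delta>_def by blast
    show "- R.dD t (- h) \<le> dE t h"
      using P S that unfolding delta_E_def \<delta>_def by blast
  qed
qed

lemma u_E_eq_u_refl:
  assumes t: "0 \<le> t"
  shows "u_E f \<mu> u\<^sub>0 hbar (x, t) = - u_refl (x, t)"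
proof -
  have UE: "U_E f \<mu> u\<^sub>0 hbar x t h = - U_D f_refl \<mu> (\<lambda>x. - u\<^sub>0 x) (- hbar) x t (- h)" for h
  proof -
    have neg: "U_0 (\<lambda>x. - u\<^sub>0 x) y (- h) = - U_0 u\<^sub>0 y h" for y by (simp add: U_0_def)
    \<comment> \<open>On the reals \<open>Inf\<close> is defined through \<open>Sup\<close> of the
      negated set, so this holds for every set, bounded or not.\<close>
    have Inf: "Inf ((\<lambda>y. - g y) ` A) = - Sup (g ` A)" for g :: "real^'n \<Rightarrow> real" and A
      by (simp add: Inf_real_def image_image)
    then have Sup: "Sup ((\<lambda>y. - g y) ` A) = - Inf (g ` A)" for g :: "real^'n \<Rightarrow> real" and A
      using Inf[of "\<lambda>y. - g y" A] by simp
    show ?thesis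
      by (simp add: U_E_def U_D_def neg Inf Sup delta_E_reflect(2)[OF t])
  qed
  have "{h. U_E f \<mu> u\<^sub>0 hbar x t h \<le> 0} = uminus ` {k. 0 \<le> U_D f_refl \<mu> (\<lambda>x. - u\<^sub>0 x) (- hbar) x t k}"
    unfolding UE by (auto simp: image_iff) (metis minus_minus)
  then show ?thesis by (simp add: u_E_def u_D_def Inf_real_def image_image)
qed

text \<open>Comparison of displacements only asks for a gap between closure and interior, so it
  applies to a \<open>D\<close> family against an \<open>E\<close> family of a different level, in
  either order. The resulting nesting of sublevel sets squeezes the two functions together.\<close>

lemma u_E_eq_u:
  assumes t: "0 \<le> t"
  shows "u_E f \<mu> u\<^sub>0 hbar (x, t) = u (x, t)"
proof -
  interpret R: nonlocal_front f_refl \<mu> "\<lambda>x. - u\<^sub>0 x" "- hbar" C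
    by (rule nonlocal_front_reflected)
  have fE: "x \<in> R.front t (- h) \<longleftrightarrow> x \<notin> E_set u\<^sub>0 h (dE t h)" for h
    by (simp add: R.front_def E_set_eq_compl_D_set delta_E_reflect(2)[OF t])
  have fdD: "front_displacement f \<mu> (D h) h (\<lambda>t. dD t h)" for h
    by (rule displ_imp_front_displacement[OF delta_D_displ])
  have clD: "closure (D h a) \<subseteq> D h b" if "a < b" for h a b
    using closure_D_set_subset[OF u0_cont, of h a] Dc_set_subset_D_set[OF that, of u\<^sub>0 h] by blast
  have DE: "D h1 (dD t h1) \<subseteq> E_set u\<^sub>0 h2 (dE t h2)" if h: "h1 < h2" for h1 h2
  proof -
    obtain d where d: "0 < d" "\<And>h a. D h a \<subseteq> D (h + (h2 - h1)) (a - d)"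
      using D_set_gap[OF u0_unif, of "h2 - h1"] h by auto
    have "dD t h1 \<le> dE t h2"
    proof (rule front_displacement_le[OF fdD delta_E_reflect(1)])
      show "h1 \<le> h2" "0 < d / 2" "0 \<le> t" using h d t by auto
      show "E_set u\<^sub>0 h2 a \<subseteq> E_set u\<^sub>0 h2 b" if "a \<le> b" for a b by (rule E_set_mono[OF that])
      fix a
      have "closure (D h1 a) \<subseteq> D h1 (a + d / 2)" using d by (intro clD) simp
      also have "\<dots> \<subseteq> D h2 (a - d / 2)" using d(2)[of h1 "a + d / 2"] by simp
      finally show "closure (D h1 a) \<subseteq> interior (E_set u\<^sub>0 h2 (a - d / 2))"
        using interior_maximal[OF D_set_subset_E_set D_open] by blast
    qed
    then have "D h1 (dD t h1) \<subseteq> D h2 (dE t h2)" using h by (intro D_mono) auto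
    then show ?thesis using D_set_subset_E_set by blast
  qed
  have ED: "E_set u\<^sub>0 h1 (dE t h1) \<subseteq> D h2 (dD t h2)" if h: "h1 < h2" for h1 h2
  proof -
    \<comment> \<open>Between \<open>h1\<close> and \<open>g\<close> the \<open>E\<close> set is
      absorbed by a \<open>D\<close> set; between \<open>g\<close> and \<open>h2\<close> the gap is
      gained.\<close>
    define g where "g = (h1 + h2) / 2"
    have g: "h1 < g" "g < h2" using h by (auto simp: g_def)
    obtain d where d: "0 < d" "\<And>h a. D h a \<subseteq> D (h + (h2 - g)) (a - d)"
      using D_set_gap[OF u0_unif, of "h2 - g"] g by auto
    have gap: "E_set u\<^sub>0 h1 a \<subseteq> D h2 (a - d / 2)" for a
    proof -
      have "E_set u\<^sub>0 h1 a \<subseteq> D g (a + d / 2)"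
        using d by (intro E_set_subset_D_set[OF u0_cont g(1)]) simp
      also have "\<dots> \<subseteq> D h2 (a - d / 2)" using d(2)[of g "a + d / 2"] by simp
      finally show ?thesis .
    qed
    have "dE t h1 \<le> dD t h2"
    proof (rule front_displacement_le[OF delta_E_reflect(1) fdD])
      show "h1 \<le> h2" "0 < d / 2" "0 \<le> t" using h d t by auto
      show "D h2 a \<subseteq> D h2 b" if "a \<le> b" for a b using that by (intro D_mono) auto
      show "closure (E_set u\<^sub>0 h1 a) \<subseteq> interior (D h2 (a - d / 2))" for a
        using gap by (simp add: closure_closed[OF closed_E_set[OF u0_cont]] interior_open[OF D_open])
    qed
    then have "D h2 (dE t h1 - d / 2) \<subseteq> D h2 (dD t h2)" using d by (intro D_mono) auto
    then show ?thesis using gap by blast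
  qed
  show ?thesis
  proof (rule antisym; rule ccontr)
    assume "\<not> u_E f \<mu> u\<^sub>0 hbar (x, t) \<le> u (x, t)"
    then have "u (x, t) < u_E f \<mu> u\<^sub>0 hbar (x, t)" by simp
    then obtain h2 where h2: "u (x, t) < h2" "h2 < u_E f \<mu> u\<^sub>0 hbar (x, t)" using dense by blast
    then obtain h1 where h1: "u (x, t) < h1" "h1 < h2" using dense by blast
    have "x \<in> D h1 (dD t h1)" using h1 u_less_iff[OF t] by (simp add: front_def)
    moreover have "R.u (x, t) < - h2" using h2 u_E_eq_u_refl[OF t] by simp
    then have "x \<notin> E_set u\<^sub>0 h2 (dE t h2)" using R.u_less_iff[OF t] fE by blast
    ultimately show False using DE[OF h1(2)] by blast
  next
    assume "\<not> u (x, t) \<le> u_E f \<mu> u\<^sub>0 hbar (x, t)"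
    then have "u_E f \<mu> u\<^sub>0 hbar (x, t) < u (x, t)" by simp
    then obtain h1 where h1: "u_E f \<mu> u\<^sub>0 hbar (x, t) < h1" "h1 < u (x, t)" using dense by blast
    then obtain h2 where h2: "h1 < h2" "h2 < u (x, t)" using dense by blast
    have "x \<notin> D h2 (dD t h2)" using h2 u_less_iff[OF t, of x h2] by (simp add: front_def)
    moreover have "\<not> R.u (x, t) < - h1" using h1 u_E_eq_u_refl[OF t, of x] by simp
    then have "x \<in> E_set u\<^sub>0 h1 (dE t h1)" using R.u_less_iff[OF t] fE by blast
    ultimately show False using ED[OF h2(1)] by blast
  qed
qed

section \<open>Reflection of viscosity sub- and supersolutions\<close>

lemma C1_with_gradient_uminus:
  assumes "C1_with_gradient \<phi> G"
  shows "C1_with_gradient (\<lambda>z. - \<phi> z) (\<lambda>z. - G z)"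
  using assms unfolding C1_with_gradient_def by (auto intro: GDERIV_minus continuous_on_minus)

lemma refl_speed:
  assumes "continuous_on UNIV g"
  shows "f_refl (- c) (\<mu> {y. c < g y}) = - f c (\<mu> {y. g y \<le> c})"
proof -
  have "{y. c < g y} = - {y. g y \<le> c}" by auto
  moreover have "{y. g y \<le> c} \<in> sets borel"
    using assms by (intro borel_closed closed_Collect_le continuous_on_const)
  ultimately show ?thesis by (simp add: f_refl_compl)
qed

lemma continuous_slice:
  assumes "continuous_on pos_time v" "0 < t"
  shows "continuous_on UNIV (\<lambda>y. v (y, t))"
  by (rule continuous_on_compose2[OF assms(1)]) (use assms(2) in \<open>auto intro!: continuous_intros\<close>)

lemma viscosity_subsolution_reflect:
  assumes sup: "viscosity_supersolution f \<mu> v" and cont: "continuous_on pos_time v"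
  shows "viscosity_subsolution f_refl \<mu> (\<lambda>z. - v z)"
  unfolding viscosity_subsolution_def
proof (intro conjI allI impI)
  have "continuous_on pos_time (\<lambda>z. - v z)" using cont by (rule continuous_on_minus)
  then show "locally_bounded_on pos_time (\<lambda>z. - v z)" "usc_on pos_time (\<lambda>z. - v z)"
    by (auto intro: continuous_imp_locally_bounded_on continuous_imp_usc_on)
  fix \<phi> G x0 t0
  assume C1: "C1_with_gradient \<phi> G" and max: "local_max_on pos_time (\<lambda>z. - v z - \<phi> z) (x0, t0)"
  have "local_min_on pos_time (\<lambda>z. v z - - \<phi> z) (x0, t0)"
    using max unfolding local_max_on_def local_min_on_def by (auto elim: eventually_mono)
  then have "0 \<le> snd (- G (x0, t0)) + norm (fst (- G (x0, t0))) * f (v (x0, t0)) (\<mu> {y. v (y, t0) \<le> v (x0, t0)})"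
    using sup C1_with_gradient_uminus[OF C1] unfolding viscosity_supersolution_def by blast
  moreover have "0 < t0" using max by (simp add: local_max_on_def)
  ultimately show "snd (G (x0, t0)) + norm (fst (G (x0, t0))) * f_refl (- v (x0, t0)) (\<mu> {y. - v (y, t0) < - v (x0, t0)}) \<le> 0"
    by (simp add: refl_speed[OF continuous_slice[OF cont]])
qed

lemma viscosity_supersolution_reflect:
  assumes sub: "viscosity_subsolution f_refl \<mu> w" and v: "\<And>z. z \<in> pos_time \<Longrightarrow> w z = - v z"
    and cont: "continuous_on pos_time v"
  shows "viscosity_supersolution f \<mu> v"
  unfolding viscosity_supersolution_def
proof (intro conjI allI impI)
  show "locally_bounded_on pos_time v"
    using cont by (rule continuous_imp_locally_bounded_on)
  show "lsc_on pos_time v"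
    using cont unfolding lsc_on_def continuous_on_def by (blast intro: order_tendstoD(1))
  fix \<phi> G x0 t0
  assume C1: "C1_with_gradient \<phi> G" and min: "local_min_on pos_time (\<lambda>z. v z - \<phi> z) (x0, t0)"
  have t0: "0 < t0" using min by (simp add: local_min_on_def)
  have w: "w (y, t0) = - v (y, t0)" for y using v t0 by simp
  have "local_max_on pos_time (\<lambda>z. w z - - \<phi> z) (x0, t0)"
    using min w unfolding local_max_on_def local_min_on_def eventually_at_filter
    by (auto elim!: eventually_mono simp: v)
  then have "snd (- G (x0, t0)) + norm (fst (- G (x0, t0))) * f_refl (w (x0, t0)) (\<mu> {y. w (y, t0) < w (x0, t0)}) \<le> 0"
    using sub C1_with_gradient_uminus[OF C1] unfolding viscosity_subsolution_def by blast
  then show "0 \<le> snd (G (x0, t0)) + norm (fst (G (x0, t0))) * f (v (x0, t0)) (\<mu> {y. v (y, t0) \<le> v (x0, t0)})"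
    by (simp add: w refl_speed[OF continuous_slice[OF cont t0]])
qed

text \<open>The subsolution property of the reflected problem is the supersolution property of
  \<open>u_E\<close>; equality with \<open>u\<close> gives one function both properties.\<close>

lemma u_solution: "continuous_Cauchy_solution f \<mu> u\<^sub>0 u"
proof -
  interpret R: nonlocal_front f_refl \<mu> "\<lambda>x. - u\<^sub>0 x" "- hbar" C
    by (rule nonlocal_front_reflected)
  have cont: "continuous_on pos_time u"
    by (rule continuous_on_subset[OF u_continuous]) auto
  have "viscosity_supersolution f \<mu> u"
  proof (rule viscosity_supersolution_reflect[OF R.u_subsolution _ cont])
    fix z :: "(real^'n) \<times> real" assume "z \<in> pos_time"
    then show "R.u z = - u z" using u_E_eq_u_refl u_E_eq_u by (cases z) auto
  qed
  then show ?thesis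
    using cont u_continuous u_subsolution u_0
    by (simp add: continuous_Cauchy_solution_def viscosity_solution_def)
qed

lemma solution_unique:
  assumes v: "continuous_Cauchy_solution f \<mu> u\<^sub>0 v" and t: "0 \<le> t"
  shows "v (x, t) = u (x, t)"
proof (rule antisym)
  interpret R: nonlocal_front f_refl \<mu> "\<lambda>x. - u\<^sub>0 x" "- hbar" C
    by (rule nonlocal_front_reflected)
  have cont: "continuous_on (UNIV \<times> {0..}) v" "continuous_on pos_time v"
    and sub: "viscosity_subsolution f \<mu> v" and sup: "viscosity_supersolution f \<mu> v"
    and v0: "\<And>x. v (x, 0) = u\<^sub>0 x"
    using v by (auto simp: continuous_Cauchy_solution_def viscosity_solution_def)
  show "v (x, t) \<le> u (x, t)" by (rule subsolution_le_u[OF sub cont(1) v0 t])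
  have "- v (x, t) \<le> R.u (x, t)"
    by (rule R.subsolution_le_u[OF viscosity_subsolution_reflect[OF sup cont(2)] _ _ t])
      (auto simp: v0 intro: continuous_on_minus cont)
  then show "u (x, t) \<le> v (x, t)" using u_E_eq_u_refl[OF t, of x] u_E_eq_u[OF t, of x] by simp
qed

end

section \<open>The measure with density \<open>\<Theta>\<close>, and the theorem\<close>

lemma set_integral_strict_mono_open:
  fixes \<Theta> :: "'a::euclidean_space \<Rightarrow> real"
  assumes int: "integrable lebesgue \<Theta>" and pos: "\<And>x. 0 < \<Theta> x"
    and AB: "A \<in> sets lebesgue" "B \<in> sets lebesgue" "A \<subseteq> B"
    and U: "open U" "U \<noteq> {}" "U \<subseteq> B - A"
  shows "(LINT x:A|lebesgue. \<Theta> x) < (LINT x:B|lebesgue. \<Theta> x)"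
proof -
  have ind: "integrable lebesgue (\<lambda>x. indicator S x *\<^sub>R \<Theta> x)" if "S \<in> sets lebesgue" for S
    using integrable_mult_indicator[OF that int] .
  have BA: "B - A \<in> sets lebesgue" using AB by auto
  have "(LINT x:B|lebesgue. \<Theta> x) = (LINT x:A \<union> (B - A)|lebesgue. \<Theta> x)"
    using AB by (simp add: Un_absorb1)
  also have "\<dots> = (LINT x:A|lebesgue. \<Theta> x) + (LINT x:B - A|lebesgue. \<Theta> x)"
    by (intro set_integral_Un) (auto simp only: set_integrable_def intro!: ind AB BA)
  finally have eq: "(LINT x:B|lebesgue. \<Theta> x) = (LINT x:A|lebesgue. \<Theta> x) + (LINT x:B - A|lebesgue. \<Theta> x)" .
  have nonneg: "AE x in lebesgue. 0 \<le> indicator (B - A) x *\<^sub>R \<Theta> x"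
    using pos by (auto intro!: AE_I2 simp: less_imp_le)
  \<comment> \<open>A vanishing integral of the positive \<open>\<Theta>\<close> would make
    \<open>B - A\<close> negligible, yet it contains a nonempty open set.\<close>
  have "(LINT x:B - A|lebesgue. \<Theta> x) \<noteq> 0"
  proof
    assume "(LINT x:B - A|lebesgue. \<Theta> x) = 0"
    then have "AE x in lebesgue. indicator (B - A) x *\<^sub>R \<Theta> x = 0"
      unfolding set_lebesgue_integral_def
      using integral_nonneg_eq_0_iff_AE[OF ind[OF BA] nonneg] by blast
    then have "AE x in lebesgue. x \<notin> B - A"
    proof eventually_elim
      case (elim x)
      then show ?case using pos[of x] by (simp add: indicator_def split: if_splits)
    qed
    then have "negligible (B - A)"
      using BA by (simp add: negligible_iff_null_sets AE_iff_null_sets)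
    then show False using U open_not_negligible negligible_subset by blast
  qed
  moreover have "0 \<le> (LINT x:B - A|lebesgue. \<Theta> x)"
    unfolding set_lebesgue_integral_def using nonneg by (rule integral_nonneg_AE)
  ultimately show ?thesis using eq by linarith
qed

theorem theorem1p1:
  fixes f :: "real \<Rightarrow> real \<Rightarrow> real"
    and \<mu> :: "(real^'n) set \<Rightarrow> real"
    and u\<^sub>0 :: "real^'n \<Rightarrow> real"
    and hbar :: real
  assumes A1_bounded: "bounded ((\<lambda>(r, q). f r q) ` (UNIV \<times> {0..}))"
    and A1_continuous: "continuous_on (UNIV \<times> {0..}) (\<lambda>(r, q). f r q)"
    and A1_modulus: "\<exists>\<omega>. modulus_of_continuity \<omega> \<and>
          (\<forall>r. \<forall>q\<^sub>1\<ge>0. \<forall>q\<^sub>2\<ge>0. \<bar>f r q\<^sub>1 - f r q\<^sub>2\<bar> \<le> \<omega> \<bar>q\<^sub>1 - q\<^sub>2\<bar>)"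
    and A2_mono_r: "\<And>r\<^sub>1 r\<^sub>2 q. r\<^sub>1 < r\<^sub>2 \<Longrightarrow> 0 \<le> q \<Longrightarrow> f r\<^sub>1 q \<le> f r\<^sub>2 q"
    and A2_strict_mono_q: "\<And>r q\<^sub>1 q\<^sub>2. 0 \<le> q\<^sub>1 \<Longrightarrow> q\<^sub>1 < q\<^sub>2 \<Longrightarrow> f r q\<^sub>1 < f r q\<^sub>2"
    and A3: "\<exists>\<Theta>. integrable lebesgue \<Theta> \<and> (\<forall>x. \<Theta> x > 0) \<and>
          (\<forall>A\<in>sets lebesgue. \<mu> A = (LINT x:A|lebesgue. \<Theta> x))"
    and A4_uniform: "uniformly_continuous_on UNIV u\<^sub>0"
    and A4_limit: "\<exists>L. ((\<lambda>R::real. INF y\<in>{y. norm y \<ge> R}. ereal (u\<^sub>0 y)) \<longlongrightarrow> L) at_top \<and>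
          (\<forall>x. L > ereal (u\<^sub>0 x))"
    and hbar_D: "f hbar (\<mu> {x. u\<^sub>0 x < hbar}) \<le> 0"
    and hbar_E: "0 \<le> f hbar (\<mu> {x. u\<^sub>0 x \<le> hbar})"
  shows "(\<forall>x. \<forall>t\<ge>0. u_D f \<mu> u\<^sub>0 hbar (x, t) = u_E f \<mu> u\<^sub>0 hbar (x, t)) \<and>
         continuous_Cauchy_solution f \<mu> u\<^sub>0 (u_D f \<mu> u\<^sub>0 hbar) \<and>
         linear_growth (u_D f \<mu> u\<^sub>0 hbar) \<and>
         (\<forall>v. continuous_Cauchy_solution f \<mu> u\<^sub>0 v \<and> linear_growth v \<longrightarrow>
              (\<forall>x. \<forall>t\<ge>0. v (x, t) = u_D f \<mu> u\<^sub>0 hbar (x, t)))"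

proof -
  obtain \<Theta> where int: "integrable lebesgue \<Theta>" and pos: "\<And>x. 0 < \<Theta> x"
    and \<mu>: "\<And>A. A \<in> sets lebesgue \<Longrightarrow> \<mu> A = (LINT x:A|lebesgue. \<Theta> x)"
    using A3 by blast
  have borel: "A \<in> sets lebesgue" if "A \<in> sets borel" for A :: "(real^'n) set"
    using that by simp
  have ind: "set_integrable lebesgue A \<Theta>" if "A \<in> sets borel" for A
    unfolding set_integrable_def using integrable_mult_indicator[OF borel[OF that] int] .
  have nonneg: "0 \<le> \<mu> A" if "A \<in> sets borel" for A
    using pos by (simp add: \<mu>[OF borel[OF that]] set_lebesgue_integral_def less_imp_le)
  have union: "\<mu> (A \<union> B) = \<mu> A + \<mu> B" if "A \<in> sets borel" "B \<in> sets borel" "A \<inter> B = {}" for A B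
    using set_integral_Un[OF that(3) ind[OF that(1)] ind[OF that(2)]] that
    by (simp add: \<mu> borel)
  have compl: "\<mu> (- A) = \<mu> UNIV - \<mu> A" if "A \<in> sets borel" for A
    using union[of A "- A"] that by (simp add: borel_comp)
  have mono: "\<mu> A \<le> \<mu> B" if "A \<in> sets borel" "B \<in> sets borel" "A \<subseteq> B" for A B
    using union[of A "B - A"] nonneg[of "B - A"] that by (simp add: Un_absorb1)
  obtain C where C: "\<And>r q. 0 \<le> q \<Longrightarrow> \<bar>f r q\<bar> \<le> C"
    using A1_bounded unfolding bounded_iff by fastforce
  interpret nonlocal_front f \<mu> u\<^sub>0 hbar C
  proof unfold_locales
    show "\<bar>f r q\<bar> \<le> C" if "0 \<le> q" "q \<le> \<mu> UNIV" for r q using C that by simp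
    show "continuous_on (UNIV \<times> {0..\<mu> UNIV}) (\<lambda>(r, q). f r q)"
      by (rule continuous_on_subset[OF A1_continuous]) auto
    show "f r q \<le> f r' q" if "r < r'" "0 \<le> q" "q \<le> \<mu> UNIV" for r r' q
      using A2_mono_r that by simp
    show "f r q < f r q'" if "0 \<le> q" "q < q'" "q' \<le> \<mu> UNIV" for r q q'
      using A2_strict_mono_q that by simp
    show "0 \<le> \<mu> A" if "A \<in> sets borel" for A using that by (rule nonneg)
    show "\<mu> (- A) = \<mu> UNIV - \<mu> A" if "A \<in> sets borel" for A using that by (rule compl)
    show "\<mu> A \<le> \<mu> B" if "A \<in> sets borel" "B \<in> sets borel" "A \<subseteq> B" for A B using that by (rule mono)
    show "\<mu> A < \<mu> B" if "A \<in> sets borel" "B \<in> sets borel" "A \<subseteq> B" "open U" "U \<noteq> {}" "U \<subseteq> B - A" for A B U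
      using set_integral_strict_mono_open[OF int pos _ _ that(3-6)] that(1,2) by (simp add: \<mu> borel)
    show "(\<lambda>k. \<mu> (A k)) \<longlonglongrightarrow> \<mu> (\<Union>k. A k)" if A: "\<And>k::nat. A k \<in> sets borel" "incseq A" for A
    proof -
      have U: "(\<Union>k. A k) \<in> sets borel" using A by auto
      show ?thesis
        using set_integral_cont_up[OF borel[OF A(1)] A(2) ind[OF U]]
        by (simp add: \<mu>[OF borel[OF A(1)]] \<mu>[OF borel[OF U]])
    qed
  qed (fact A4_uniform hbar_D hbar_E)+
  have eq: "u_D f \<mu> u\<^sub>0 hbar (x, t) = u_E f \<mu> u\<^sub>0 hbar (x, t)" if "0 \<le> t" for x t
    by (rule u_E_eq_u[OF that, symmetric])
  show ?thesis
    using eq u_solution u_linear_growth solution_unique by blast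
qed

end
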